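(* Let $(\Omega,\Sigma,\mu)$ be a probability space and let $(X_n)_{n\in\mathbb{N}}$ be a sequence of Banach spaces having property $(\delta\mathcal{S}_\mu)$. Then the $\ell^r$-sum $\ell^r(X_n)$ has property $(\delta\mathcal{S}_\mu)$ for every $1\le r<\infty$.
   Context: Banach spaces are real. The $\ell^r$-sum $\ell^r(X_n)$ ($1\le r<\infty$) is the Banach space of all sequences $(x_n)\in\prod_{n\in\mathbb{N}}X_n$ with $\|(x_n)\|_{\ell^r(X_n)}=\big(\sum_{n\in\mathbb{N}}\|x_n\|_{X_n}^r\big)^{1/r}<\infty$. For a Banach space $X$, $L^1(\mu,X)$ is the Lebesgue-Bochner space of (equivalence classes of) Bochner integrable functions $f:\Omega\to X$ with norm $\int_\Omega\|f(\cdot)\|_X\,d\mu$. For $f\in L^1(\mu,X)$ and a Borel set $C\subseteq X$, $\mu(f^{-1}(C))$ is computed with any $\Sigma$-$\mathrm{Borel}(X)$ measurable representative of $f$. A set $K\subseteq L^1(\mu,X)$ is uniformly integrable if it is bounded and for every $\varepsilon>0$ there is $\delta>0$ such that $\sup_{f\in K}\int_A\|f(\cdot)\|_X\,d\mu\le\varepsilon$ for every $A\in\Sigma$ with $\mu(A)\le\delta$. A set $K\subseteq L^1(\mu,X)$ is a $\delta\mathcal{S}$-set if it is uniformly integrable and for every $\delta>0$ there is a weakly compact set $W\subseteq X$ such that $\mu(f^{-1}(W))\ge 1-\delta$ for every $f\in K$. $X$ has property $(\delta\mathcal{S}_\mu)$ if every relatively weakly compact subset of $L^1(\mu,X)$ is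 a $\delta\mathcal{S}$-set. *)

theory Defs
  imports
    "HOL-Probability.Probability"
    "HOL-Algebra.Module"
begin

text \<open>
  A sequence of Banach spaces consists of unrelated spaces, and neither an \<open>\<ell>\<^sup>r\<close>-sum of such a
  sequence nor a space of classes of functions is a type.  Banach spaces are therefore carrier-based:
  a module of HOL-Algebra over the ring of real numbers, together with a norm.  The fields
  \<open>mult\<close> and \<open>one\<close>, which the record type \<open>module\<close> inherits from \<open>ring\<close>, are never looked at.
\<close>

definition real_ring :: "real ring" where
  "real_ring = \<lparr>carrier = UNIV, monoid.mult = (*), one = 1, zero = 0, add = (+)\<rparr>"

record 'a normed_module = "(real, 'a) module" +
  vnorm :: "'a \<Rightarrow> real"

locale normed_space =
  module real_ring X for X :: "('a, 'm) normed_module_scheme" (structure) +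
  assumes vnorm_eq_zero: "x \<in> carrier X \<Longrightarrow> vnorm X x = 0 \<longleftrightarrow> x = \<zero>\<^bsub>X\<^esub>"
    and vnorm_smult: "x \<in> carrier X \<Longrightarrow> vnorm X (a \<odot>\<^bsub>X\<^esub> x) = \<bar>a\<bar> * vnorm X x"
    and vnorm_triangle:
      "x \<in> carrier X \<Longrightarrow> y \<in> carrier X \<Longrightarrow> vnorm X (x \<oplus>\<^bsub>X\<^esub> y) \<le> vnorm X x + vnorm X y"

text \<open>
  The locale \<open>Metric_space\<close> requires a metric to be symmetric and nonnegative off the carrier, too.
\<close>

definition norm_dist :: "('a, 'm) normed_module_scheme \<Rightarrow> 'a \<Rightarrow> 'a \<Rightarrow> real" where
  "norm_dist X x y =
     (if x \<in> carrier X \<and> y \<in> carrier X then vnorm X (x \<ominus>\<^bsub>X\<^esub> y) else 0)"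

locale banach_space = normed_space +
  assumes mcomplete: "Metric_space.mcomplete (carrier X) (norm_dist X)"

lemma (in normed_space) vnorm_nonneg:
  assumes x: "x \<in> carrier X"
  shows "0 \<le> vnorm X x"
proof -
  have one: "\<one>\<^bsub>real_ring\<^esub> = 1"
    by (simp add: real_ring_def)
  have minus: "vnorm X (\<ominus>\<^bsub>X\<^esub> x) = vnorm X x"
  proof -
    have "\<ominus>\<^bsub>X\<^esub> x = (\<ominus>\<^bsub>real_ring\<^esub> 1) \<odot>\<^bsub>X\<^esub> x"
      using smult_l_minus[of 1 x] x smult_one[OF x] unfolding one
      by (simp add: real_ring_def)
    also have "\<ominus>\<^bsub>real_ring\<^esub> 1 = (-1 :: real)"
      by (rule R.minus_equality) (auto simp: real_ring_def)
    finally show ?thesis using vnorm_smult[OF x, of "-1"] by simp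
  qed
  have "0 = vnorm X (x \<oplus>\<^bsub>X\<^esub> \<ominus>\<^bsub>X\<^esub> x)"
    using vnorm_eq_zero[of "\<zero>\<^bsub>X\<^esub>"] x by (simp add: M.r_neg)
  also have "\<dots> \<le> vnorm X x + vnorm X x"
    using vnorm_triangle[of x "\<ominus>\<^bsub>X\<^esub> x"] x minus by simp
  finally show ?thesis by simp
qed

definition norm_topology :: "('a, 'm) normed_module_scheme \<Rightarrow> 'a topology" where
  "norm_topology X = Metric_space.mtopology (carrier X) (norm_dist X)"

definition norm_borel :: "('a, 'm) normed_module_scheme \<Rightarrow> 'a measure" where
  "norm_borel X = sigma (carrier X) {U. openin (norm_topology X) U}"

text \<open>Elements of the dual space; their values off the carrier are arbitrary and never used.\<close>

definition bounded_functionals :: "('a, 'm) normed_module_scheme \<Rightarrow> ('a \<Rightarrow> real) set" where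
  "bounded_functionals X = {\<phi>.
     (\<forall>x\<in>carrier X. \<forall>y\<in>carrier X. \<phi> (x \<oplus>\<^bsub>X\<^esub> y) = \<phi> x + \<phi> y) \<and>
     (\<forall>a. \<forall>x\<in>carrier X. \<phi> (a \<odot>\<^bsub>X\<^esub> x) = a * \<phi> x) \<and>
     (\<exists>B. \<forall>x\<in>carrier X. \<bar>\<phi> x\<bar> \<le> B * vnorm X x)}"

definition weak_topology :: "('a, 'm) normed_module_scheme \<Rightarrow> 'a topology" where
  "weak_topology X = topology_generated_by
     {{x \<in> carrier X. \<phi> x \<in> U} | \<phi> U. \<phi> \<in> bounded_functionals X \<and> open U}"

definition weakly_compact :: "('a, 'm) normed_module_scheme \<Rightarrow> 'a set \<Rightarrow> bool" where
  "weakly_compact X W \<longleftrightarrow> compactin (weak_topology X) W"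

definition relatively_weakly_compact :: "('a, 'm) normed_module_scheme \<Rightarrow> 'a set \<Rightarrow> bool" where
  "relatively_weakly_compact X K \<longleftrightarrow>
     K \<subseteq> carrier X \<and> compactin (weak_topology X) (weak_topology X closure_of K)"

definition lr_sum :: "real \<Rightarrow> (nat \<Rightarrow> 'a normed_module) \<Rightarrow> (nat \<Rightarrow> 'a) normed_module" where
  "lr_sum r X = \<lparr>
     carrier = {x. (\<forall>n. x n \<in> carrier (X n)) \<and> summable (\<lambda>n. vnorm (X n) (x n) powr r)},
     monoid.mult = undefined,
     one = undefined,
     zero = (\<lambda>n. \<zero>\<^bsub>X n\<^esub>),
     add = (\<lambda>x y n. x n \<oplus>\<^bsub>X n\<^esub> y n),
     smult = (\<lambda>a x n. a \<odot>\<^bsub>X n\<^esub> x n),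
     vnorm = (\<lambda>x. (\<Sum>n. vnorm (X n) (x n) powr r) powr (1 / r))\<rparr>"

text \<open>
  The measure \<open>M\<close> is a probability measure below, so no support condition on simple functions is
  needed.  The Bochner integral of HOL-Analysis does not apply, because it
  needs a separable space that is a type.
\<close>

definition simple_into ::
    "'w measure \<Rightarrow> ('a, 'm) normed_module_scheme \<Rightarrow> ('w \<Rightarrow> 'a) \<Rightarrow> bool" where
  "simple_into M X s \<longleftrightarrow> simple_function M s \<and> s \<in> space M \<rightarrow> carrier X"

definition strongly_measurable ::
    "'w measure \<Rightarrow> ('a, 'm) normed_module_scheme \<Rightarrow> ('w \<Rightarrow> 'a) \<Rightarrow> bool" where
  "strongly_measurable M X f \<longleftrightarrow>
     f \<in> space M \<rightarrow> carrier X \<and>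
     (\<exists>s. (\<forall>i. simple_into M X (s i)) \<and>
          (AE w in M. (\<lambda>i. vnorm X (f w \<ominus>\<^bsub>X\<^esub> s i w)) \<longlonglongrightarrow> 0))"

definition bochner_integrable ::
    "'w measure \<Rightarrow> ('a, 'm) normed_module_scheme \<Rightarrow> ('w \<Rightarrow> 'a) \<Rightarrow> bool" where
  "bochner_integrable M X f \<longleftrightarrow>
     strongly_measurable M X f \<and>
     (\<exists>s. (\<forall>i. simple_into M X (s i)) \<and>
          (\<lambda>i. \<integral>\<^sup>+w. ennreal (vnorm X (f w \<ominus>\<^bsub>X\<^esub> s i w)) \<partial>M) \<longlonglongrightarrow> 0)"

definition ae_class ::
    "'w measure \<Rightarrow> ('a, 'm) normed_module_scheme \<Rightarrow> ('w \<Rightarrow> 'a) \<Rightarrow> ('w \<Rightarrow> 'a) set" where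
  "ae_class M X f = {g. bochner_integrable M X g \<and> (AE w in M. g w = f w)}"

text \<open>
  For a class \<open>F\<close>, this is the integral over \<open>A\<close> of the norm of any representative.  The measure
  need not be complete, so a representative need only be almost everywhere equal to a measurable
  function; nonnegative integrals are invariant under such changes.
\<close>

definition class_integral ::
    "'w measure \<Rightarrow> ('a, 'm) normed_module_scheme \<Rightarrow> 'w set \<Rightarrow> ('w \<Rightarrow> 'a) set \<Rightarrow> ennreal" where
  "class_integral M X A F = (\<integral>\<^sup>+w\<in>A. ennreal (vnorm X ((SOME f. f \<in> F) w)) \<partial>M)"

definition L1 ::
    "'w measure \<Rightarrow> ('a, 'm) normed_module_scheme \<Rightarrow> ('w \<Rightarrow> 'a) set normed_module" where
  "L1 M X = \<lparr>
     carrier = {ae_class M X f | f. bochner_integrable M X f},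
     monoid.mult = undefined,
     one = undefined,
     zero = ae_class M X (\<lambda>_. \<zero>\<^bsub>X\<^esub>),
     add = (\<lambda>F G. ae_class M X (\<lambda>w. (SOME f. f \<in> F) w \<oplus>\<^bsub>X\<^esub> (SOME g. g \<in> G) w)),
     smult = (\<lambda>a F. ae_class M X (\<lambda>w. a \<odot>\<^bsub>X\<^esub> (SOME f. f \<in> F) w)),
     vnorm = (\<lambda>F. enn2real (class_integral M X (space M) F))\<rparr>"

definition uniformly_integrable ::
    "'w measure \<Rightarrow> ('a, 'm) normed_module_scheme \<Rightarrow> ('w \<Rightarrow> 'a) set set \<Rightarrow> bool" where
  "uniformly_integrable M X K \<longleftrightarrow>
     K \<subseteq> carrier (L1 M X) \<and>
     (\<exists>B. \<forall>F\<in>K. vnorm (L1 M X) F \<le> B) \<and>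
     (\<forall>\<epsilon>>0. \<exists>\<delta>>0. \<forall>A\<in>sets M. measure M A \<le> \<delta> \<longrightarrow>
        (SUP F\<in>K. class_integral M X A F) \<le> ennreal \<epsilon>)"

text \<open>
  Every class in the carrier of \<open>L1 M X\<close> has a Borel measurable representative, and weakly compact
  sets are norm closed; hence the universal quantification over such representatives is never
  vacuous, and the preimage is a measurable set whose measure does not depend on the representative.
\<close>

definition delta_S_set ::
    "'w measure \<Rightarrow> ('a, 'm) normed_module_scheme \<Rightarrow> ('w \<Rightarrow> 'a) set set \<Rightarrow> bool" where
  "delta_S_set M X K \<longleftrightarrow>
     uniformly_integrable M X K \<and>
     (\<forall>\<delta>>0. \<exists>W. weakly_compact X W \<and>
        (\<forall>F\<in>K. \<forall>f\<in>F. f \<in> measurable M (norm_borel X) \<longrightarrow>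
           measure M (f -` W \<inter> space M) \<ge> 1 - \<delta>))"

definition property_delta_S ::
    "'w measure \<Rightarrow> ('a, 'm) normed_module_scheme \<Rightarrow> bool" where
  "property_delta_S M X \<longleftrightarrow>
     (\<forall>K. relatively_weakly_compact (L1 M X) K \<longrightarrow> delta_S_set M X K)"

end

theory Submission
  imports Defs
begin

text \<open>
  Write \<open>Y\<close> for the \<open>\<ell>\<^sup>r\<close>-sum and let \<open>K\<close> be relatively weakly compact in \<open>L\<^sup>1(\<mu>,Y)\<close>.  Composition with the
  \<open>n\<close>-th coordinate is a contraction from \<open>L\<^sup>1(\<mu>,Y)\<close> to \<open>L\<^sup>1(\<mu>,X\<^sub>n)\<close>, so it maps \<open>K\<close> to a relatively weakly
  compact set; the hypothesis on \<open>X\<^sub>n\<close> then gives a weakly compact \<open>W\<^sub>n\<close> that contains \<open>f(w)\<^sub>n\<close> outside a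
  set of measure at most \<open>d 2\<^bsup>-n-1\<^esup>\<close>, for every \<open>f\<close> in \<open>K\<close> (\<open>coordinate_boxes\<close>).  The set of all \<open>y\<close> in \<open>Y\<close> with
  \<open>y\<^sub>n \<in> W\<^sub>n\<close> for every \<open>n\<close> is in general too large to be weakly compact.  It becomes weakly compact as
  soon as the tails of its elements are suitably controlled, because a bounded functional on \<open>Y\<close> is
  then a uniform limit, on that set, of functionals of finitely many coordinates, so that compactness
  in the product of the weak topologies (Tychonoff) carries over (\<open>weakly_compact_tail_box\<close>).

  For \<open>r > 1\<close> a bound on the norm controls enough: on bounded sets every functional is small on tails,
  since \<open>k\<close> disjoint blocks of norm at most \<open>R\<close> add up to a vector of norm at most \<open>k\<^bsup>1/r\<^esup> R\<close> only
  (\<open>functional_tail_uniform\<close>).  By Markov's inequality and the boundedness of \<open>K\<close>, the bound holds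
  outside a small set.  For \<open>r = 1\<close> the norms of the tails themselves must tend to zero uniformly on
  the set, and this is a property of \<open>K\<close>: restricting to tails defines projections on
  \<open>L\<^sup>1(\<mu>,\<ell>\<^sup>1(X\<^sub>n))\<close> along which the norm is additive, and such projections tend to zero uniformly on
  relatively weakly compact sets (\<open>uniform_decay_of_L_projections\<close>).

  The same theorem, applied to restrictions to sets of small measure, shows that relatively weakly
  compact subsets of \<open>L\<^sup>1(\<mu>,Y)\<close> are uniformly integrable.  It rests on the classical fact that weakly
  compact subsets of \<open>\<ell>\<^sup>1\<close> have uniformly small tails, which is proved by a gliding hump along
  weak cluster points of sequences (\<open>gliding_hump\<close>).  The functionals that it uses come from the
  Hahn-Banach theorem (\<open>norming_functional\<close>).
\<close>

section \<open>Real normed spaces and norming functionals\<close>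

lemma real_ring_simps [simp]:
  "carrier real_ring = UNIV" "x \<oplus>\<^bsub>real_ring\<^esub> y = x + y" "x \<otimes>\<^bsub>real_ring\<^esub> y = x * y"
  "\<one>\<^bsub>real_ring\<^esub> = 1" "\<zero>\<^bsub>real_ring\<^esub> = 0"
  by (simp_all add: real_ring_def)

lemma cring_real_ring: "cring real_ring"
  by (rule cringI, rule abelian_groupI)
     (auto simp: algebra_simps intro!: comm_monoidI intro: exI[of _ "- x" for x])

context normed_space
begin

lemma smult_closed_real [simp, intro]: "x \<in> carrier X \<Longrightarrow> a \<odot> x \<in> carrier X"
  by (rule smult_closed) simp_all

lemma smult_one_real [simp]: "x \<in> carrier X \<Longrightarrow> 1 \<odot> x = x"
  using smult_one[of x] by simp

lemma smult_smult: "x \<in> carrier X \<Longrightarrow> a \<odot> (b \<odot> x) = (a * b) \<odot> x"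
  using smult_assoc1[of a b x] by simp

lemma smult_add_left: "x \<in> carrier X \<Longrightarrow> (a + b) \<odot> x = a \<odot> x \<oplus> b \<odot> x"
  using smult_l_distr[of a b x] by simp

lemma smult_add_right:
  "x \<in> carrier X \<Longrightarrow> y \<in> carrier X \<Longrightarrow> a \<odot> (x \<oplus> y) = a \<odot> x \<oplus> a \<odot> y"
  using smult_r_distr[of a x y] by simp

lemma smult_zero_left [simp]: "x \<in> carrier X \<Longrightarrow> 0 \<odot> x = \<zero>"
  using smult_l_null[of x] by simp

lemma smult_zero_right [simp]: "a \<odot> \<zero> = \<zero>"
  using smult_r_null[of a] by simp

lemma minus_eq_smult: "x \<in> carrier X \<Longrightarrow> \<ominus> x = (-1) \<odot> x"
  by (rule M.minus_equality) (auto simp: smult_add_left[of x "-1" 1, simplified, symmetric])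

lemma vnorm_zero [simp]: "vnorm X \<zero> = 0"
  by (simp add: vnorm_eq_zero)

lemma vnorm_uminus: "x \<in> carrier X \<Longrightarrow> vnorm X (\<ominus> x) = vnorm X x"
  by (simp add: minus_eq_smult vnorm_smult)

lemma minus_eq_zero_iff:
  assumes "x \<in> carrier X" "y \<in> carrier X"
  shows "x \<ominus> y = \<zero> \<longleftrightarrow> x = y"
proof
  assume "x \<ominus> y = \<zero>"
  then have "(x \<ominus> y) \<oplus> y = y" using assms by simp
  then show "x = y" using assms by (simp add: a_minus_def M.a_assoc M.l_neg)
qed (use assms in \<open>simp add: a_minus_def M.r_neg\<close>)

lemma minus_self [simp]: "x \<in> carrier X \<Longrightarrow> x \<ominus> x = \<zero>"
  by (simp add: minus_eq_zero_iff)

lemma minus_zero [simp]: "x \<in> carrier X \<Longrightarrow> x \<ominus> \<zero> = x"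
  by (simp add: a_minus_def)

lemma vnorm_minus_commute:
  assumes "x \<in> carrier X" "y \<in> carrier X"
  shows "vnorm X (x \<ominus> y) = vnorm X (y \<ominus> x)"
proof -
  have "\<ominus> (x \<ominus> y) = y \<ominus> x"
    using assms by (simp add: a_minus_def M.minus_add M.a_comm)
  then show ?thesis using vnorm_uminus[of "x \<ominus> y"] assms by simp
qed

lemma minus_add_minus:
  assumes "x \<in> carrier X" "y \<in> carrier X" "z \<in> carrier X"
  shows "(x \<ominus> y) \<oplus> (y \<ominus> z) = x \<ominus> z"
  using assms unfolding a_minus_def
  by (metis M.a_assoc M.a_inv_closed M.add.m_closed M.l_neg M.l_zero)

lemma vnorm_minus_triangle:
  assumes "x \<in> carrier X" "y \<in> carrier X" "z \<in> carrier X"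
  shows "vnorm X (x \<ominus> z) \<le> vnorm X (x \<ominus> y) + vnorm X (y \<ominus> z)"
  using vnorm_triangle[of "x \<ominus> y" "y \<ominus> z"] minus_add_minus[OF assms] assms by simp

lemma vnorm_diff_le:
  assumes "x \<in> carrier X" "y \<in> carrier X"
  shows "\<bar>vnorm X x - vnorm X y\<bar> \<le> vnorm X (x \<ominus> y)"
  using vnorm_minus_triangle[of x y \<zero>] vnorm_minus_triangle[of y x \<zero>] vnorm_minus_commute[of x y] assms
  by simp

lemma add_minus_add:
  assumes "x \<in> carrier X" "y \<in> carrier X" "x' \<in> carrier X" "y' \<in> carrier X"
  shows "(x \<oplus> y) \<ominus> (x' \<oplus> y') = (x \<ominus> x') \<oplus> (y \<ominus> y')"
  using assms by (simp add: a_minus_def M.minus_add M.a_ac)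

lemma smult_minus:
  assumes "x \<in> carrier X" "y \<in> carrier X"
  shows "a \<odot> (x \<ominus> y) = a \<odot> x \<ominus> a \<odot> y"
  using assms by (simp add: a_minus_def minus_eq_smult smult_add_right smult_smult)

subsection \<open>Functionals\<close>

lemma functional_add:
  "\<phi> \<in> bounded_functionals X \<Longrightarrow> x \<in> carrier X \<Longrightarrow> y \<in> carrier X \<Longrightarrow> \<phi> (x \<oplus> y) = \<phi> x + \<phi> y"
  by (simp add: bounded_functionals_def)

lemma functional_smult:
  "\<phi> \<in> bounded_functionals X \<Longrightarrow> x \<in> carrier X \<Longrightarrow> \<phi> (a \<odot> x) = a * \<phi> x"
  by (simp add: bounded_functionals_def)

lemma functional_zero: "\<phi> \<in> bounded_functionals X \<Longrightarrow> \<phi> \<zero> = 0"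
  using functional_smult[of \<phi> \<zero> 0] by simp

lemma functional_minus:
  "\<phi> \<in> bounded_functionals X \<Longrightarrow> x \<in> carrier X \<Longrightarrow> y \<in> carrier X \<Longrightarrow> \<phi> (x \<ominus> y) = \<phi> x - \<phi> y"
  by (simp add: a_minus_def minus_eq_smult functional_add functional_smult)

lemma functional_bound:
  assumes "\<phi> \<in> bounded_functionals X"
  obtains B where "B > 0" "\<And>x. x \<in> carrier X \<Longrightarrow> \<bar>\<phi> x\<bar> \<le> B * vnorm X x"
proof -
  obtain B where B: "\<forall>x\<in>carrier X. \<bar>\<phi> x\<bar> \<le> B * vnorm X x"
    using assms by (auto simp: bounded_functionals_def)
  have "\<bar>\<phi> x\<bar> \<le> (\<bar>B\<bar> + 1) * vnorm X x" if "x \<in> carrier X" for x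
    using B[rule_format, OF that] mult_right_mono[of B "\<bar>B\<bar> + 1" "vnorm X x"] vnorm_nonneg[OF that]
    by linarith
  then show thesis by (intro that[of "\<bar>B\<bar> + 1"]) auto
qed

lemma bounded_functionalI:
  assumes "\<And>x y. x \<in> carrier X \<Longrightarrow> y \<in> carrier X \<Longrightarrow> \<phi> (x \<oplus> y) = \<phi> x + \<phi> y"
    and "\<And>a x. x \<in> carrier X \<Longrightarrow> \<phi> (a \<odot> x) = a * \<phi> x"
    and "\<And>x. x \<in> carrier X \<Longrightarrow> \<bar>\<phi> x\<bar> \<le> B * vnorm X x"
  shows "\<phi> \<in> bounded_functionals X"
  using assms unfolding bounded_functionals_def by blast

text \<open>
  Hahn-Banach is proved by minimising rather than by extending: a minimal sublinear functional below
  the norm is automatically linear.  Homogeneity is only demanded as an inequality; equality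
  follows by applying it to \<open>1/c\<close>.
\<close>
definition sublinear :: "('a \<Rightarrow> real) \<Rightarrow> bool" where
  "sublinear p \<longleftrightarrow>
     (\<forall>x\<in>carrier X. \<forall>y\<in>carrier X. p (x \<oplus> y) \<le> p x + p y) \<and>
     (\<forall>c\<ge>0. \<forall>x\<in>carrier X. p (c \<odot> x) \<le> c * p x)"

lemma sublinear_add:
  "sublinear p \<Longrightarrow> x \<in> carrier X \<Longrightarrow> y \<in> carrier X \<Longrightarrow> p (x \<oplus> y) \<le> p x + p y"
  by (simp add: sublinear_def)

lemma sublinear_smult_le: "sublinear p \<Longrightarrow> 0 \<le> c \<Longrightarrow> x \<in> carrier X \<Longrightarrow> p (c \<odot> x) \<le> c * p x"
  by (simp add: sublinear_def)

lemma sublinear_zero: "sublinear p \<Longrightarrow> p \<zero> = 0"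
  using sublinear_smult_le[of p 0 \<zero>] sublinear_add[of p \<zero> \<zero>] by simp

lemma sublinear_smult:
  assumes p: "sublinear p" and c: "0 \<le> c" and x: "x \<in> carrier X"
  shows "p (c \<odot> x) = c * p x"
proof (cases "c = 0")
  case False
  with c have "c > 0" by simp
  have "p x \<le> (1 / c) * p (c \<odot> x)"
    using sublinear_smult_le[OF p, of "1 / c" "c \<odot> x"] \<open>c > 0\<close> x by (simp add: smult_smult)
  then have "c * p x \<le> p (c \<odot> x)" using \<open>c > 0\<close> by (simp add: field_simps)
  with sublinear_smult_le[OF p c x] show ?thesis by simp
qed (use x sublinear_zero[OF p] in simp)

lemma sublinear_lower: "sublinear p \<Longrightarrow> x \<in> carrier X \<Longrightarrow> - p (\<ominus> x) \<le> p x"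
  using sublinear_add[of p x "\<ominus> x"] sublinear_zero[of p] by (simp add: M.r_neg)

lemma sublinear_vnorm: "sublinear (vnorm X)"
  by (auto simp: sublinear_def vnorm_smult vnorm_triangle)

text \<open>
  Among the sublinear functionals \<open>q \<le> p\<close> with \<open>q (\<ominus> a) \<le> - p a\<close> this is the largest.  The value off the carrier is
  fixed, so that the pointwise order on functionals supported by the carrier is antisymmetric.
\<close>
definition tilt :: "('a \<Rightarrow> real) \<Rightarrow> 'a \<Rightarrow> 'a \<Rightarrow> real" where
  "tilt p a y = (if y \<in> carrier X then INF t\<in>{0..}. p (y \<oplus> t \<odot> a) - t * p a else 0)"

lemma tilt_le:
  assumes p: "sublinear p" and a: "a \<in> carrier X" and y: "y \<in> carrier X" and t: "0 \<le> t"
  shows "tilt p a y \<le> p (y \<oplus> t \<odot> a) - t * p a"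
proof -
  have "- p (\<ominus> y) \<le> p (y \<oplus> s \<odot> a) - s * p a" if "s \<in> {0..}" for s
  proof -
    have "(y \<oplus> s \<odot> a) \<oplus> \<ominus> y = s \<odot> a"
      using a y by (simp add: M.a_assoc M.a_comm[of "s \<odot> a"] M.r_neg1 M.r_neg2)
    then have "p (s \<odot> a) \<le> p (y \<oplus> s \<odot> a) + p (\<ominus> y)"
      using sublinear_add[OF p, of "y \<oplus> s \<odot> a" "\<ominus> y"] a y by simp
    then show ?thesis using sublinear_smult[OF p _ a, of s] that by simp
  qed
  then have "bdd_below ((\<lambda>s. p (y \<oplus> s \<odot> a) - s * p a) ` {0..})" by (rule bdd_belowI2)
  from cINF_lower[OF this, of t] show ?thesis using y t by (simp add: tilt_def)
qed

lemma tilt_greatest: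
  assumes "y \<in> carrier X" "\<And>t. 0 \<le> t \<Longrightarrow> b \<le> p (y \<oplus> t \<odot> a) - t * p a"
  shows "b \<le> tilt p a y"
  using assms by (auto simp: tilt_def intro!: cINF_greatest)

lemma tilt_le_self:
  "sublinear p \<Longrightarrow> a \<in> carrier X \<Longrightarrow> y \<in> carrier X \<Longrightarrow> tilt p a y \<le> p y"
  using tilt_le[of p a y 0] by simp

lemma tilt_uminus:
  assumes "sublinear p" "a \<in> carrier X"
  shows "tilt p a (\<ominus> a) \<le> - p a"
  using tilt_le[OF assms, of "\<ominus> a" 1] assms by (simp add: M.l_neg sublinear_zero)

lemma sublinear_tilt:
  assumes p: "sublinear p" and a: "a \<in> carrier X"
  shows "sublinear (tilt p a)"
  unfolding sublinear_def
proof (intro conjI ballI allI impI)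
  fix x y assume x: "x \<in> carrier X" and y: "y \<in> carrier X"
  have *: "tilt p a (x \<oplus> y) - (p (x \<oplus> s \<odot> a) - s * p a) \<le> p (y \<oplus> t \<odot> a) - t * p a"
    if "0 \<le> s" "0 \<le> t" for s t
  proof -
    have "(x \<oplus> y) \<oplus> (s + t) \<odot> a = (x \<oplus> s \<odot> a) \<oplus> (y \<oplus> t \<odot> a)"
      using x y a by (simp add: smult_add_left M.a_ac)
    then show ?thesis
      using tilt_le[OF p a, of "x \<oplus> y" "s + t"] sublinear_add[OF p, of "x \<oplus> s \<odot> a" "y \<oplus> t \<odot> a"] x y a that
      by (simp add: algebra_simps)
  qed
  have "tilt p a (x \<oplus> y) - (p (x \<oplus> s \<odot> a) - s * p a) \<le> tilt p a y" if "0 \<le> s" for s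
    using * that y by (intro tilt_greatest) auto
  then have "tilt p a (x \<oplus> y) - tilt p a y \<le> tilt p a x"
    using x by (intro tilt_greatest) (auto simp: algebra_simps)
  then show "tilt p a (x \<oplus> y) \<le> tilt p a x + tilt p a y" by simp
next
  fix c :: real and x assume c: "0 \<le> c" and x: "x \<in> carrier X"
  show "tilt p a (c \<odot> x) \<le> c * tilt p a x"
  proof (cases "c = 0")
    case True
    then show ?thesis using tilt_le_self[OF p a, of \<zero>] x by (simp add: sublinear_zero[OF p])
  next
    case False
    with c have "c > 0" by simp
    have "tilt p a (c \<odot> x) / c \<le> tilt p a x"
    proof (rule tilt_greatest[OF x])
      fix t :: real assume "0 \<le> t"
      have "c \<odot> x \<oplus> (c * t) \<odot> a = c \<odot> (x \<oplus> t \<odot> a)"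
        using x a by (simp add: smult_add_right smult_smult)
      then have "tilt p a (c \<odot> x) \<le> c * p (x \<oplus> t \<odot> a) - (c * t) * p a"
        using tilt_le[OF p a, of "c \<odot> x" "c * t"] sublinear_smult[OF p c, of "x \<oplus> t \<odot> a"] x a c \<open>0 \<le> t\<close> by simp
      then show "tilt p a (c \<odot> x) / c \<le> p (x \<oplus> t \<odot> a) - t * p a"
        using \<open>c > 0\<close> by (simp add: field_simps)
    qed
    then show ?thesis using \<open>c > 0\<close> by (simp add: field_simps)
  qed
qed

text \<open>
  The infimum of a chain is sublinear because any two members of the chain can be replaced by the
  smaller one.  It is finite since every member \<open>p\<close> satisfies \<open>- vnorm X x \<le> - p (\<ominus> x) \<le> p x\<close>.
\<close>
lemma sublinear_chain_Inf:
  assumes ne: "C \<noteq> {}" and sub: "\<forall>p\<in>C. sublinear p \<and> (\<forall>x\<in>carrier X. p x \<le> vnorm X x)"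
    and chain: "\<forall>p\<in>C. \<forall>q\<in>C. p \<le> q \<or> q \<le> p"
    and u: "\<forall>x\<in>carrier X. u x = (INF p\<in>C. p x)"
  shows "sublinear u" and "\<And>p x. p \<in> C \<Longrightarrow> x \<in> carrier X \<Longrightarrow> u x \<le> p x"
proof -
  have C: "sublinear p" "\<And>x. x \<in> carrier X \<Longrightarrow> p x \<le> vnorm X x" if "p \<in> C" for p
    using sub that by auto
  have bdd: "bdd_below ((\<lambda>p. p x) ` C)" if x: "x \<in> carrier X" for x
  proof (rule bdd_belowI2)
    fix p assume "p \<in> C"
    then show "- vnorm X x \<le> p x"
      using sublinear_lower[OF C(1) x, of p] C(2)[of p "\<ominus> x"] vnorm_uminus[OF x] x by fastforce
  qed
  show le: "u x \<le> p x" if "p \<in> C" "x \<in> carrier X" for p x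
    using cINF_lower[OF bdd] that u by simp
  have ge: "b \<le> u x" if "x \<in> carrier X" "\<And>p. p \<in> C \<Longrightarrow> b \<le> p x" for b x
    using that u ne by (auto intro!: cINF_greatest)
  show "sublinear u"
    unfolding sublinear_def
  proof (intro conjI ballI allI impI)
    fix x y assume x: "x \<in> carrier X" and y: "y \<in> carrier X"
    have *: "u (x \<oplus> y) \<le> p x + q y" if p: "p \<in> C" and q: "q \<in> C" for p q
      using chain[rule_format, OF p q]
    proof
      assume "p \<le> q"
      then have "p y \<le> q y" by (simp add: le_funD)
      then show ?thesis using le[OF p, of "x \<oplus> y"] sublinear_add[OF C(1)[OF p] x y] x y by simp
    next
      assume "q \<le> p"
      then have "q x \<le> p x" by (simp add: le_funD)
      then show ?thesis using le[OF q, of "x \<oplus> y"] sublinear_add[OF C(1)[OF q] x y] x y by simp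
    qed
    have "u (x \<oplus> y) - p x \<le> u y" if "p \<in> C" for p
      using *[OF that] y by (intro ge) (auto simp: algebra_simps)
    then have "u (x \<oplus> y) - u y \<le> u x"
      using x by (intro ge) (auto simp: algebra_simps)
    then show "u (x \<oplus> y) \<le> u x + u y" by simp
  next
    fix c :: real and x assume c: "0 \<le> c" and x: "x \<in> carrier X"
    show "u (c \<odot> x) \<le> c * u x"
    proof (cases "c = 0")
      case True
      obtain p where "p \<in> C" using ne by auto
      then show ?thesis using True x le[of p \<zero>] sublinear_zero[OF C(1), of p] by simp
    next
      case False
      with c have "c > 0" by simp
      have "u (c \<odot> x) / c \<le> p x" if "p \<in> C" for p
        using le[OF that, of "c \<odot> x"] sublinear_smult_le[OF C(1)[OF that] c x] x \<open>c > 0\<close>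
        by (simp add: field_simps)
      then have "u (c \<odot> x) / c \<le> u x" by (intro ge[OF x])
      then show ?thesis using \<open>c > 0\<close> by (simp add: field_simps)
    qed
  qed
qed

lemma minimal_sublinear_below:
  assumes q: "sublinear q" "\<And>x. x \<in> carrier X \<Longrightarrow> q x \<le> vnorm X x" "\<And>x. x \<notin> carrier X \<Longrightarrow> q x = 0"
  obtains f where "sublinear f" "f \<le> q" "\<And>x. x \<notin> carrier X \<Longrightarrow> f x = 0"
    "\<And>p. sublinear p \<Longrightarrow> p \<le> f \<Longrightarrow> (\<And>x. x \<notin> carrier X \<Longrightarrow> p x = 0) \<Longrightarrow> p = f"
proof -
  define A where "A = {p. sublinear p \<and> p \<le> q \<and> (\<forall>x. x \<notin> carrier X \<longrightarrow> p x = 0)}"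
  \<comment> \<open>Zorn is applied to the reversed order, in which an upper bound of a chain is its infimum.\<close>
  have "\<exists>m\<in>A. \<forall>p\<in>A. p \<le> m \<longrightarrow> p = m"
  proof (rule predicate_Zorn[where P = "\<lambda>a b. b \<le> a"])
    show "partial_order_on A (relation_of (\<lambda>a b. b \<le> a) A)"
      by (rule partial_order_on_relation_ofI) auto
    fix C assume C: "C \<in> Chains (relation_of (\<lambda>a b. b \<le> a) A)"
    then have CA: "C \<subseteq> A" by (auto simp: Chains_def relation_of_def)
    have chain: "p \<le> p' \<or> p' \<le> p" if "p \<in> C" "p' \<in> C" for p p'
      using C that by (auto simp: Chains_def relation_of_def)
    show "\<exists>u\<in>A. \<forall>a\<in>C. u \<le> a"
    proof (cases "C = {}")
      case True
      then show ?thesis using q unfolding A_def by (intro bexI[of _ q]) auto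
    next
      case False
      define u where "u x = (if x \<in> carrier X then INF p\<in>C. p x else 0)" for x
      have sub: "\<forall>p\<in>C. sublinear p \<and> (\<forall>x\<in>carrier X. p x \<le> vnorm X x)"
        using CA q(2) unfolding A_def le_fun_def by (blast intro: order_trans)
      have chain': "\<forall>p\<in>C. \<forall>p'\<in>C. p \<le> p' \<or> p' \<le> p" using chain by blast
      have Inf: "\<forall>x\<in>carrier X. u x = (INF p\<in>C. p x)" by (simp add: u_def)
      have su: "sublinear u" by (rule sublinear_chain_Inf(1)[OF False sub chain' Inf])
      have le: "u \<le> p" if "p \<in> C" for p
      proof (rule le_funI)
        fix x show "u x \<le> p x"
          using sublinear_chain_Inf(2)[OF False sub chain' Inf that, of x] CA that
          by (cases "x \<in> carrier X") (auto simp: u_def A_def)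
      qed
      obtain p where "p \<in> C" using False by auto
      then have "u \<le> q" using le[of p] CA by (auto simp: A_def)
      then show ?thesis using su le by (auto simp: A_def u_def)
    qed
  qed
  then obtain f where f: "f \<in> A" "\<And>p. p \<in> A \<Longrightarrow> p \<le> f \<Longrightarrow> p = f" by blast
  show thesis
  proof (rule that[of f])
    show "sublinear f" "f \<le> q" "\<And>x. x \<notin> carrier X \<Longrightarrow> f x = 0" using f by (auto simp: A_def)
    fix p assume "sublinear p" "p \<le> f" "\<And>x. x \<notin> carrier X \<Longrightarrow> p x = 0"
    moreover from this have "p \<in> A" using f(1) by (auto simp: A_def)
    ultimately show "p = f" using f(2) by blast
  qed
qed

text \<open>
  Let \<open>f\<close> be minimal below the norm tilted at \<open>x\<close>.  Tilting \<open>f\<close> at any \<open>a\<close> cannot make it smaller, hence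
  \<open>f (\<ominus> a) \<le> - f a\<close>; so \<open>f\<close> is odd, and an odd sublinear functional is linear.  The initial tilt forces
  \<open>f (\<ominus> x) \<le> - vnorm X x\<close>, which is the norming property.
\<close>
theorem norming_functional:
  assumes x: "x \<in> carrier X"
  obtains \<phi> where "\<phi> \<in> bounded_functionals X" "\<phi> x = vnorm X x"
    "\<And>y. y \<in> carrier X \<Longrightarrow> \<bar>\<phi> y\<bar> \<le> vnorm X y"
proof -
  note sub = sublinear_tilt[OF sublinear_vnorm x]
  obtain f where f: "sublinear f" "f \<le> tilt (vnorm X) x" and off: "\<And>y. y \<notin> carrier X \<Longrightarrow> f y = 0"
    and min: "\<And>p. sublinear p \<Longrightarrow> p \<le> f \<Longrightarrow> (\<And>y. y \<notin> carrier X \<Longrightarrow> p y = 0) \<Longrightarrow> p = f"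
  proof (rule minimal_sublinear_below[OF sub])
    show "tilt (vnorm X) x y \<le> vnorm X y" if "y \<in> carrier X" for y
      by (rule tilt_le_self[OF sublinear_vnorm x that])
  qed (auto simp: tilt_def)
  have le: "f y \<le> vnorm X y" if "y \<in> carrier X" for y
    using le_funD[OF f(2), of y] tilt_le_self[OF sublinear_vnorm x that] by simp
  have odd: "f (\<ominus> a) = - f a" if a: "a \<in> carrier X" for a
  proof -
    have "tilt f a \<le> f"
      using tilt_le_self[OF f(1) a] off by (force simp: le_fun_def tilt_def)
    then have "tilt f a = f"
      using sublinear_tilt[OF f(1) a] by (intro min) (auto simp: tilt_def)
    then show ?thesis using tilt_uminus[OF f(1) a] sublinear_lower[OF f(1) a] by simp
  qed
  have add: "f (y \<oplus> z) = f y + f z" if "y \<in> carrier X" "z \<in> carrier X" for y z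
  proof -
    have "(y \<oplus> z) \<oplus> \<ominus> z = y" using that by (simp add: M.a_assoc M.r_neg)
    then have "f y \<le> f (y \<oplus> z) + f (\<ominus> z)"
      using sublinear_add[OF f(1), of "y \<oplus> z" "\<ominus> z"] that by simp
    then show ?thesis using odd sublinear_add[OF f(1) that] that by simp
  qed
  have smult: "f (c \<odot> y) = c * f y" if y: "y \<in> carrier X" for c y
  proof (cases "0 \<le> c")
    case False
    have "c \<odot> y = \<ominus> ((- c) \<odot> y)" using y by (simp add: minus_eq_smult smult_smult)
    then show ?thesis using odd[of "(- c) \<odot> y"] sublinear_smult[OF f(1), of "- c" y] y False by simp
  qed (simp add: sublinear_smult[OF f(1) _ y])
  have abs: "\<bar>f y\<bar> \<le> vnorm X y" if "y \<in> carrier X" for y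
    using le[OF that] le[of "\<ominus> y"] odd[OF that] vnorm_uminus[OF that] that by simp
  have "f (\<ominus> x) \<le> - vnorm X x"
    using le_funD[OF f(2), of "\<ominus> x"] tilt_uminus[OF sublinear_vnorm x] by simp
  then have "f x = vnorm X x" using odd[OF x] le[OF x] by simp
  moreover have "f \<in> bounded_functionals X"
    using add smult abs by (intro bounded_functionalI[where B = 1]) auto
  ultimately show thesis using abs by (intro that[of f])
qed

end

section \<open>Weakly compact sets and the gliding hump\<close>

lemma compactin_cluster_point:
  assumes C: "compactin T C" and x: "\<And>k::nat. x k \<in> C"
  obtains z where "z \<in> C" "\<And>U n. openin T U \<Longrightarrow> z \<in> U \<Longrightarrow> \<exists>k\<ge>n. x k \<in> U"
proof (rule ccontr)
  assume "\<not> thesis"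
  then have "\<forall>z\<in>C. \<exists>U n. openin T U \<and> z \<in> U \<and> (\<forall>k\<ge>n. x k \<notin> U)"
    using that by meson
  then obtain U n where U: "\<And>z. z \<in> C \<Longrightarrow> openin T (U z) \<and> z \<in> U z \<and> (\<forall>k\<ge>n z. x k \<notin> U z)"
    by metis
  have "\<exists>\<F>. finite \<F> \<and> \<F> \<subseteq> U ` C \<and> C \<subseteq> \<Union>\<F>"
    using U by (intro compactinD[OF C]) auto
  then obtain D where D: "D \<subseteq> C" "finite D" "C \<subseteq> \<Union>(U ` D)"
    by (metis finite_subset_image)
  define k where "k = Max (insert 0 (n ` D))"
  have "n z \<le> k" if "z \<in> D" for z using that D(2) by (auto simp: k_def)
  then show False using U D x[of k] by fastforce
qed

context normed_space
begin

lemma topspace_weak_topology [simp]: "topspace (weak_topology X) = carrier X"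
proof -
  have "(\<lambda>_. 0) \<in> bounded_functionals X"
    by (rule bounded_functionalI[where B = 0]) auto
  then have "carrier X \<in> {{x \<in> carrier X. \<phi> x \<in> U} | \<phi> U. \<phi> \<in> bounded_functionals X \<and> open U}"
    using open_UNIV by (auto intro!: exI[of _ "\<lambda>_. 0"] exI[of _ UNIV])
  then show ?thesis unfolding weak_topology_def topology_generated_by_topspace by blast
qed

lemma continuous_map_functional:
  assumes "\<phi> \<in> bounded_functionals X"
  shows "continuous_map (weak_topology X) euclidean \<phi>"
  unfolding continuous_map_def
proof (intro conjI allI impI)
  fix U :: "real set" assume "openin euclidean U"
  then show "openin (weak_topology X) {x \<in> topspace (weak_topology X). \<phi> x \<in> U}"
    unfolding topspace_weak_topology unfolding weak_topology_def
    using assms by (intro topology_generated_by_Basis) auto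
qed auto

lemma openin_weak_topology_functional:
  "\<phi> \<in> bounded_functionals X \<Longrightarrow> open U \<Longrightarrow> openin (weak_topology X) {x \<in> carrier X. \<phi> x \<in> U}"
  using openin_continuous_map_preimage[OF continuous_map_functional, of \<phi> U] by simp

text \<open>
  Norming functionals separate points.  This makes weakly compact sets weakly closed, so that a subset
  of a weakly compact set is relatively weakly compact.
\<close>
lemma Hausdorff_weak_topology: "Hausdorff_space (weak_topology X)"
  unfolding Hausdorff_space_def topspace_weak_topology
proof (intro allI impI)
  fix x y assume *: "x \<in> carrier X \<and> y \<in> carrier X \<and> x \<noteq> y"
  obtain \<phi> where \<phi>: "\<phi> \<in> bounded_functionals X" "\<phi> (x \<ominus> y) = vnorm X (x \<ominus> y)"
    using norming_functional[of "x \<ominus> y"] * by auto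
  have "vnorm X (x \<ominus> y) > 0"
    using vnorm_nonneg[of "x \<ominus> y"] vnorm_eq_zero[of "x \<ominus> y"] * by (simp add: minus_eq_zero_iff order_less_le)
  then have "\<phi> y < \<phi> x" using \<phi> * by (simp add: functional_minus)
  then obtain m where m: "\<phi> y < m" "m < \<phi> x" using dense by blast
  show "\<exists>U V. openin (weak_topology X) U \<and> openin (weak_topology X) V \<and> x \<in> U \<and> y \<in> V \<and> disjnt U V"
    using m * openin_weak_topology_functional[OF \<phi>(1), of "{m<..}"] openin_weak_topology_functional[OF \<phi>(1), of "{..<m}"]
    by (intro exI[of _ "{x \<in> carrier X. \<phi> x \<in> {m<..}}"] exI[of _ "{x \<in> carrier X. \<phi> x \<in> {..<m}}"])
       (auto simp: disjnt_def)
qed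

lemma relatively_weakly_compactD:
  assumes "relatively_weakly_compact X K"
  obtains C where "weakly_compact X C" "K \<subseteq> C" "C \<subseteq> carrier X"
  using assms closure_of_subset[of K "weak_topology X"] closure_of_subset_topspace[of "weak_topology X" K]
  by (intro that[of "weak_topology X closure_of K"])
     (auto simp: relatively_weakly_compact_def weakly_compact_def)

lemma relatively_weakly_compactI:
  assumes "weakly_compact X C" "K \<subseteq> C"
  shows "relatively_weakly_compact X K"
proof -
  have C: "compactin (weak_topology X) C" using assms by (simp add: weakly_compact_def)
  have "closedin (weak_topology X) C"
    by (rule compactin_imp_closedin[OF Hausdorff_weak_topology C])
  then have "weak_topology X closure_of K \<subseteq> C"
    using assms(2) by (simp add: closure_of_minimal)
  then have "compactin (weak_topology X) (weak_topology X closure_of K)"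
    using closed_compactin[OF C] by simp
  moreover have "K \<subseteq> carrier X" using compactin_subset_topspace[OF C] assms(2) by simp
  ultimately show ?thesis by (simp add: relatively_weakly_compact_def)
qed

text \<open>
  Finitely many functionals define a weak neighbourhood of a cluster point, so the sequence returns
  to any prescribed accuracy in all of them at once, at arbitrarily late indices.
\<close>
lemma weak_cluster_point:
  assumes C: "weakly_compact X C" and x: "\<And>k::nat. x k \<in> C"
  obtains z where "z \<in> carrier X"
    "\<And>\<Phi> n \<epsilon>. finite \<Phi> \<Longrightarrow> \<Phi> \<subseteq> bounded_functionals X \<Longrightarrow> \<epsilon> > 0 \<Longrightarrow> \<exists>k\<ge>n. \<forall>\<phi>\<in>\<Phi>. \<bar>\<phi> (x k) - \<phi> z\<bar> < \<epsilon>"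
proof -
  have C': "compactin (weak_topology X) C" using C by (simp add: weakly_compact_def)
  have CX: "C \<subseteq> carrier X" using compactin_subset_topspace[OF C'] by simp
  obtain z where z: "z \<in> C"
    and cl: "\<And>U n. openin (weak_topology X) U \<Longrightarrow> z \<in> U \<Longrightarrow> \<exists>k\<ge>n. x k \<in> U"
    using compactin_cluster_point[where x = x, OF C' x] by metis
  show thesis
  proof (rule that[of z])
    show "z \<in> carrier X" using z CX by auto
    fix \<Phi> and n :: nat and \<epsilon> :: real
    assume \<Phi>: "finite \<Phi>" "\<Phi> \<subseteq> bounded_functionals X" and \<epsilon>: "\<epsilon> > 0"
    define V where "V \<phi> = {y \<in> carrier X. \<phi> y \<in> ball (\<phi> z) \<epsilon>}" for \<phi> :: "'a \<Rightarrow> real"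
    have "openin (weak_topology X) (topspace (weak_topology X) \<inter> \<Inter>(V ` \<Phi>))"
      using \<Phi> openin_weak_topology_functional unfolding V_def
      by (intro openin_Int_Inter openin_topspace) (auto simp del: mem_ball)
    moreover have "z \<in> topspace (weak_topology X) \<inter> \<Inter>(V ` \<Phi>)"
      using z CX \<epsilon> by (auto simp: V_def)
    ultimately obtain k where "k \<ge> n" "x k \<in> topspace (weak_topology X) \<inter> \<Inter>(V ` \<Phi>)"
      using cl by blast
    then show "\<exists>k\<ge>n. \<forall>\<phi>\<in>\<Phi>. \<bar>\<phi> (x k) - \<phi> z\<bar> < \<epsilon>"
      by (intro exI[of _ k]) (auto simp: V_def dist_real_def abs_minus_commute)
  qed
qed

lemma summable_functionals:
  assumes "\<And>n. (\<Sum>j<n. \<bar>\<psi> j y\<bar>) \<le> vnorm X y"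
  shows "summable (\<lambda>j. \<bar>\<psi> j y\<bar>)" "(\<Sum>j. \<bar>\<psi> j y\<bar>) \<le> vnorm X y"
proof -
  show s: "summable (\<lambda>j. \<bar>\<psi> j y\<bar>)"
    using assms by (intro bounded_imp_summable[where B = "vnorm X y"])
      (auto simp: lessThan_Suc_atMost[symmetric] simp del: sum.lessThan_Suc)
  show "(\<Sum>j. \<bar>\<psi> j y\<bar>) \<le> vnorm X y"
    using assms by (intro suminf_le_const s)
qed

text \<open>
  The bound on the partial sums says that \<open>y \<mapsto> (\<psi> j y)\<close> is a contraction into \<open>\<ell>\<^sup>1\<close>; pairing it with a
  bounded sequence \<open>a\<close> is therefore a bounded functional.
\<close>
lemma suminf_functional:
  assumes \<psi>: "\<And>j::nat. \<psi> j \<in> bounded_functionals X"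
    and sum: "\<And>y n. y \<in> carrier X \<Longrightarrow> (\<Sum>j<n. \<bar>\<psi> j y\<bar>) \<le> vnorm X y"
    and a: "\<And>j. \<bar>a j\<bar> \<le> 1"
  shows "(\<lambda>y. \<Sum>j. a j * \<psi> j y) \<in> bounded_functionals X"
    and "\<And>y. y \<in> carrier X \<Longrightarrow> summable (\<lambda>j. a j * \<psi> j y)"
proof -
  have le: "\<bar>a j * \<psi> j y\<bar> \<le> \<bar>\<psi> j y\<bar>" for j y
    using a[of j] by (simp add: abs_mult mult_left_le_one_le)
  have abs: "summable (\<lambda>j. \<bar>a j * \<psi> j y\<bar>)" if "y \<in> carrier X" for y
    using le by (intro summable_comparison_test'[OF summable_functionals(1)[of \<psi> y, OF sum[OF that]], of 0]) auto
  show s: "summable (\<lambda>j. a j * \<psi> j y)" if "y \<in> carrier X" for y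
    using abs[OF that] by (rule summable_rabs_cancel)
  show "(\<lambda>y. \<Sum>j. a j * \<psi> j y) \<in> bounded_functionals X"
  proof (rule bounded_functionalI[where B = 1])
    fix x y assume "x \<in> carrier X" "y \<in> carrier X"
    then show "(\<Sum>j. a j * \<psi> j (x \<oplus> y)) = (\<Sum>j. a j * \<psi> j x) + (\<Sum>j. a j * \<psi> j y)"
      by (subst suminf_add) (auto intro!: s simp: functional_add[OF \<psi>] algebra_simps)
  next
    fix c x assume "x \<in> carrier X"
    then show "(\<Sum>j. a j * \<psi> j (c \<odot> x)) = c * (\<Sum>j. a j * \<psi> j x)"
      by (subst suminf_mult[symmetric]) (auto intro!: s simp: functional_smult[OF \<psi>] algebra_simps)
  next
    fix x assume x: "x \<in> carrier X"
    have "\<bar>\<Sum>j. a j * \<psi> j x\<bar> \<le> (\<Sum>j. \<bar>a j * \<psi> j x\<bar>)"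
      by (rule summable_rabs[OF abs[OF x]])
    also have "\<dots> \<le> (\<Sum>j. \<bar>\<psi> j x\<bar>)"
      by (rule suminf_le[OF le abs[OF x] summable_functionals(1)[of \<psi> x, OF sum[OF x]]])
    also have "\<dots> \<le> vnorm X x" by (rule summable_functionals(2)[of \<psi> x, OF sum[OF x]])
    finally show "\<bar>\<Sum>j. a j * \<psi> j x\<bar> \<le> 1 * vnorm X x" by simp
  qed
qed

text \<open>
  Suppose that \<open>\<psi> k (x k) \<ge> \<epsilon>\<close> for every \<open>k\<close>, and let \<open>z\<close> be a weak cluster point of \<open>x\<close>.  One can pick indices
  \<open>\<kappa> 0 < \<kappa> 1 < \<dots>\<close> such that, viewed in \<open>\<ell>\<^sup>1\<close>, the difference of \<open>x (\<kappa> (i + 1))\<close> and \<open>z\<close> has little mass in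
  the coordinates up to \<open>\<kappa> i\<close> and in those from \<open>\<kappa> (i + 2)\<close> on.  Summing the coordinates \<open>\<kappa> i\<close> gives a
  functional that stays away from its value at \<open>z\<close> along the subsequence.  But a weak cluster point of
  the subsequence has the same \<open>\<ell>\<^sup>1\<close>-coordinates as \<open>z\<close>, which is a contradiction.
\<close>
theorem gliding_hump:
  assumes C: "weakly_compact X C" and x: "\<And>k::nat. x k \<in> C"
    and \<psi>: "\<And>k. \<psi> k \<in> bounded_functionals X"
    and sum: "\<And>y n. y \<in> carrier X \<Longrightarrow> (\<Sum>j<n. \<bar>\<psi> j y\<bar>) \<le> vnorm X y"
    and \<epsilon>: "\<epsilon> > 0"
  shows "\<exists>k. \<psi> k (x k) < \<epsilon>"
proof (rule ccontr)
  assume "\<not> ?thesis"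
  then have large: "\<epsilon> \<le> \<psi> k (x k)" for k by (simp add: not_less)
  have xX: "x k \<in> carrier X" for k
    using x compactin_subset_topspace C by (fastforce simp: weakly_compact_def)
  obtain z where z: "z \<in> carrier X"
    and cl: "\<And>\<Phi> n \<epsilon>. finite \<Phi> \<Longrightarrow> \<Phi> \<subseteq> bounded_functionals X \<Longrightarrow> \<epsilon> > 0 \<Longrightarrow>
        \<exists>k\<ge>n. \<forall>\<phi>\<in>\<Phi>. \<bar>\<phi> (x k) - \<phi> z\<bar> < \<epsilon>"
    using weak_cluster_point[of C x, OF C x] by metis
  define D where "D k j = \<psi> j (x k) - \<psi> j z" for k j
  have D_eq: "D k j = \<psi> j (x k \<ominus> z)" for k j
    by (simp add: D_def functional_minus[OF \<psi>] xX z)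
  have sD: "summable (\<lambda>j. \<bar>D k j\<bar>)" for k
    unfolding D_eq using xX z by (intro summable_functionals sum) auto
  have "(\<lambda>j. \<psi> j z) \<longlonglongrightarrow> 0"
    using summable_LIMSEQ_zero[OF summable_functionals(1)[of \<psi> z, OF sum[OF z]]] by (simp add: tendsto_rabs_zero_iff)
  then have "\<forall>\<^sub>F j in sequentially. \<psi> j z < \<epsilon> / 4"
    using \<epsilon> by (intro order_tendstoD) auto
  then obtain k0 where k0: "\<And>j. j \<ge> k0 \<Longrightarrow> \<psi> j z < \<epsilon> / 4"
    by (auto simp: eventually_sequentially)
  \<comment> \<open>The bound \<open>1 / (k + 1)\<close> makes the coordinates converge along the subsequence, the bounds
      \<open>\<epsilon> / 8\<close> isolate the hump.\<close>
  define R where "R k k' \<longleftrightarrow> k < k' \<and> (\<Sum>j\<le>k. \<bar>D k' j\<bar>) \<le> min (\<epsilon> / 8) (1 / (real k + 1)) \<and>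
      (\<Sum>j. \<bar>D k (j + k')\<bar>) \<le> \<epsilon> / 8" for k k'
  have step: "\<exists>k'. R k k'" for k
  proof -
    obtain N where N: "\<And>n. n \<ge> N \<Longrightarrow> norm (\<Sum>j. \<bar>D k (j + n)\<bar>) < \<epsilon> / 8"
      using suminf_exist_split[OF _ sD, of "\<epsilon> / 8"] \<epsilon> by auto
    define \<eta> where "\<eta> = min (\<epsilon> / 8) (1 / (real k + 1)) / (real k + 1)"
    have "\<eta> > 0" using \<epsilon> by (simp add: \<eta>_def)
    then obtain k' where k': "k' \<ge> max (Suc k) N" "\<forall>\<phi>\<in>\<psi> ` {..k}. \<bar>\<phi> (x k') - \<phi> z\<bar> < \<eta>"
      using cl[of "\<psi> ` {..k}" \<eta> "max (Suc k) N"] \<psi> by blast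
    have "(\<Sum>j\<le>k. \<bar>D k' j\<bar>) \<le> (\<Sum>j\<le>k. \<eta>)"
      using k'(2) by (intro sum_mono) (auto simp: D_def intro: less_imp_le)
    also have "\<dots> = min (\<epsilon> / 8) (1 / (real k + 1))" by (simp add: \<eta>_def add.commute[of 1])
    finally show ?thesis using k'(1) N[of k'] unfolding R_def by (intro exI[of _ k']) auto
  qed
  obtain \<kappa> where \<kappa>0: "\<kappa> 0 \<ge> k0" and \<kappa>: "\<And>i. R (\<kappa> i) (\<kappa> (Suc i))"
    using dependent_nat_choice[of "\<lambda>i k. i = 0 \<longrightarrow> k \<ge> k0" "\<lambda>_. R"] step by auto
  have mono: "strict_mono \<kappa>" using \<kappa> by (auto simp: strict_mono_Suc_iff R_def)
  define a :: "nat \<Rightarrow> real" where "a j = indicator (range \<kappa>) j" for j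
  define \<phi> where "\<phi> y = (\<Sum>j. a j * \<psi> j y)" for y
  have a1: "\<bar>a j\<bar> \<le> 1" for j by (simp add: a_def indicator_def)
  note \<phi> = suminf_functional[of \<psi> a, OF \<psi> sum a1, folded \<phi>_def]
  have hump: "\<phi> (x (\<kappa> (Suc i))) - \<phi> z \<ge> \<epsilon> / 2" for i
  proof -
    define p k q where "p = \<kappa> i" and "k = \<kappa> (Suc i)" and "q = \<kappa> (Suc (Suc i))"
    have pkq: "p < k" "k < q" using mono by (auto simp: p_def k_def q_def strict_mono_def)
    have le: "\<bar>a j * D k j\<bar> \<le> \<bar>D k j\<bar>" for j
      using a1[of j] by (simp add: abs_mult mult_left_le_one_le)
    have sabs: "summable (\<lambda>j. \<bar>a j * D k j\<bar>)"
      using le by (intro summable_comparison_test'[OF sD[of k], of 0]) auto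
    have s: "summable (\<lambda>j. a j * D k j)" using sabs by (rule summable_rabs_cancel)
    have "\<phi> (x k) - \<phi> z = (\<Sum>j. a j * D k j)"
      unfolding D_eq using functional_minus[OF \<phi>(1) xX z] by (simp add: \<phi>_def)
    also have "\<dots> = (\<Sum>j. a (j + q) * D k (j + q)) + (\<Sum>j<q. a j * D k j)"
      by (rule suminf_split_initial_segment[OF s])
    also have "(\<Sum>j<q. a j * D k j) = (\<Sum>j\<le>p. a j * D k j) + (\<Sum>j\<in>{p<..<q}. a j * D k j)"
      using pkq by (subst sum.union_disjoint[symmetric]) (auto intro!: sum.cong)
    also have "(\<Sum>j\<in>{p<..<q}. a j * D k j) = (\<Sum>j\<in>{k}. a j * D k j)"
    proof (rule sum.mono_neutral_right)
      show "\<forall>j\<in>{p<..<q} - {k}. a j * D k j = 0"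
      proof
        fix j assume j: "j \<in> {p<..<q} - {k}"
        have "j \<noteq> \<kappa> l" for l
        proof
          assume "j = \<kappa> l"
          with j have "i < l" "l < Suc (Suc i)"
            using strict_mono_less[OF mono] by (auto simp: p_def q_def)
          then have "l = Suc i" by simp
          with j \<open>j = \<kappa> l\<close> show False by (simp add: k_def)
        qed
        then show "a j * D k j = 0" by (auto simp: a_def indicator_def)
      qed
    qed (use pkq in auto)
    finally have eq: "\<phi> (x k) - \<phi> z = (\<Sum>j. a (j + q) * D k (j + q)) + (\<Sum>j\<le>p. a j * D k j) + D k k"
      by (simp add: a_def k_def)
    have "\<bar>\<Sum>j. a (j + q) * D k (j + q)\<bar> \<le> (\<Sum>j. \<bar>a (j + q) * D k (j + q)\<bar>)"
      by (intro summable_rabs summable_ignore_initial_segment sabs)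
    also have "\<dots> \<le> (\<Sum>j. \<bar>D k (j + q)\<bar>)"
      by (intro suminf_le le) (rule summable_ignore_initial_segment, fact)+
    also have "\<dots> \<le> \<epsilon> / 8" using \<kappa>[of "Suc i"] by (simp add: R_def k_def q_def)
    finally have 1: "\<bar>\<Sum>j. a (j + q) * D k (j + q)\<bar> \<le> \<epsilon> / 8" .
    have "\<bar>\<Sum>j\<le>p. a j * D k j\<bar> \<le> (\<Sum>j\<le>p. \<bar>D k j\<bar>)"
      using le by (intro order_trans[OF sum_abs] sum_mono)
    also have "\<dots> \<le> \<epsilon> / 8" using \<kappa>[of i] by (simp add: R_def k_def p_def)
    finally have 2: "\<bar>\<Sum>j\<le>p. a j * D k j\<bar> \<le> \<epsilon> / 8" .
    have "k0 \<le> k" using \<kappa>0 strict_mono_less_eq[OF mono, of 0 "Suc i"] by (simp add: k_def)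
    then have 3: "D k k \<ge> \<epsilon> - \<epsilon> / 4" using large[of k] k0[of k] by (simp add: D_def)
    show ?thesis unfolding k_def[symmetric] using eq 1 2 3 by linarith
  qed
  obtain z' where z': "z' \<in> carrier X"
    and cl': "\<And>\<Phi> n \<epsilon>. finite \<Phi> \<Longrightarrow> \<Phi> \<subseteq> bounded_functionals X \<Longrightarrow> \<epsilon> > 0 \<Longrightarrow>
        \<exists>i\<ge>n. \<forall>\<phi>\<in>\<Phi>. \<bar>\<phi> (x (\<kappa> (Suc i))) - \<phi> z'\<bar> < \<epsilon>"
    using weak_cluster_point[of C "\<lambda>i. x (\<kappa> (Suc i))", OF C x] by metis
  have "\<psi> j z' = \<psi> j z" for j
  proof (rule ccontr)
    assume "\<psi> j z' \<noteq> \<psi> j z"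
    define \<eta> where "\<eta> = \<bar>\<psi> j z' - \<psi> j z\<bar> / 2"
    have \<eta>: "\<eta> > 0" using \<open>\<psi> j z' \<noteq> \<psi> j z\<close> by (simp add: \<eta>_def)
    obtain N :: nat where N: "1 / \<eta> < real N" using reals_Archimedean2 by blast
    have N0: "0 < real N" using N \<eta> by (smt (verit) divide_pos_pos)
    obtain i where i: "i \<ge> max N j" "\<bar>\<psi> j (x (\<kappa> (Suc i))) - \<psi> j z'\<bar> < \<eta>"
      using cl'[of "{\<psi> j}" \<eta> "max N j"] \<eta> \<psi> by auto
    have ki: "i \<le> \<kappa> i" using mono by (rule strict_mono_imp_increasing)
    have "\<bar>D (\<kappa> (Suc i)) j\<bar> \<le> (\<Sum>j\<le>\<kappa> i. \<bar>D (\<kappa> (Suc i)) j\<bar>)"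
      using i(1) ki by (intro member_le_sum) auto
    also have "\<dots> \<le> 1 / (real (\<kappa> i) + 1)" using \<kappa>[of i] by (simp add: R_def)
    also have "\<dots> \<le> 1 / real N"
    proof (rule divide_left_mono)
      show "0 < (real (\<kappa> i) + 1) * real N" using N0 by (intro mult_pos_pos) auto
    qed (use i(1) ki in auto)
    also have "\<dots> < \<eta>" using N N0 \<eta> by (simp add: field_simps)
    finally show False using i(2) by (auto simp: D_def \<eta>_def abs_if split: if_splits)
  qed
  then have "\<phi> z' = \<phi> z" by (simp add: \<phi>_def)
  moreover obtain i where "\<bar>\<phi> (x (\<kappa> (Suc i))) - \<phi> z'\<bar> < \<epsilon> / 2"
    using cl'[of "{\<phi>}" "\<epsilon> / 2" 0] \<phi>(1) \<epsilon> by auto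
  ultimately show False using hump[of i] by linarith
qed

text \<open>
  If \<open>x k\<close> in \<open>K\<close> had norm above \<open>2\<^bsup>k+1\<^esup>\<close>, the norming functionals of the \<open>x k\<close>, scaled by \<open>2\<^bsup>-k-1\<^esup>\<close>,
  would contradict the gliding hump.
\<close>
theorem relatively_weakly_compact_bounded:
  assumes "relatively_weakly_compact X K"
  shows "\<exists>B. \<forall>x\<in>K. vnorm X x \<le> B"
proof (rule ccontr)
  assume "\<not> ?thesis"
  then have "\<exists>x\<in>K. 2 ^ Suc k < vnorm X x" for k :: nat by (meson not_le)
  then obtain x where x: "\<And>k::nat. x k \<in> K" "\<And>k. 2 ^ Suc k < vnorm X (x k)" by metis
  obtain C where C: "weakly_compact X C" "K \<subseteq> C" "C \<subseteq> carrier X"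
    using relatively_weakly_compactD[OF assms] by metis
  have xX: "x k \<in> carrier X" for k using x C by auto
  have "\<exists>\<phi>\<in>bounded_functionals X. \<phi> (x k) = vnorm X (x k) \<and> (\<forall>y\<in>carrier X. \<bar>\<phi> y\<bar> \<le> vnorm X y)" for k
    using norming_functional[OF xX[of k]] by metis
  then obtain \<phi> where \<phi>: "\<And>k. \<phi> k \<in> bounded_functionals X" "\<And>k. \<phi> k (x k) = vnorm X (x k)"
    "\<And>k y. y \<in> carrier X \<Longrightarrow> \<bar>\<phi> k y\<bar> \<le> vnorm X y" by metis
  define \<psi> where "\<psi> k y = (1/2) ^ Suc k * \<phi> k y" for k y
  have "\<exists>k. \<psi> k (x k) < 1"
  proof (rule gliding_hump[OF C(1)])
    show "x k \<in> C" for k using x C by auto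
    fix k
    show "\<psi> k \<in> bounded_functionals X"
    proof (rule bounded_functionalI[where B = 1])
      fix y assume y: "y \<in> carrier X"
      have "(1/2::real) ^ Suc k \<le> 1" by (intro power_le_one) auto
      then have "(1/2) ^ Suc k * \<bar>\<phi> k y\<bar> \<le> 1 * \<bar>\<phi> k y\<bar>" by (rule mult_right_mono) simp
      then show "\<bar>\<psi> k y\<bar> \<le> 1 * vnorm X y"
        using \<phi>(3)[OF y, of k] by (simp add: \<psi>_def abs_mult)
    qed (auto simp: \<psi>_def functional_add[OF \<phi>(1)] functional_smult[OF \<phi>(1)] algebra_simps)
  next
    fix y and n :: nat assume y: "y \<in> carrier X"
    have "(\<Sum>j<n. \<bar>\<psi> j y\<bar>) \<le> (\<Sum>j<n. (1/2) ^ Suc j * vnorm X y)"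
      using \<phi>(3)[OF y] by (intro sum_mono) (auto simp: \<psi>_def abs_mult intro!: mult_left_mono)
    also have "\<dots> = (\<Sum>j<n. (1/2) ^ Suc j) * vnorm X y" by (simp add: sum_distrib_right)
    also have "(\<Sum>j<n. (1/2::real) ^ Suc j) = 1 - (1/2) ^ n" by (induction n) auto
    also have "(1 - (1/2) ^ n) * vnorm X y \<le> 1 * vnorm X y"
      using vnorm_nonneg[OF y] by (intro mult_right_mono) auto
    finally show "(\<Sum>j<n. \<bar>\<psi> j y\<bar>) \<le> vnorm X y" by simp
  qed simp
  then obtain k where "\<psi> k (x k) < 1" by blast
  then show False using x(2)[of k] by (simp add: \<psi>_def \<phi>(2) field_simps)
qed

text \<open>
  If the decay is not uniform, then some \<open>x n\<close> in \<open>K\<close> keeps more than \<open>\<epsilon>\<close> of its norm in the block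
  between \<open>P n\<close> and \<open>P (m n)\<close> when \<open>m n\<close> is large.  Along the iterates of \<open>m\<close> the norms of the
  blocks of any vector telescope to at most its norm, so functionals norming the blocks satisfy the
  hypotheses of the gliding hump.
\<close>
theorem uniform_decay_of_L_projections:
  assumes K: "relatively_weakly_compact X K"
    and closed: "\<And>n x. x \<in> carrier X \<Longrightarrow> P n x \<in> carrier X"
    and add: "\<And>n x y. x \<in> carrier X \<Longrightarrow> y \<in> carrier X \<Longrightarrow> P n (x \<oplus> y) = P n x \<oplus> P n y"
    and smult: "\<And>n a x. x \<in> carrier X \<Longrightarrow> P n (a \<odot> x) = a \<odot> P n x"
    and le: "\<And>n x. x \<in> carrier X \<Longrightarrow> vnorm X (P n x) \<le> vnorm X x"
    and split: "\<And>m n x. n \<le> m \<Longrightarrow> x \<in> carrier X \<Longrightarrow>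
        vnorm X (P n x) = vnorm X (P m x) + vnorm X (P n x \<ominus> P m x)"
    and lim: "\<And>x. x \<in> carrier X \<Longrightarrow> (\<lambda>n. vnorm X (P n x)) \<longlonglongrightarrow> 0"
    and \<epsilon>: "\<epsilon> > 0"
  shows "\<exists>n. \<forall>x\<in>K. vnorm X (P n x) \<le> \<epsilon>"
proof (rule ccontr)
  assume "\<not> ?thesis"
  then have "\<exists>x\<in>K. \<epsilon> < vnorm X (P n x)" for n by (meson not_le)
  then obtain x where x: "\<And>n::nat. x n \<in> K" "\<And>n. \<epsilon> < vnorm X (P n (x n))" by metis
  obtain C where C: "weakly_compact X C" "K \<subseteq> C" "C \<subseteq> carrier X"
    using relatively_weakly_compactD[OF K] by metis
  have xX: "x k \<in> carrier X" for k using x C by auto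
  have "\<exists>m>n. \<epsilon> < vnorm X (P n (x n) \<ominus> P m (x n))" for n
  proof -
    have "\<forall>\<^sub>F m in sequentially. vnorm X (P m (x n)) < vnorm X (P n (x n)) - \<epsilon>"
      using lim[OF xX] x(2)[of n] by (intro order_tendstoD) auto
    then have "\<forall>\<^sub>F m in sequentially. vnorm X (P m (x n)) < vnorm X (P n (x n)) - \<epsilon> \<and> n < m"
      using eventually_gt_at_top by eventually_elim auto
    then obtain m where "vnorm X (P m (x n)) < vnorm X (P n (x n)) - \<epsilon>" "n < m"
      by (auto dest: eventually_happens)
    then show ?thesis using split[of n m "x n"] xX by (intro exI[of _ m]) auto
  qed
  then obtain m where m: "\<And>n. n < m n" "\<And>n. \<epsilon> < vnorm X (P n (x n) \<ominus> P (m n) (x n))" by metis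
  define \<nu> where "\<nu> k = (m ^^ k) 0" for k
  have \<nu>Suc: "\<nu> (Suc k) = m (\<nu> k)" for k by (simp add: \<nu>_def)
  define Q where "Q k y = P (\<nu> k) y \<ominus> P (\<nu> (Suc k)) y" for k y
  have QX: "y \<in> carrier X \<Longrightarrow> Q k y \<in> carrier X" for k y by (simp add: Q_def closed)
  have "\<exists>\<phi>\<in>bounded_functionals X. \<phi> (Q k (x (\<nu> k))) = vnorm X (Q k (x (\<nu> k))) \<and>
      (\<forall>y\<in>carrier X. \<bar>\<phi> y\<bar> \<le> vnorm X y)" for k
    using norming_functional[OF QX[OF xX], of k "\<nu> k"] by metis
  then obtain \<phi> where \<phi>: "\<And>k. \<phi> k \<in> bounded_functionals X"
    "\<And>k. \<phi> k (Q k (x (\<nu> k))) = vnorm X (Q k (x (\<nu> k)))"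
    "\<And>k y. y \<in> carrier X \<Longrightarrow> \<bar>\<phi> k y\<bar> \<le> vnorm X y" by metis
  define \<psi> where "\<psi> k y = \<phi> k (Q k y)" for k y
  have sum: "(\<Sum>j<n. \<bar>\<psi> j y\<bar>) \<le> vnorm X y" if y: "y \<in> carrier X" for y n
  proof -
    have "(\<Sum>j<n. \<bar>\<psi> j y\<bar>) \<le> (\<Sum>j<n. vnorm X (Q j y))"
      using \<phi>(3) QX[OF y] by (intro sum_mono) (auto simp: \<psi>_def)
    also have "\<dots> = (\<Sum>j<n. vnorm X (P (\<nu> j) y) - vnorm X (P (\<nu> (Suc j)) y))"
    proof (rule sum.cong)
      fix j
      show "vnorm X (Q j y) = vnorm X (P (\<nu> j) y) - vnorm X (P (\<nu> (Suc j)) y)"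
        using split[of "\<nu> j" "\<nu> (Suc j)" y] m(1)[of "\<nu> j"] y by (simp add: Q_def \<nu>Suc)
    qed simp
    also have "\<dots> = vnorm X (P (\<nu> 0) y) - vnorm X (P (\<nu> n) y)"
      by (rule sum_lessThan_telescope')
    also have "\<dots> \<le> vnorm X y"
      using le[OF y, of "\<nu> 0"] vnorm_nonneg[OF closed[OF y], of "\<nu> n"] by simp
    finally show ?thesis .
  qed
  have "\<exists>k. \<psi> k (x (\<nu> k)) < \<epsilon>"
  proof (rule gliding_hump[OF C(1)])
    show "x (\<nu> k) \<in> C" for k using x C by auto
    fix k
    show "\<psi> k \<in> bounded_functionals X"
    proof (rule bounded_functionalI[where B = 1])
      fix y assume y: "y \<in> carrier X"
      have "\<bar>\<psi> k y\<bar> \<le> (\<Sum>j<Suc k. \<bar>\<psi> j y\<bar>)" by (simp add: sum_nonneg)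
      then show "\<bar>\<psi> k y\<bar> \<le> 1 * vnorm X y" using sum[OF y, of "Suc k"] by linarith
    next
      fix y y' assume "y \<in> carrier X" "y' \<in> carrier X"
      then show "\<psi> k (y \<oplus> y') = \<psi> k y + \<psi> k y'"
        by (simp add: \<psi>_def Q_def add add_minus_add closed functional_add[OF \<phi>(1)])
    next
      fix a y assume "y \<in> carrier X"
      then show "\<psi> k (a \<odot> y) = a * \<psi> k y"
        by (simp add: \<psi>_def Q_def smult smult_minus[symmetric] closed functional_smult[OF \<phi>(1)])
    qed
  qed (use sum \<epsilon> in auto)
  then obtain k where "\<psi> k (x (\<nu> k)) < \<epsilon>" by blast
  then show False using m(2)[of "\<nu> k"] by (simp add: \<psi>_def \<phi>(2)) (simp add: Q_def \<nu>Suc)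
qed

end

text \<open>
  Composition with \<open>T\<close> maps bounded functionals to bounded functionals, so \<open>T\<close> is weakly continuous.
\<close>
lemma relatively_weakly_compact_image:
  assumes X: "normed_space X" and Y: "normed_space Y" and K: "relatively_weakly_compact X K"
    and closed: "\<And>x. x \<in> carrier X \<Longrightarrow> T x \<in> carrier Y"
    and add: "\<And>x y. x \<in> carrier X \<Longrightarrow> y \<in> carrier X \<Longrightarrow> T (x \<oplus>\<^bsub>X\<^esub> y) = T x \<oplus>\<^bsub>Y\<^esub> T y"
    and smult: "\<And>a x. x \<in> carrier X \<Longrightarrow> T (a \<odot>\<^bsub>X\<^esub> x) = a \<odot>\<^bsub>Y\<^esub> T x"
    and le: "\<And>x. x \<in> carrier X \<Longrightarrow> vnorm Y (T x) \<le> vnorm X x"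
  shows "relatively_weakly_compact Y (T ` K)"
proof -
  interpret X: normed_space X by fact
  interpret Y: normed_space Y by fact
  have "continuous_map (weak_topology X) (weak_topology Y) T"
    unfolding weak_topology_def[of Y]
  proof (rule continuous_on_generated_topo)
    show "T ` topspace (weak_topology X)
        \<subseteq> \<Union>{{x \<in> carrier Y. \<phi> x \<in> U} |\<phi> U. \<phi> \<in> bounded_functionals Y \<and> open U}"
      using Y.topspace_weak_topology closed
      unfolding weak_topology_def[of Y] topology_generated_by_topspace by auto
    fix V assume "V \<in> {{x \<in> carrier Y. \<phi> x \<in> U} |\<phi> U. \<phi> \<in> bounded_functionals Y \<and> open U}"
    then obtain \<phi> U where V: "V = {x \<in> carrier Y. \<phi> x \<in> U}" and \<phi>: "\<phi> \<in> bounded_functionals Y" and U: "open U"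
      by auto
    obtain B where B: "B > 0" "\<And>y. y \<in> carrier Y \<Longrightarrow> \<bar>\<phi> y\<bar> \<le> B * vnorm Y y"
      using Y.functional_bound[OF \<phi>] by metis
    have "(\<lambda>x. \<phi> (T x)) \<in> bounded_functionals X"
    proof (rule X.bounded_functionalI[where B = B])
      fix x assume x: "x \<in> carrier X"
      show "\<bar>\<phi> (T x)\<bar> \<le> B * vnorm X x"
        using B(2)[OF closed[OF x]] mult_left_mono[OF le[OF x], of B] B(1) by linarith
    qed (auto simp: add smult closed Y.functional_add[OF \<phi>] Y.functional_smult[OF \<phi>])
    moreover have "T -` V \<inter> topspace (weak_topology X) = {x \<in> carrier X. \<phi> (T x) \<in> U}"
      using closed by (auto simp: V)
    ultimately show "openin (weak_topology X) (T -` V \<inter> topspace (weak_topology X))"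
      using X.openin_weak_topology_functional[OF _ U] by simp
  qed
  moreover obtain C where C: "weakly_compact X C" "K \<subseteq> C"
    using X.relatively_weakly_compactD[OF K] by metis
  ultimately have "weakly_compact Y (T ` C)"
    unfolding weakly_compact_def by (intro image_compactin)
  then show ?thesis using C(2) by (intro Y.relatively_weakly_compactI) auto
qed

section \<open>The normed space of classes of Bochner integrable functions\<close>

context normed_space
begin

lemma simple_into_closed: "simple_into M X s \<Longrightarrow> w \<in> space M \<Longrightarrow> s w \<in> carrier X"
  by (auto simp: simple_into_def)

lemma strongly_measurable_closed: "strongly_measurable M X f \<Longrightarrow> w \<in> space M \<Longrightarrow> f w \<in> carrier X"
  by (auto simp: strongly_measurable_def)

lemma bochner_integrable_closed: "bochner_integrable M X f \<Longrightarrow> w \<in> space M \<Longrightarrow> f w \<in> carrier X"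
  by (auto simp: bochner_integrable_def strongly_measurable_closed)

lemma simple_into_const: "x \<in> carrier X \<Longrightarrow> simple_into M X (\<lambda>_. x)"
  by (simp add: simple_into_def)

lemma simple_into_add:
  "simple_into M X s \<Longrightarrow> simple_into M X t \<Longrightarrow> simple_into M X (\<lambda>w. s w \<oplus> t w)"
  using simple_function_compose2[of M s t "\<lambda>x y. x \<oplus> y"] by (simp add: simple_into_def Pi_iff)

lemma simple_into_smult:
  "simple_into M X s \<Longrightarrow> simple_into M X (\<lambda>w. a \<odot> s w)"
  using simple_function_compose1[of M s "\<lambda>x. a \<odot> x"] by (simp add: simple_into_def Pi_iff)

lemma measurable_vnorm_simple:
  "simple_into M X s \<Longrightarrow> (\<lambda>w. vnorm X (s w)) \<in> borel_measurable M"
  using simple_function_compose1[of M s "vnorm X"]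
  by (auto simp: simple_into_def intro: borel_measurable_simple_function)

lemma strongly_measurableI:
  assumes "\<And>w. w \<in> space M \<Longrightarrow> f w \<in> carrier X" "\<And>i. simple_into M X (s i)"
    "AE w in M. (\<lambda>i. vnorm X (f w \<ominus> s i w)) \<longlonglongrightarrow> 0"
  shows "strongly_measurable M X f"
  using assms unfolding strongly_measurable_def by blast

lemma strongly_measurableE:
  assumes "strongly_measurable M X f"
  obtains s where "\<forall>i. simple_into M X (s i)" "AE w in M. (\<lambda>i. vnorm X (f w \<ominus> s i w)) \<longlonglongrightarrow> 0"
  using assms unfolding strongly_measurable_def by blast

lemma strongly_measurable_simple: "simple_into M X s \<Longrightarrow> strongly_measurable M X s"
  by (rule strongly_measurableI[where s = "\<lambda>_. s"]) (auto simp: simple_into_closed)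

lemma strongly_measurable_add:
  assumes f: "strongly_measurable M X f" and g: "strongly_measurable M X g"
  shows "strongly_measurable M X (\<lambda>w. f w \<oplus> g w)"
proof -
  obtain s where s0: "\<forall>i. simple_into M X (s i)" "AE w in M. (\<lambda>i. vnorm X (f w \<ominus> s i w)) \<longlonglongrightarrow> 0"
    by (rule strongly_measurableE[OF f])
    note s = s0(1)[rule_format] s0(2)
  obtain t where t0: "\<forall>i. simple_into M X (t i)" "AE w in M. (\<lambda>i. vnorm X (g w \<ominus> t i w)) \<longlonglongrightarrow> 0"
    by (rule strongly_measurableE[OF g])
    note t = t0(1)[rule_format] t0(2)
  show ?thesis
  proof (rule strongly_measurableI[where s = "\<lambda>i w. s i w \<oplus> t i w"])
    show "AE w in M. (\<lambda>i. vnorm X (f w \<oplus> g w \<ominus> (s i w \<oplus> t i w))) \<longlonglongrightarrow> 0"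
      using s(2) t(2) AE_space
    proof eventually_elim
      case (elim w)
      note [simp] = strongly_measurable_closed[OF f elim(3)] strongly_measurable_closed[OF g elim(3)]
        simple_into_closed[OF s(1) elim(3)] simple_into_closed[OF t(1) elim(3)]
      show ?case
      proof (rule tendsto_sandwich[OF _ _ tendsto_const])
        show "(\<lambda>i. vnorm X (f w \<ominus> s i w) + vnorm X (g w \<ominus> t i w)) \<longlonglongrightarrow> 0"
          using tendsto_add[OF elim(1,2)] by simp
      qed (auto simp: add_minus_add vnorm_nonneg vnorm_triangle)
    qed
  qed (auto simp: strongly_measurable_closed[OF f] strongly_measurable_closed[OF g] simple_into_add s t)
qed

lemma strongly_measurable_smult:
  assumes f: "strongly_measurable M X f"
  shows "strongly_measurable M X (\<lambda>w. a \<odot> f w)"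
proof -
  obtain s where s0: "\<forall>i. simple_into M X (s i)" "AE w in M. (\<lambda>i. vnorm X (f w \<ominus> s i w)) \<longlonglongrightarrow> 0"
    by (rule strongly_measurableE[OF f])
    note s = s0(1)[rule_format] s0(2)
  show ?thesis
  proof (rule strongly_measurableI[where s = "\<lambda>i w. a \<odot> s i w"])
    show "AE w in M. (\<lambda>i. vnorm X (a \<odot> f w \<ominus> a \<odot> s i w)) \<longlonglongrightarrow> 0"
      using s(2) AE_space
    proof eventually_elim
      case (elim w)
      note [simp] = strongly_measurable_closed[OF f elim(2)] simple_into_closed[OF s(1) elim(2)]
      show ?case
        using tendsto_mult[OF tendsto_const[of "\<bar>a\<bar>"] elim(1)]
        by (simp add: smult_minus[symmetric] vnorm_smult)
    qed
  qed (auto simp: strongly_measurable_closed[OF f] simple_into_smult s)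
qed

lemma strongly_measurable_minus:
  assumes f: "strongly_measurable M X f" and g: "strongly_measurable M X g"
  shows "strongly_measurable M X (\<lambda>w. f w \<ominus> g w)"
proof -
  note * = strongly_measurable_add[OF f strongly_measurable_smult[OF g, of "-1"]]
  have eq: "f w \<ominus> g w = f w \<oplus> (-1) \<odot> g w" if "w \<in> space M" for w
    using that strongly_measurable_closed[OF g] by (simp add: a_minus_def minus_eq_smult)
  obtain s where s0: "\<forall>i. simple_into M X (s i)" "AE w in M. (\<lambda>i. vnorm X (f w \<oplus> (-1) \<odot> g w \<ominus> s i w)) \<longlonglongrightarrow> 0"
    by (rule strongly_measurableE[OF *])
    note s = s0(1)[rule_format] s0(2)
  show ?thesis
  proof (rule strongly_measurableI[OF _ s(1)])
    show "AE w in M. (\<lambda>i. vnorm X (f w \<ominus> g w \<ominus> s i w)) \<longlonglongrightarrow> 0"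
      using s(2) AE_space by eventually_elim (simp add: eq)
  qed (intro M.minus_closed strongly_measurable_closed[OF f] strongly_measurable_closed[OF g])
qed

text \<open>
  The measure need not be complete, so the norm of a strongly measurable function is only almost
  everywhere equal to a measurable function.  This is enough to compute with nonnegative integrals.
\<close>
lemma vnorm_AE_measurable:
  assumes f: "strongly_measurable M X f"
  obtains h where "h \<in> borel_measurable M" "AE w in M. vnorm X (f w) = h w"
proof -
  obtain s where s0: "\<forall>i. simple_into M X (s i)" "AE w in M. (\<lambda>i. vnorm X (f w \<ominus> s i w)) \<longlonglongrightarrow> 0"
    by (rule strongly_measurableE[OF f])
    note s = s0(1)[rule_format] s0(2)
  define h where "h w = lim (\<lambda>i. vnorm X (s i w))" for w
  show thesis
  proof (rule that)
    show "h \<in> borel_measurable M"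
      unfolding h_def using measurable_vnorm_simple[OF s(1)] by (rule borel_measurable_lim_metric)
    show "AE w in M. vnorm X (f w) = h w"
      using s(2) AE_space
    proof eventually_elim
      case (elim w)
      note [simp] = strongly_measurable_closed[OF f elim(2)] simple_into_closed[OF s(1) elim(2)]
      have "(\<lambda>i. vnorm X (s i w) - vnorm X (f w)) \<longlonglongrightarrow> 0"
      proof (rule Lim_null_comparison[OF _ elim(1)])
        show "\<forall>\<^sub>F i in sequentially. norm (vnorm X (s i w) - vnorm X (f w)) \<le> vnorm X (f w \<ominus> s i w)"
          using vnorm_diff_le[of "f w" "s _ w"] by (auto simp: abs_minus_commute)
      qed
      then have "(\<lambda>i. vnorm X (s i w)) \<longlonglongrightarrow> vnorm X (f w)" by (simp add: LIM_zero_iff)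
      then show ?case unfolding h_def by (rule limI[symmetric])
    qed
  qed
qed

lemma nn_integral_vnorm_add:
  assumes f: "strongly_measurable M X f" and Y: "normed_space Y" and g: "strongly_measurable M Y g"
  shows "(\<integral>\<^sup>+w. ennreal (vnorm X (f w) + vnorm Y (g w)) \<partial>M)
    = (\<integral>\<^sup>+w. ennreal (vnorm X (f w)) \<partial>M) + (\<integral>\<^sup>+w. ennreal (vnorm Y (g w)) \<partial>M)"
proof -
  interpret Y: normed_space Y by fact
  obtain h where h: "h \<in> borel_measurable M" "AE w in M. vnorm X (f w) = h w"
    by (rule vnorm_AE_measurable[OF f])
  obtain k where k: "k \<in> borel_measurable M" "AE w in M. vnorm Y (g w) = k w"
    by (rule Y.vnorm_AE_measurable[OF g])
  have "(\<integral>\<^sup>+w. ennreal (vnorm X (f w) + vnorm Y (g w)) \<partial>M) = (\<integral>\<^sup>+w. ennreal (h w) + ennreal (k w) \<partial>M)"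
  proof (rule nn_integral_cong_AE)
    show "AE w in M. ennreal (vnorm X (f w) + vnorm Y (g w)) = ennreal (h w) + ennreal (k w)"
      using h(2) k(2) AE_space
    proof eventually_elim
      case (elim w)
      then show ?case
        using vnorm_nonneg[OF strongly_measurable_closed[OF f, of w]]
          Y.vnorm_nonneg[OF Y.strongly_measurable_closed[OF g, of w]] by (simp add: ennreal_plus)
    qed
  qed
  also have "\<dots> = (\<integral>\<^sup>+w. ennreal (h w) \<partial>M) + (\<integral>\<^sup>+w. ennreal (k w) \<partial>M)"
    using h(1) k(1) by (intro nn_integral_add) auto
  also have "(\<integral>\<^sup>+w. ennreal (h w) \<partial>M) = (\<integral>\<^sup>+w. ennreal (vnorm X (f w)) \<partial>M)"
    using h(2) by (intro nn_integral_cong_AE) auto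
  also have "(\<integral>\<^sup>+w. ennreal (k w) \<partial>M) = (\<integral>\<^sup>+w. ennreal (vnorm Y (g w)) \<partial>M)"
    using k(2) by (intro nn_integral_cong_AE) auto
  finally show ?thesis .
qed

lemma bochner_integrableE:
  assumes "bochner_integrable M X f"
  obtains s where "\<forall>i. simple_into M X (s i)" "(\<lambda>i. \<integral>\<^sup>+w. ennreal (vnorm X (f w \<ominus> s i w)) \<partial>M) \<longlonglongrightarrow> 0"
  using assms unfolding bochner_integrable_def by blast

lemma bochner_integrable_strongly_measurable:
  "bochner_integrable M X f \<Longrightarrow> strongly_measurable M X f"
  by (simp add: bochner_integrable_def)

lemma bochner_integrable_simple: "simple_into M X s \<Longrightarrow> bochner_integrable M X s"
  unfolding bochner_integrable_def
proof (intro conjI exI[of _ "\<lambda>_. s"] allI)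
  assume s: "simple_into M X s"
  have "(\<integral>\<^sup>+w. ennreal (vnorm X (s w \<ominus> s w)) \<partial>M) = (\<integral>\<^sup>+w. 0 \<partial>M)"
    using simple_into_closed[OF s] by (intro nn_integral_cong) simp
  then show "(\<lambda>i::nat. \<integral>\<^sup>+w. ennreal (vnorm X (s w \<ominus> s w)) \<partial>M) \<longlonglongrightarrow> 0" by simp
qed (auto simp: strongly_measurable_simple)

lemma bochner_integrable_const: "x \<in> carrier X \<Longrightarrow> bochner_integrable M X (\<lambda>_. x)"
  by (intro bochner_integrable_simple simple_into_const)

lemma bochner_integrable_add:
  assumes f: "bochner_integrable M X f" and g: "bochner_integrable M X g"
  shows "bochner_integrable M X (\<lambda>w. f w \<oplus> g w)"
proof -
  note [simp] = bochner_integrable_closed[OF f] bochner_integrable_closed[OF g]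
  obtain s where s0: "\<forall>i. simple_into M X (s i)" "(\<lambda>i. \<integral>\<^sup>+w. ennreal (vnorm X (f w \<ominus> s i w)) \<partial>M) \<longlonglongrightarrow> 0"
    by (rule bochner_integrableE[OF f])
    note s = s0(1)[rule_format] s0(2)
  obtain t where t0: "\<forall>i. simple_into M X (t i)" "(\<lambda>i. \<integral>\<^sup>+w. ennreal (vnorm X (g w \<ominus> t i w)) \<partial>M) \<longlonglongrightarrow> 0"
    by (rule bochner_integrableE[OF g])
    note t = t0(1)[rule_format] t0(2)
  note [simp] = simple_into_closed[OF s(1)] simple_into_closed[OF t(1)]
  have le: "(\<integral>\<^sup>+w. ennreal (vnorm X (f w \<oplus> g w \<ominus> (s i w \<oplus> t i w))) \<partial>M) \<le>
      (\<integral>\<^sup>+w. ennreal (vnorm X (f w \<ominus> s i w)) \<partial>M) + (\<integral>\<^sup>+w. ennreal (vnorm X (g w \<ominus> t i w)) \<partial>M)" for i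
  proof (subst nn_integral_vnorm_add[symmetric])
    show "strongly_measurable M X (\<lambda>w. f w \<ominus> s i w)" "strongly_measurable M X (\<lambda>w. g w \<ominus> t i w)"
      by (intro strongly_measurable_minus bochner_integrable_strongly_measurable f g strongly_measurable_simple s t)+
    show "(\<integral>\<^sup>+w. ennreal (vnorm X (f w \<oplus> g w \<ominus> (s i w \<oplus> t i w))) \<partial>M) \<le>
        (\<integral>\<^sup>+w. ennreal (vnorm X (f w \<ominus> s i w) + vnorm X (g w \<ominus> t i w)) \<partial>M)"
      by (intro nn_integral_mono ennreal_leI) (simp add: add_minus_add vnorm_triangle)
  qed (rule normed_space_axioms)
  show ?thesis
    unfolding bochner_integrable_def
  proof (intro conjI exI[of _ "\<lambda>i w. s i w \<oplus> t i w"] allI)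
    show "(\<lambda>i. \<integral>\<^sup>+w. ennreal (vnorm X (f w \<oplus> g w \<ominus> (s i w \<oplus> t i w))) \<partial>M) \<longlonglongrightarrow> 0"
    proof (rule tendsto_sandwich[OF _ _ tendsto_const])
      show "(\<lambda>i. (\<integral>\<^sup>+w. ennreal (vnorm X (f w \<ominus> s i w)) \<partial>M) + (\<integral>\<^sup>+w. ennreal (vnorm X (g w \<ominus> t i w)) \<partial>M)) \<longlonglongrightarrow> 0"
        using tendsto_add[OF s(2) t(2)] by simp
    qed (auto simp: le)
  qed (intro strongly_measurable_add simple_into_add bochner_integrable_strongly_measurable f g s t)+
qed

lemma bochner_integrable_smult:
  assumes f: "bochner_integrable M X f"
  shows "bochner_integrable M X (\<lambda>w. a \<odot> f w)"
proof -
  note fm = bochner_integrable_strongly_measurable[OF f]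
  obtain s where s0: "\<forall>i. simple_into M X (s i)" "(\<lambda>i. \<integral>\<^sup>+w. ennreal (vnorm X (f w \<ominus> s i w)) \<partial>M) \<longlonglongrightarrow> 0"
    by (rule bochner_integrableE[OF f])
    note s = s0(1)[rule_format] s0(2)
  have eq: "(\<integral>\<^sup>+w. ennreal (vnorm X (a \<odot> f w \<ominus> a \<odot> s i w)) \<partial>M)
      = ennreal \<bar>a\<bar> * (\<integral>\<^sup>+w. ennreal (vnorm X (f w \<ominus> s i w)) \<partial>M)" for i
  proof -
    obtain h where h: "h \<in> borel_measurable M" "AE w in M. vnorm X (f w \<ominus> s i w) = h w"
      by (rule vnorm_AE_measurable[OF strongly_measurable_minus[OF fm strongly_measurable_simple[OF s(1)[of i]]]])
    have "(\<integral>\<^sup>+w. ennreal (vnorm X (a \<odot> f w \<ominus> a \<odot> s i w)) \<partial>M) = (\<integral>\<^sup>+w. ennreal \<bar>a\<bar> * ennreal (h w) \<partial>M)"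
    proof (rule nn_integral_cong_AE)
      show "AE w in M. ennreal (vnorm X (a \<odot> f w \<ominus> a \<odot> s i w)) = ennreal \<bar>a\<bar> * ennreal (h w)"
        using h(2) AE_space
      proof eventually_elim
        case (elim w)
        then show ?case
          using bochner_integrable_closed[OF f, of w] simple_into_closed[OF s(1), of w i]
          by (simp add: smult_minus[symmetric] vnorm_smult ennreal_mult')
      qed
    qed
    also have "\<dots> = ennreal \<bar>a\<bar> * (\<integral>\<^sup>+w. ennreal (h w) \<partial>M)"
      using h(1) by (intro nn_integral_cmult) auto
    also have "(\<integral>\<^sup>+w. ennreal (h w) \<partial>M) = (\<integral>\<^sup>+w. ennreal (vnorm X (f w \<ominus> s i w)) \<partial>M)"
      using h(2) by (intro nn_integral_cong_AE) auto
    finally show ?thesis .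
  qed
  show ?thesis
    unfolding bochner_integrable_def
  proof (intro conjI exI[of _ "\<lambda>i w. a \<odot> s i w"] allI)
    show "(\<lambda>i. \<integral>\<^sup>+w. ennreal (vnorm X (a \<odot> f w \<ominus> a \<odot> s i w)) \<partial>M) \<longlonglongrightarrow> 0"
      unfolding eq using ennreal_tendsto_cmult[OF _ s(2), of "ennreal \<bar>a\<bar>"] by simp
  qed (use fm s(1) in \<open>auto intro!: strongly_measurable_smult simple_into_smult\<close>)
qed

text \<open>
  A function at finite distance from a simple function is integrable, because simple functions are
  bounded and the measure is finite.
\<close>
lemma bochner_integrable_finite:
  assumes "finite_measure M" and f: "bochner_integrable M X f"
  shows "(\<integral>\<^sup>+w. ennreal (vnorm X (f w)) \<partial>M) < \<infinity>"
proof -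
  interpret finite_measure M by fact
  note fm = bochner_integrable_strongly_measurable[OF f]
  obtain s where s0: "\<forall>i. simple_into M X (s i)" "(\<lambda>i. \<integral>\<^sup>+w. ennreal (vnorm X (f w \<ominus> s i w)) \<partial>M) \<longlonglongrightarrow> 0"
    by (rule bochner_integrableE[OF f])
    note s = s0(1)[rule_format] s0(2)
  have "\<forall>\<^sub>F i in sequentially. (\<integral>\<^sup>+w. ennreal (vnorm X (f w \<ominus> s i w)) \<partial>M) < 1"
    using s(2) by (intro order_tendstoD) auto
  then obtain i where i: "(\<integral>\<^sup>+w. ennreal (vnorm X (f w \<ominus> s i w)) \<partial>M) < 1"
    by (auto dest: eventually_happens)
  have fin: "finite (s i ` space M)"
    using s(1)[of i] by (auto simp: simple_into_def dest: simple_functionD)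
  define B where "B = Max (insert 0 (vnorm X ` s i ` space M))"
  have B: "vnorm X (s i w) \<le> B" if "w \<in> space M" for w
    using that fin by (auto simp: B_def intro!: Max_ge)
  have "(\<integral>\<^sup>+w. ennreal (vnorm X (s i w)) \<partial>M) \<le> (\<integral>\<^sup>+w. ennreal B \<partial>M)"
    using B by (intro nn_integral_mono ennreal_leI) auto
  also have "\<dots> < \<infinity>" by (simp add: ennreal_mult_less_top emeasure_eq_measure)
  finally have 2: "(\<integral>\<^sup>+w. ennreal (vnorm X (s i w)) \<partial>M) < \<infinity>" .
  have "(\<integral>\<^sup>+w. ennreal (vnorm X (f w)) \<partial>M) \<le> (\<integral>\<^sup>+w. ennreal (vnorm X (f w \<ominus> s i w) + vnorm X (s i w)) \<partial>M)"
  proof (intro nn_integral_mono ennreal_leI)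
    fix w assume "w \<in> space M"
    then show "vnorm X (f w) \<le> vnorm X (f w \<ominus> s i w) + vnorm X (s i w)"
      using vnorm_diff_le[of "f w" "s i w"] bochner_integrable_closed[OF f, of w]
        simple_into_closed[OF s(1), of w i] by simp
  qed
  also have "\<dots> = (\<integral>\<^sup>+w. ennreal (vnorm X (f w \<ominus> s i w)) \<partial>M) + (\<integral>\<^sup>+w. ennreal (vnorm X (s i w)) \<partial>M)"
    by (intro nn_integral_vnorm_add strongly_measurable_minus fm strongly_measurable_simple s(1) normed_space_axioms)
  also have "\<dots> < \<infinity>" using i 2 by (auto simp: less_top[symmetric] intro: order.strict_trans)
  finally show ?thesis .
qed

subsection \<open>The space of classes\<close>

lemma ae_class_cong: "AE w in M. f w = g w \<Longrightarrow> ae_class M X f = ae_class M X g"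
  unfolding ae_class_def by (auto elim: eventually_elim2)

lemma ae_class_self: "bochner_integrable M X f \<Longrightarrow> f \<in> ae_class M X f"
  by (simp add: ae_class_def)

lemma ae_classD:
  assumes "g \<in> ae_class M X f"
  shows "bochner_integrable M X g" "AE w in M. g w = f w" "ae_class M X g = ae_class M X f"
  using assms ae_class_cong[where f = g and g = f] by (auto simp: ae_class_def)

lemma some_ae_class:
  assumes "bochner_integrable M X f"
  shows "(SOME g. g \<in> ae_class M X f) \<in> ae_class M X f"
  using ae_class_self[OF assms] by (rule someI[of "\<lambda>g. g \<in> ae_class M X f"])

lemma L1_carrier: "bochner_integrable M X f \<Longrightarrow> ae_class M X f \<in> carrier (L1 M X)"
  by (auto simp: L1_def)

lemma L1_carrierE:
  assumes "F \<in> carrier (L1 M X)"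
  obtains f where "bochner_integrable M X f" "F = ae_class M X f"
  using assms by (auto simp: L1_def)

lemma L1_zero: "\<zero>\<^bsub>L1 M X\<^esub> = ae_class M X (\<lambda>_. \<zero>)"
  by (simp add: L1_def)

lemma L1_add:
  assumes "bochner_integrable M X f" "bochner_integrable M X g"
  shows "ae_class M X f \<oplus>\<^bsub>L1 M X\<^esub> ae_class M X g = ae_class M X (\<lambda>w. f w \<oplus> g w)"
proof -
  have "ae_class M X f \<oplus>\<^bsub>L1 M X\<^esub> ae_class M X g =
      ae_class M X (\<lambda>w. (SOME h. h \<in> ae_class M X f) w \<oplus> (SOME h. h \<in> ae_class M X g) w)"
    by (simp add: L1_def)
  also have "\<dots> = ae_class M X (\<lambda>w. f w \<oplus> g w)"
  proof (rule ae_class_cong)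
    show "AE w in M. (SOME h. h \<in> ae_class M X f) w \<oplus> (SOME h. h \<in> ae_class M X g) w = f w \<oplus> g w"
      using ae_classD(2)[OF some_ae_class[OF assms(1)]] ae_classD(2)[OF some_ae_class[OF assms(2)]]
      by eventually_elim simp
  qed
  finally show ?thesis .
qed

lemma L1_smult:
  assumes "bochner_integrable M X f"
  shows "a \<odot>\<^bsub>L1 M X\<^esub> ae_class M X f = ae_class M X (\<lambda>w. a \<odot> f w)"
proof -
  have "a \<odot>\<^bsub>L1 M X\<^esub> ae_class M X f = ae_class M X (\<lambda>w. a \<odot> (SOME h. h \<in> ae_class M X f) w)"
    by (simp add: L1_def)
  also have "\<dots> = ae_class M X (\<lambda>w. a \<odot> f w)"
  proof (rule ae_class_cong)
    show "AE w in M. a \<odot> (SOME h. h \<in> ae_class M X f) w = a \<odot> f w"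
      using ae_classD(2)[OF some_ae_class[OF assms]] by eventually_elim simp
  qed
  finally show ?thesis .
qed

lemma class_integral_ae_class:
  assumes "bochner_integrable M X f"
  shows "class_integral M X A (ae_class M X f) = (\<integral>\<^sup>+w\<in>A. ennreal (vnorm X (f w)) \<partial>M)"
  unfolding class_integral_def
proof (rule nn_integral_cong_AE)
  show "AE w in M. ennreal (vnorm X ((SOME f'. f' \<in> ae_class M X f) w)) * indicator A w
      = ennreal (vnorm X (f w)) * indicator A w"
    using ae_classD(2)[OF some_ae_class[OF assms]] by eventually_elim simp
qed

lemma vnorm_L1:
  assumes "bochner_integrable M X f"
  shows "vnorm (L1 M X) (ae_class M X f) = enn2real (\<integral>\<^sup>+w. ennreal (vnorm X (f w)) \<partial>M)"
proof -
  have "vnorm (L1 M X) (ae_class M X f) = enn2real (\<integral>\<^sup>+w\<in>space M. ennreal (vnorm X (f w)) \<partial>M)"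
    using class_integral_ae_class[OF assms] by (simp add: L1_def)
  also have "(\<integral>\<^sup>+w\<in>space M. ennreal (vnorm X (f w)) \<partial>M) = (\<integral>\<^sup>+w. ennreal (vnorm X (f w)) \<partial>M)"
    by (intro nn_integral_cong) simp
  finally show ?thesis .
qed

lemma ennreal_vnorm_L1:
  assumes "finite_measure M" "bochner_integrable M X f"
  shows "ennreal (vnorm (L1 M X) (ae_class M X f)) = (\<integral>\<^sup>+w. ennreal (vnorm X (f w)) \<partial>M)"
  using bochner_integrable_finite[OF assms] by (simp add: vnorm_L1 assms)

text \<open>
  All algebraic laws are checked on representatives, on which the operations act pointwise; they
  may be chosen freely by \<open>L1_add\<close> and \<open>L1_smult\<close>.
\<close>
theorem normed_space_L1:
  assumes M: "finite_measure M"
  shows "normed_space (L1 M X)"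
proof (rule normed_space.intro)
  note closed = bochner_integrable_closed
  have eqI: "ae_class M X f = ae_class M X g" if "\<And>w. w \<in> space M \<Longrightarrow> f w = g w" for f g
    using that by (intro ae_class_cong AE_I2) auto
  have "abelian_group (L1 M X)"
  proof (rule abelian_groupI)
    fix F G assume "F \<in> carrier (L1 M X)" "G \<in> carrier (L1 M X)"
    then obtain f g where fg: "bochner_integrable M X f" "F = ae_class M X f"
      "bochner_integrable M X g" "G = ae_class M X g" by (elim L1_carrierE) auto
    then show "F \<oplus>\<^bsub>L1 M X\<^esub> G \<in> carrier (L1 M X)"
      by (simp add: L1_add L1_carrier bochner_integrable_add)
    show "F \<oplus>\<^bsub>L1 M X\<^esub> G = G \<oplus>\<^bsub>L1 M X\<^esub> F"
      using fg closed[OF fg(1)] closed[OF fg(3)] by (auto simp: L1_add M.a_comm intro!: eqI)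
    fix H assume "H \<in> carrier (L1 M X)"
    then obtain h where h: "bochner_integrable M X h" "H = ae_class M X h" by (elim L1_carrierE) auto
    show "F \<oplus>\<^bsub>L1 M X\<^esub> G \<oplus>\<^bsub>L1 M X\<^esub> H = F \<oplus>\<^bsub>L1 M X\<^esub> (G \<oplus>\<^bsub>L1 M X\<^esub> H)"
      using fg h closed[OF fg(1)] closed[OF fg(3)] closed[OF h(1)]
      by (auto simp: L1_add bochner_integrable_add M.a_assoc intro!: eqI)
  next
    show "\<zero>\<^bsub>L1 M X\<^esub> \<in> carrier (L1 M X)"
      by (simp add: L1_zero L1_carrier bochner_integrable_const)
  next
    fix F assume "F \<in> carrier (L1 M X)"
    then obtain f where f: "bochner_integrable M X f" "F = ae_class M X f" by (elim L1_carrierE) auto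
    show "\<zero>\<^bsub>L1 M X\<^esub> \<oplus>\<^bsub>L1 M X\<^esub> F = F"
      using f closed[OF f(1)] by (auto simp: L1_zero L1_add bochner_integrable_const intro!: eqI)
    show "\<exists>G\<in>carrier (L1 M X). G \<oplus>\<^bsub>L1 M X\<^esub> F = \<zero>\<^bsub>L1 M X\<^esub>"
    proof (rule bexI)
      show "ae_class M X (\<lambda>w. (-1) \<odot> f w) \<oplus>\<^bsub>L1 M X\<^esub> F = \<zero>\<^bsub>L1 M X\<^esub>"
        using f closed[OF f(1)]
        by (auto simp: L1_zero L1_add bochner_integrable_smult minus_eq_smult[symmetric] M.l_neg intro!: eqI)
    qed (simp add: f L1_carrier bochner_integrable_smult)
  qed
  then show "module real_ring (L1 M X)"
  proof (rule moduleI[OF cring_real_ring])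
    fix a b :: real and F G assume "F \<in> carrier (L1 M X)"
    then obtain f where f: "bochner_integrable M X f" "F = ae_class M X f" by (elim L1_carrierE) auto
    note f' = closed[OF f(1)]
    show "a \<odot>\<^bsub>L1 M X\<^esub> F \<in> carrier (L1 M X)"
      by (simp add: f L1_smult L1_carrier bochner_integrable_smult)
    show "(a \<oplus>\<^bsub>real_ring\<^esub> b) \<odot>\<^bsub>L1 M X\<^esub> F = a \<odot>\<^bsub>L1 M X\<^esub> F \<oplus>\<^bsub>L1 M X\<^esub> b \<odot>\<^bsub>L1 M X\<^esub> F"
      using f f' by (auto simp: L1_smult L1_add bochner_integrable_smult smult_add_left intro!: eqI)
    show "(a \<otimes>\<^bsub>real_ring\<^esub> b) \<odot>\<^bsub>L1 M X\<^esub> F = a \<odot>\<^bsub>L1 M X\<^esub> (b \<odot>\<^bsub>L1 M X\<^esub> F)"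
      using f f' by (auto simp: L1_smult bochner_integrable_smult smult_smult intro!: eqI)
    show "\<one>\<^bsub>real_ring\<^esub> \<odot>\<^bsub>L1 M X\<^esub> F = F"
      using f f' by (auto simp: L1_smult intro!: eqI)
    assume "G \<in> carrier (L1 M X)"
    then obtain g where g: "bochner_integrable M X g" "G = ae_class M X g" by (elim L1_carrierE) auto
    show "a \<odot>\<^bsub>L1 M X\<^esub> (F \<oplus>\<^bsub>L1 M X\<^esub> G) = a \<odot>\<^bsub>L1 M X\<^esub> F \<oplus>\<^bsub>L1 M X\<^esub> a \<odot>\<^bsub>L1 M X\<^esub> G"
      using f f' g closed[OF g(1)]
      by (auto simp: L1_smult L1_add bochner_integrable_smult bochner_integrable_add smult_add_right intro!: eqI)
  qed
  show "normed_space_axioms (L1 M X)"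
  proof
    fix F assume "F \<in> carrier (L1 M X)"
    then obtain f where f: "bochner_integrable M X f" "F = ae_class M X f" by (elim L1_carrierE) auto
    note fm = bochner_integrable_strongly_measurable[OF f(1)]
    obtain h where h: "h \<in> borel_measurable M" "AE w in M. vnorm X (f w) = h w"
      by (rule vnorm_AE_measurable[OF fm])
    have int: "(\<integral>\<^sup>+w. ennreal (vnorm X (f w)) \<partial>M) = (\<integral>\<^sup>+w. ennreal (h w) \<partial>M)"
      using h(2) by (intro nn_integral_cong_AE) auto
    show "vnorm (L1 M X) F = 0 \<longleftrightarrow> F = \<zero>\<^bsub>L1 M X\<^esub>"
    proof
      assume "vnorm (L1 M X) F = 0"
      then have "(\<integral>\<^sup>+w. ennreal (h w) \<partial>M) = 0"
        using ennreal_vnorm_L1[OF M f(1)] f int by simp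
      then have "AE w in M. ennreal (h w) = 0"
        using h(1) by (subst (asm) nn_integral_0_iff_AE) auto
      then have "AE w in M. f w = \<zero>"
        using h(2) AE_space
      proof eventually_elim
        case (elim w)
        then show ?case
          using vnorm_nonneg[OF closed[OF f(1), of w]] vnorm_eq_zero[OF closed[OF f(1), of w]]
          by (simp add: ennreal_eq_0_iff)
      qed
      then show "F = \<zero>\<^bsub>L1 M X\<^esub>" unfolding f L1_zero by (rule ae_class_cong)
    next
      assume "F = \<zero>\<^bsub>L1 M X\<^esub>"
      then show "vnorm (L1 M X) F = 0" by (simp add: L1_zero vnorm_L1 bochner_integrable_const)
    qed
    show "vnorm (L1 M X) (a \<odot>\<^bsub>L1 M X\<^esub> F) = \<bar>a\<bar> * vnorm (L1 M X) F" for a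
    proof -
      have "(\<integral>\<^sup>+w. ennreal (vnorm X (a \<odot> f w)) \<partial>M) = (\<integral>\<^sup>+w. ennreal \<bar>a\<bar> * ennreal (h w) \<partial>M)"
      proof (rule nn_integral_cong_AE)
        show "AE w in M. ennreal (vnorm X (a \<odot> f w)) = ennreal \<bar>a\<bar> * ennreal (h w)"
          using h(2) AE_space
          by eventually_elim (simp add: vnorm_smult closed[OF f(1)] ennreal_mult')
      qed
      also have "\<dots> = ennreal \<bar>a\<bar> * (\<integral>\<^sup>+w. ennreal (h w) \<partial>M)"
        using h(1) by (intro nn_integral_cmult) auto
      finally show ?thesis
        using int by (simp add: f L1_smult vnorm_L1 bochner_integrable_smult enn2real_mult)
    qed
    fix G assume "G \<in> carrier (L1 M X)"
    then obtain g where g: "bochner_integrable M X g" "G = ae_class M X g" by (elim L1_carrierE) auto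
    note gm = bochner_integrable_strongly_measurable[OF g(1)]
    have "(\<integral>\<^sup>+w. ennreal (vnorm X (f w \<oplus> g w)) \<partial>M) \<le> (\<integral>\<^sup>+w. ennreal (vnorm X (f w) + vnorm X (g w)) \<partial>M)"
      by (intro nn_integral_mono ennreal_leI vnorm_triangle closed[OF f(1)] closed[OF g(1)])
    also have "\<dots> = ennreal (vnorm (L1 M X) F) + ennreal (vnorm (L1 M X) G)"
      by (simp add: nn_integral_vnorm_add[OF fm normed_space_axioms gm] f g ennreal_vnorm_L1[OF M])
    also have "\<dots> = ennreal (vnorm (L1 M X) F + vnorm (L1 M X) G)"
      by (intro ennreal_plus[symmetric]) (auto simp: f g vnorm_L1)
    finally show "vnorm (L1 M X) (F \<oplus>\<^bsub>L1 M X\<^esub> G) \<le> vnorm (L1 M X) F + vnorm (L1 M X) G"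
      by (simp add: f g L1_add vnorm_L1 bochner_integrable_add enn2real_leI)
  qed
qed

lemma L1_minus:
  assumes M: "finite_measure M" and f: "bochner_integrable M X f" and g: "bochner_integrable M X g"
  shows "ae_class M X f \<ominus>\<^bsub>L1 M X\<^esub> ae_class M X g = ae_class M X (\<lambda>w. f w \<ominus> g w)"
    and "bochner_integrable M X (\<lambda>w. f w \<ominus> g w)"
proof -
  interpret L: normed_space "L1 M X" by (rule normed_space_L1[OF M])
  have eq: "f w \<ominus> g w = f w \<oplus> (-1) \<odot> g w" if "w \<in> space M" for w
    using that bochner_integrable_closed[OF g] by (simp add: a_minus_def minus_eq_smult)
  have "ae_class M X f \<ominus>\<^bsub>L1 M X\<^esub> ae_class M X g = ae_class M X (\<lambda>w. f w \<oplus> (-1) \<odot> g w)"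
    using f g by (simp add: a_minus_def L.minus_eq_smult L1_carrier L1_smult L1_add bochner_integrable_smult)
  also have "\<dots> = ae_class M X (\<lambda>w. f w \<ominus> g w)"
    using eq by (intro ae_class_cong AE_I2) simp
  finally show "ae_class M X f \<ominus>\<^bsub>L1 M X\<^esub> ae_class M X g = ae_class M X (\<lambda>w. f w \<ominus> g w)" .
  have *: "bochner_integrable M X (\<lambda>w. f w \<oplus> (-1) \<odot> g w)"
    by (intro bochner_integrable_add bochner_integrable_smult f g)
  obtain s where s0: "\<forall>i. simple_into M X (s i)"
    "(\<lambda>i. \<integral>\<^sup>+w. ennreal (vnorm X (f w \<oplus> (-1) \<odot> g w \<ominus> s i w)) \<partial>M) \<longlonglongrightarrow> 0"
    by (rule bochner_integrableE[OF *])
    note s = s0(1)[rule_format] s0(2)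
  have "(\<integral>\<^sup>+w. ennreal (vnorm X (f w \<ominus> g w \<ominus> s i w)) \<partial>M)
      = (\<integral>\<^sup>+w. ennreal (vnorm X (f w \<oplus> (-1) \<odot> g w \<ominus> s i w)) \<partial>M)" for i
    by (intro nn_integral_cong) (simp add: eq)
  then show "bochner_integrable M X (\<lambda>w. f w \<ominus> g w)"
    using s f g unfolding bochner_integrable_def
    by (intro conjI exI[of _ s]) (auto intro!: strongly_measurable_minus)
qed

end

section \<open>Operators acting fibrewise and uniform integrability\<close>

text \<open>
  Three families of operators on Lebesgue-Bochner spaces act by a contraction that may depend on the
  point of the probability space: restriction to a measurable set, taking tails, and taking a
  coordinate.  That the image of each constant function is simple makes images of simple functions simple,
  which preserves strong measurability.
\<close>
definition fibrewise_contraction ::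
    "'w measure \<Rightarrow> ('a, 'm) normed_module_scheme \<Rightarrow> ('b, 'n) normed_module_scheme \<Rightarrow>
      ('w \<Rightarrow> 'a \<Rightarrow> 'b) \<Rightarrow> bool" where
  "fibrewise_contraction M X Y p \<longleftrightarrow>
     (\<forall>w\<in>space M.
        (\<forall>x\<in>carrier X. p w x \<in> carrier Y \<and> vnorm Y (p w x) \<le> vnorm X x) \<and>
        (\<forall>x\<in>carrier X. \<forall>y\<in>carrier X. p w (x \<oplus>\<^bsub>X\<^esub> y) = p w x \<oplus>\<^bsub>Y\<^esub> p w y) \<and>
        (\<forall>a. \<forall>x\<in>carrier X. p w (a \<odot>\<^bsub>X\<^esub> x) = a \<odot>\<^bsub>Y\<^esub> p w x)) \<and>
     (\<forall>x\<in>carrier X. simple_function M (\<lambda>w. p w x))"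

definition L1_map ::
    "'w measure \<Rightarrow> ('b, 'n) normed_module_scheme \<Rightarrow> ('w \<Rightarrow> 'a \<Rightarrow> 'b) \<Rightarrow> ('w \<Rightarrow> 'a) set \<Rightarrow> ('w \<Rightarrow> 'b) set"
  where "L1_map M Y p F = ae_class M Y (\<lambda>w. p w ((SOME f. f \<in> F) w))"

locale fibrewise =
  X: normed_space X + Y: normed_space Y + finite_measure M
  for M :: "'w measure" and X :: "('a, 'm) normed_module_scheme"
    and Y :: "('b, 'n) normed_module_scheme" +
  fixes p :: "'w \<Rightarrow> 'a \<Rightarrow> 'b"
  assumes p: "fibrewise_contraction M X Y p"
begin

lemma closed [simp]: "w \<in> space M \<Longrightarrow> x \<in> carrier X \<Longrightarrow> p w x \<in> carrier Y"
  and contraction: "w \<in> space M \<Longrightarrow> x \<in> carrier X \<Longrightarrow> vnorm Y (p w x) \<le> vnorm X x"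
  and additive: "w \<in> space M \<Longrightarrow> x \<in> carrier X \<Longrightarrow> y \<in> carrier X \<Longrightarrow> p w (x \<oplus>\<^bsub>X\<^esub> y) = p w x \<oplus>\<^bsub>Y\<^esub> p w y"
  and homogeneous: "w \<in> space M \<Longrightarrow> x \<in> carrier X \<Longrightarrow> p w (a \<odot>\<^bsub>X\<^esub> x) = a \<odot>\<^bsub>Y\<^esub> p w x"
  and simple: "x \<in> carrier X \<Longrightarrow> simple_function M (\<lambda>w. p w x)"
  using p by (auto simp: fibrewise_contraction_def)

lemma subtractive:
  "w \<in> space M \<Longrightarrow> x \<in> carrier X \<Longrightarrow> y \<in> carrier X \<Longrightarrow> p w (x \<ominus>\<^bsub>X\<^esub> y) = p w x \<ominus>\<^bsub>Y\<^esub> p w y"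
  by (simp add: a_minus_def X.minus_eq_smult Y.minus_eq_smult additive homogeneous)

lemma simple_into_fibrewise:
  assumes s: "simple_into M X s"
  shows "simple_into M Y (\<lambda>w. p w (s w))"
proof -
  note sX = X.simple_into_closed[OF s]
  have sf: "simple_function M s" using s by (simp add: simple_into_def)
  note fin = simple_functionD(1)[OF sf]
  have fin_p: "finite ((\<lambda>w. p w x) ` space M)" if "x \<in> s ` space M" for x
    using that sX by (intro simple_functionD(1)[OF simple]) auto
  have "simple_function M (\<lambda>w. p w (s w))"
    unfolding simple_function_def
  proof (intro conjI ballI)
    have "(\<lambda>w. p w (s w)) ` space M \<subseteq> (\<Union>x\<in>s ` space M. (\<lambda>w. p w x) ` space M)" by auto
    then show "finite ((\<lambda>w. p w (s w)) ` space M)"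
      by (rule finite_subset) (intro finite_UN_I fin fin_p)
    fix y
    have "(\<lambda>w. p w (s w)) -` {y} \<inter> space M
        = (\<Union>x\<in>s ` space M. (s -` {x} \<inter> space M) \<inter> ((\<lambda>w. p w x) -` {y} \<inter> space M))" by auto
    also have "\<dots> \<in> sets M"
      using sX by (intro sets.finite_UN fin sets.Int simple_functionD(2)[OF sf] simple_functionD(2)[OF simple]) auto
    finally show "(\<lambda>w. p w (s w)) -` {y} \<inter> space M \<in> sets M" .
  qed
  then show ?thesis using sX by (auto simp: simple_into_def)
qed

text \<open>
  A contraction in every fibre does not increase the distance to a simple function, so the images of
  the approximating simple functions approximate the image.
\<close>
lemma bochner_integrable_fibrewise:
  assumes f: "bochner_integrable M X f"
  shows "bochner_integrable M Y (\<lambda>w. p w (f w))"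
proof -
  note fX = X.bochner_integrable_closed[OF f]
  have le: "vnorm Y (p w (f w) \<ominus>\<^bsub>Y\<^esub> p w (s w)) \<le> vnorm X (f w \<ominus>\<^bsub>X\<^esub> s w)"
    if "w \<in> space M" "simple_into M X s" for w s
    using that fX X.simple_into_closed[OF that(2)] by (simp add: subtractive[symmetric] contraction)
  have "strongly_measurable M X f" by (rule X.bochner_integrable_strongly_measurable[OF f])
  then obtain s where s: "\<forall>i. simple_into M X (s i)" "AE w in M. (\<lambda>i. vnorm X (f w \<ominus>\<^bsub>X\<^esub> s i w)) \<longlonglongrightarrow> 0"
    by (rule X.strongly_measurableE)
  obtain t where t: "\<forall>i. simple_into M X (t i)"
    "(\<lambda>i. \<integral>\<^sup>+w. ennreal (vnorm X (f w \<ominus>\<^bsub>X\<^esub> t i w)) \<partial>M) \<longlonglongrightarrow> 0"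
    by (rule X.bochner_integrableE[OF f])
  have sm: "strongly_measurable M Y (\<lambda>w. p w (f w))"
  proof (rule Y.strongly_measurableI)
    show "simple_into M Y (\<lambda>w. p w (s i w))" for i using s(1) by (simp add: simple_into_fibrewise)
    show "AE w in M. (\<lambda>i. vnorm Y (p w (f w) \<ominus>\<^bsub>Y\<^esub> p w (s i w))) \<longlonglongrightarrow> 0"
      using s(2) AE_space
    proof eventually_elim
      case (elim w)
      show ?case
      proof (rule tendsto_sandwich[OF _ _ tendsto_const elim(1)])
        show "\<forall>\<^sub>F i in sequentially. 0 \<le> vnorm Y (p w (f w) \<ominus>\<^bsub>Y\<^esub> p w (s i w))"
          using elim(2) fX[OF elim(2)] X.simple_into_closed[OF s(1)[rule_format] elim(2)]
          by (intro always_eventually allI Y.vnorm_nonneg Y.M.minus_closed closed)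
        show "\<forall>\<^sub>F i in sequentially. vnorm Y (p w (f w) \<ominus>\<^bsub>Y\<^esub> p w (s i w)) \<le> vnorm X (f w \<ominus>\<^bsub>X\<^esub> s i w)"
          using le elim(2) s(1) by auto
      qed
    qed
  qed (use fX in auto)
  show ?thesis
    unfolding bochner_integrable_def
  proof (intro conjI sm exI[of _ "\<lambda>i w. p w (t i w)"] allI)
    show "simple_into M Y (\<lambda>w. p w (t i w))" for i using t(1) by (simp add: simple_into_fibrewise)
    show "(\<lambda>i. \<integral>\<^sup>+w. ennreal (vnorm Y (p w (f w) \<ominus>\<^bsub>Y\<^esub> p w (t i w))) \<partial>M) \<longlonglongrightarrow> 0"
    proof (rule tendsto_sandwich[OF _ _ tendsto_const t(2)])
      show "\<forall>\<^sub>F i in sequentially. (\<integral>\<^sup>+w. ennreal (vnorm Y (p w (f w) \<ominus>\<^bsub>Y\<^esub> p w (t i w))) \<partial>M)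
          \<le> (\<integral>\<^sup>+w. ennreal (vnorm X (f w \<ominus>\<^bsub>X\<^esub> t i w)) \<partial>M)"
        using le t(1) by (intro always_eventually allI nn_integral_mono ennreal_leI) auto
    qed simp
  qed
qed

lemma L1_map_ae_class:
  assumes f: "bochner_integrable M X f"
  shows "L1_map M Y p (ae_class M X f) = ae_class M Y (\<lambda>w. p w (f w))"
  unfolding L1_map_def
proof (rule Y.ae_class_cong)
  show "AE w in M. p w ((SOME g. g \<in> ae_class M X f) w) = p w (f w)"
    using X.ae_classD(2)[OF X.some_ae_class[OF f]] by eventually_elim simp
qed

lemma L1_map_closed: "F \<in> carrier (L1 M X) \<Longrightarrow> L1_map M Y p F \<in> carrier (L1 M Y)"
  by (elim X.L1_carrierE) (simp add: L1_map_ae_class Y.L1_carrier bochner_integrable_fibrewise)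

lemma L1_map_add:
  assumes "F \<in> carrier (L1 M X)" "G \<in> carrier (L1 M X)"
  shows "L1_map M Y p (F \<oplus>\<^bsub>L1 M X\<^esub> G) = L1_map M Y p F \<oplus>\<^bsub>L1 M Y\<^esub> L1_map M Y p G"
proof -
  obtain f g where f: "bochner_integrable M X f" "F = ae_class M X f"
    and g: "bochner_integrable M X g" "G = ae_class M X g"
    using assms by (elim X.L1_carrierE) auto
  have "L1_map M Y p (F \<oplus>\<^bsub>L1 M X\<^esub> G) = ae_class M Y (\<lambda>w. p w (f w \<oplus>\<^bsub>X\<^esub> g w))"
    using f g by (simp add: X.L1_add L1_map_ae_class X.bochner_integrable_add)
  also have "\<dots> = ae_class M Y (\<lambda>w. p w (f w) \<oplus>\<^bsub>Y\<^esub> p w (g w))"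
    using X.bochner_integrable_closed[OF f(1)] X.bochner_integrable_closed[OF g(1)]
    by (intro Y.ae_class_cong AE_I2) (simp add: additive)
  also have "\<dots> = L1_map M Y p F \<oplus>\<^bsub>L1 M Y\<^esub> L1_map M Y p G"
    using f g by (simp add: Y.L1_add L1_map_ae_class bochner_integrable_fibrewise)
  finally show ?thesis .
qed

lemma L1_map_smult:
  assumes "F \<in> carrier (L1 M X)"
  shows "L1_map M Y p (a \<odot>\<^bsub>L1 M X\<^esub> F) = a \<odot>\<^bsub>L1 M Y\<^esub> L1_map M Y p F"
proof -
  obtain f where f: "bochner_integrable M X f" "F = ae_class M X f"
    using assms by (elim X.L1_carrierE) auto
  have "L1_map M Y p (a \<odot>\<^bsub>L1 M X\<^esub> F) = ae_class M Y (\<lambda>w. p w (a \<odot>\<^bsub>X\<^esub> f w))"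
    using f by (simp add: X.L1_smult L1_map_ae_class X.bochner_integrable_smult)
  also have "\<dots> = ae_class M Y (\<lambda>w. a \<odot>\<^bsub>Y\<^esub> p w (f w))"
    using X.bochner_integrable_closed[OF f(1)]
    by (intro Y.ae_class_cong AE_I2) (simp add: homogeneous)
  also have "\<dots> = a \<odot>\<^bsub>L1 M Y\<^esub> L1_map M Y p F"
    using f by (simp add: Y.L1_smult L1_map_ae_class bochner_integrable_fibrewise)
  finally show ?thesis .
qed

lemma vnorm_L1_map_le:
  assumes "F \<in> carrier (L1 M X)"
  shows "vnorm (L1 M Y) (L1_map M Y p F) \<le> vnorm (L1 M X) F"
proof -
  obtain f where f: "bochner_integrable M X f" "F = ae_class M X f"
    using assms by (elim X.L1_carrierE) auto
  have "(\<integral>\<^sup>+w. ennreal (vnorm Y (p w (f w))) \<partial>M) \<le> (\<integral>\<^sup>+w. ennreal (vnorm X (f w)) \<partial>M)"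
    using X.bochner_integrable_closed[OF f(1)] by (intro nn_integral_mono ennreal_leI contraction)
  then show ?thesis
    using f X.bochner_integrable_finite[OF finite_measure_axioms f(1)]
    by (simp add: L1_map_ae_class X.vnorm_L1 Y.vnorm_L1 bochner_integrable_fibrewise enn2real_mono)
qed

lemma relatively_weakly_compact_L1_map:
  assumes "relatively_weakly_compact (L1 M X) K"
  shows "relatively_weakly_compact (L1 M Y) (L1_map M Y p ` K)"
  by (rule relatively_weakly_compact_image[OF _ _ assms])
     (assumption | rule X.normed_space_L1 Y.normed_space_L1 finite_measure_axioms
       L1_map_closed L1_map_add L1_map_smult vnorm_L1_map_le)+

end

context normed_space
begin

text \<open>
  This is dominated convergence, with the norm of a representative of \<open>F\<close> as the dominating function.
\<close>
lemma L1_map_tendsto_zero: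
  assumes M: "finite_measure M" and p: "\<And>n::nat. fibrewise_contraction M X X (p n)"
    and lim: "AE w in M. \<forall>x\<in>carrier X. (\<lambda>n. vnorm X (p n w x)) \<longlonglongrightarrow> 0"
    and F: "F \<in> carrier (L1 M X)"
  shows "(\<lambda>n. vnorm (L1 M X) (L1_map M X (p n) F)) \<longlonglongrightarrow> 0"
proof -
  interpret finite_measure M by fact
  have fw: "fibrewise M X X (p n)" for n
    by (intro fibrewise.intro fibrewise_axioms.intro normed_space_axioms M p)
  obtain f where f: "bochner_integrable M X f" "F = ae_class M X f"
    using F by (rule L1_carrierE)
  note fX = bochner_integrable_closed[OF f(1)]
  note pf = fibrewise.bochner_integrable_fibrewise[OF fw f(1)]
  obtain h where h: "h \<in> borel_measurable M" "AE w in M. vnorm X (f w) = h w"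
    by (rule vnorm_AE_measurable[OF bochner_integrable_strongly_measurable[OF f(1)]])
  have "\<exists>k. k \<in> borel_measurable M \<and> (AE w in M. vnorm X (p n w (f w)) = k w)" for n
    by (rule vnorm_AE_measurable[OF bochner_integrable_strongly_measurable[OF pf[of n]]]) blast
  then obtain k where k: "\<And>n. k n \<in> borel_measurable M" "\<And>n. AE w in M. vnorm X (p n w (f w)) = k n w"
    by metis
  have "(\<lambda>n. \<integral>\<^sup>+w. ennreal (k n w) \<partial>M) \<longlonglongrightarrow> (\<integral>\<^sup>+w. 0 \<partial>M)"
  proof (rule nn_integral_dominated_convergence[where w = "\<lambda>w. ennreal (h w)"])
    show "AE w in M. ennreal (k n w) \<le> ennreal (h w)" for n
      using h(2) k(2)[of n] AE_space
    proof eventually_elim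
      case (elim w)
      then show ?case
        using fibrewise.contraction[OF fw elim(3) fX[OF elim(3)], of n] by (intro ennreal_leI) simp
    qed
    have "(\<integral>\<^sup>+w. ennreal (h w) \<partial>M) = (\<integral>\<^sup>+w. ennreal (vnorm X (f w)) \<partial>M)"
      using h(2) by (intro nn_integral_cong_AE) auto
    then show "(\<integral>\<^sup>+w. ennreal (h w) \<partial>M) < \<infinity>" using bochner_integrable_finite[OF M f(1)] by simp
    have "AE w in M. \<forall>n. vnorm X (p n w (f w)) = k n w" using k(2) by (simp add: AE_all_countable)
    then show "AE w in M. (\<lambda>n. ennreal (k n w)) \<longlonglongrightarrow> 0"
      using lim AE_space
    proof eventually_elim
      case (elim w)
      have "(\<lambda>n. vnorm X (p n w (f w))) \<longlonglongrightarrow> 0" using elim(2) fX[OF elim(3)] by blast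
      then have "(\<lambda>n. k n w) \<longlonglongrightarrow> 0" using elim(1) by simp
      from tendsto_ennrealI[OF this] show ?case by simp
    qed
  qed (use h(1) k(1) in auto)
  moreover have "(\<integral>\<^sup>+w. ennreal (k n w) \<partial>M) = (\<integral>\<^sup>+w. ennreal (vnorm X (p n w (f w))) \<partial>M)" for n
    using k(2)[of n] by (intro nn_integral_cong_AE) auto
  ultimately have "(\<lambda>n. \<integral>\<^sup>+w. ennreal (vnorm X (p n w (f w))) \<partial>M) \<longlonglongrightarrow> 0" by simp
  then have "(\<lambda>n. ennreal (vnorm (L1 M X) (L1_map M X (p n) F))) \<longlonglongrightarrow> 0"
    using f(1) by (simp add: f(2) fibrewise.L1_map_ae_class[OF fw] ennreal_vnorm_L1[OF M pf])
  then show ?thesis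
    by (rule tendsto_ennrealD[of _ 0, simplified])
       (auto simp: f fibrewise.L1_map_ae_class[OF fw] vnorm_L1[OF pf])
qed

text \<open>
  Integration turns the additivity of the norm in each fibre into additivity of the norm of the
  Lebesgue-Bochner space.
\<close>
theorem L1_uniform_decay:
  assumes M: "finite_measure M" and p: "\<And>n::nat. fibrewise_contraction M X X (p n)"
    and split: "\<And>m n w x. n \<le> m \<Longrightarrow> w \<in> space M \<Longrightarrow> x \<in> carrier X \<Longrightarrow>
        vnorm X (p n w x) = vnorm X (p m w x) + vnorm X (p n w x \<ominus> p m w x)"
    and lim: "AE w in M. \<forall>x\<in>carrier X. (\<lambda>n. vnorm X (p n w x)) \<longlonglongrightarrow> 0"
    and K: "relatively_weakly_compact (L1 M X) K" and \<epsilon>: "\<epsilon> > 0"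
  shows "\<exists>n. \<forall>F\<in>K. vnorm (L1 M X) (L1_map M X (p n) F) \<le> \<epsilon>"
proof -
  interpret L: normed_space "L1 M X" by (rule normed_space_L1[OF M])
  have fw: "fibrewise M X X (p n)" for n
    by (intro fibrewise.intro fibrewise_axioms.intro normed_space_axioms M p)
  show ?thesis
  proof (rule L.uniform_decay_of_L_projections[OF K])
    fix m n :: nat and F assume mn: "n \<le> m" and "F \<in> carrier (L1 M X)"
    then obtain f where f: "bochner_integrable M X f" "F = ae_class M X f" by (elim L1_carrierE) auto
    note fX = bochner_integrable_closed[OF f(1)]
    note pf = fibrewise.bochner_integrable_fibrewise[OF fw f(1)]
    note sub = L1_minus[OF M pf[of n] pf[of m]]
    have "(\<integral>\<^sup>+w. ennreal (vnorm X (p n w (f w))) \<partial>M)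
        = (\<integral>\<^sup>+w. ennreal (vnorm X (p m w (f w)) + vnorm X (p n w (f w) \<ominus> p m w (f w))) \<partial>M)"
      using split[OF mn] fX by (intro nn_integral_cong) auto
    also have "\<dots> = (\<integral>\<^sup>+w. ennreal (vnorm X (p m w (f w))) \<partial>M)
        + (\<integral>\<^sup>+w. ennreal (vnorm X (p n w (f w) \<ominus> p m w (f w))) \<partial>M)"
      by (intro nn_integral_vnorm_add normed_space_axioms bochner_integrable_strongly_measurable pf sub)
    finally show "vnorm (L1 M X) (L1_map M X (p n) F) = vnorm (L1 M X) (L1_map M X (p m) F)
        + vnorm (L1 M X) (L1_map M X (p n) F \<ominus>\<^bsub>L1 M X\<^esub> L1_map M X (p m) F)"
      using f(1) bochner_integrable_finite[OF M pf[of m]] bochner_integrable_finite[OF M sub(2)]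
      by (simp add: f(2) fibrewise.L1_map_ae_class[OF fw] sub vnorm_L1[OF pf] vnorm_L1[OF sub(2)] enn2real_plus)
  next
    fix F assume "F \<in> carrier (L1 M X)"
    then show "(\<lambda>n. vnorm (L1 M X) (L1_map M X (p n) F)) \<longlonglongrightarrow> 0"
      by (rule L1_map_tendsto_zero[OF M p lim])
  qed (assumption | rule \<epsilon> fibrewise.L1_map_closed[OF fw] fibrewise.L1_map_add[OF fw]
      fibrewise.L1_map_smult[OF fw] fibrewise.vnorm_L1_map_le[OF fw])+
qed

text \<open>
  If uniform integrability fails, there are sets \<open>A n\<close> of measure at most \<open>2\<^bsup>-n\<^esup>\<close> on which members of
  \<open>K\<close> have integral above \<open>\<epsilon>\<close>.  Restrictions to the decreasing sets \<open>B n\<close>, the unions of the \<open>A k\<close> with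
  \<open>k \<ge> n\<close>, tend to zero almost everywhere by the Borel-Cantelli lemma and hence uniformly on \<open>K\<close>.
\<close>
theorem relatively_weakly_compact_imp_uniformly_integrable:
  assumes M: "prob_space M" and K: "relatively_weakly_compact (L1 M X) K"
  shows "uniformly_integrable M X K"
proof -
  interpret prob_space M by fact
  have fin: "finite_measure M" by (rule finite_measure_axioms)
  interpret L: normed_space "L1 M X" by (rule normed_space_L1[OF fin])
  have KX: "K \<subseteq> carrier (L1 M X)" using K by (simp add: relatively_weakly_compact_def)
  have small: "\<exists>\<delta>>0. \<forall>A\<in>sets M. measure M A \<le> \<delta> \<longrightarrow> (SUP F\<in>K. class_integral M X A F) \<le> ennreal \<epsilon>"
    if \<epsilon>: "\<epsilon> > 0" for \<epsilon> :: real
  proof (rule ccontr)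
    assume contr: "\<not> ?thesis"
    have "\<exists>A F. A \<in> sets M \<and> measure M A \<le> (1/2) ^ n \<and> F \<in> K \<and> ennreal \<epsilon> < class_integral M X A F" for n
    proof -
      have "(1/2::real) ^ n > 0" by simp
      then obtain A where "A \<in> sets M" "measure M A \<le> (1/2) ^ n" "\<not> (SUP F\<in>K. class_integral M X A F) \<le> ennreal \<epsilon>"
        using contr by blast
      then show ?thesis by (auto simp: SUP_le_iff not_le)
    qed
    then obtain A F where A: "\<And>n. A n \<in> sets M" "\<And>n. measure M (A n) \<le> (1/2) ^ n"
      and F: "\<And>n. F n \<in> K" "\<And>n. ennreal \<epsilon> < class_integral M X (A n) (F n)" by metis
    define B where "B n = (\<Union>k\<in>{n..}. A k)" for n
    have B: "B n \<in> sets M" for n unfolding B_def using A(1) by (intro sets.countable_UN') auto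
    define p where "p n w x = (if w \<in> B n then x else \<zero>)" for n w x
    have p: "fibrewise_contraction M X X (p n)" for n
      unfolding fibrewise_contraction_def
    proof (intro conjI ballI allI)
      fix x
      have "simple_function M (\<lambda>w. if w \<in> B n then x else \<zero>)"
        using B[of n] by (intro simple_function_If_set) (auto simp: Int_absorb2 sets.sets_into_space)
      then show "simple_function M (\<lambda>w. p n w x)" by (simp add: p_def)
    qed (auto simp: p_def vnorm_nonneg)
    have "summable (\<lambda>n. measure M (A n))"
      by (rule summable_comparison_test'[of "\<lambda>n. (1/2::real) ^ n" 0]) (use A(2) in \<open>auto simp: summable_geometric\<close>)
    then have "AE w in M. \<forall>\<^sub>F n in sequentially. w \<in> space M - A n"
      using A(1) by (intro borel_cantelli_AE1) (auto simp: emeasure_eq_measure)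
    then have lim: "AE w in M. \<forall>x\<in>carrier X. (\<lambda>n. vnorm X (p n w x)) \<longlonglongrightarrow> 0"
    proof eventually_elim
      case (elim w)
      then obtain N where "\<And>n. n \<ge> N \<Longrightarrow> w \<notin> A n" by (auto simp: eventually_sequentially)
      then have "w \<notin> B n" if "n \<ge> N" for n using that by (auto simp: B_def)
      then have "\<forall>\<^sub>F n in sequentially. vnorm X (p n w x) = 0" for x
        by (auto simp: p_def eventually_sequentially)
      then show ?case by (auto intro: tendsto_eventually)
    qed
    have "\<exists>n. \<forall>F\<in>K. vnorm (L1 M X) (L1_map M X (p n) F) \<le> \<epsilon>"
    proof (rule L1_uniform_decay[OF fin p _ lim K \<epsilon>])
      fix m n :: nat and w x assume "n \<le> m" "x \<in> carrier X"
      moreover from \<open>n \<le> m\<close> have "B m \<subseteq> B n" unfolding B_def by (intro UN_mono) auto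
      ultimately show "vnorm X (p n w x) = vnorm X (p m w x) + vnorm X (p n w x \<ominus> p m w x)"
        by (auto simp: p_def)
    qed
    then obtain n where n: "\<And>F. F \<in> K \<Longrightarrow> vnorm (L1 M X) (L1_map M X (p n) F) \<le> \<epsilon>" by blast
    have fw: "fibrewise M X X (p n)"
      by (intro fibrewise.intro fibrewise_axioms.intro normed_space_axioms fin p)
    obtain f where f: "bochner_integrable M X f" "F n = ae_class M X f"
      using L1_carrierE[of "F n"] F(1)[of n] KX by blast
    note pf = fibrewise.bochner_integrable_fibrewise[OF fw f(1)]
    have "class_integral M X (A n) (F n) = (\<integral>\<^sup>+w\<in>A n. ennreal (vnorm X (f w)) \<partial>M)"
      unfolding f(2) by (rule class_integral_ae_class[OF f(1)])
    also have "\<dots> \<le> (\<integral>\<^sup>+w. ennreal (vnorm X (p n w (f w))) \<partial>M)"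
      by (intro nn_integral_mono) (auto simp: p_def B_def indicator_def)
    also have "\<dots> = ennreal (vnorm (L1 M X) (L1_map M X (p n) (F n)))"
      by (simp add: f(2) fibrewise.L1_map_ae_class[OF fw f(1)] ennreal_vnorm_L1[OF fin pf])
    also have "\<dots> \<le> ennreal \<epsilon>" using n[OF F(1)] by (rule ennreal_leI)
    finally show False using F(2)[of n] by simp
  qed
  show ?thesis
    unfolding uniformly_integrable_def
    using KX L.relatively_weakly_compact_bounded[OF K] small by blast
qed

end

section \<open>The \<open>\<ell>\<^sup>r\<close>-sum as a normed space\<close>

text \<open>
  This is convexity of \<open>u \<mapsto> u\<^sup>r\<close>, with weights \<open>s / (s + t)\<close> and \<open>t / (s + t)\<close> at the points \<open>a / s\<close> and
  \<open>b / t\<close>.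
\<close>
lemma powr_add_le:
  fixes a b s t r :: real
  assumes r: "1 \<le> r" and "0 \<le> a" "0 \<le> b" and s: "0 < s" and t: "0 < t"
  shows "(a + b) powr r \<le> (s + t) powr r * (s / (s + t) * (a / s) powr r + t / (s + t) * (b / t) powr r)"
proof -
  define c where "c = s / (s + t)"
  have c: "0 < c" "c < 1" "1 - c = t / (s + t)" using s t by (auto simp: c_def field_simps)
  have small: "l powr r \<le> l" if "0 < l" "l < 1" for l :: real
    using powr_mono'[of 1 r l] that r by simp
  have conv: "(c * u + (1 - c) * v) powr r \<le> c * u powr r + (1 - c) * v powr r" if "0 \<le> u" "0 \<le> v" for u v
  proof (cases "u = 0 \<or> v = 0")
    case True
    then show ?thesis
      using mult_right_mono[OF small[of c], of "u powr r"] mult_right_mono[OF small[of "1 - c"], of "v powr r"]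
        that c(1,2) by (auto simp: powr_mult)
  next
    case False
    then show ?thesis
      using convex_onD[OF powr_convex[OF r], of "1 - c" u v] that c(1,2) by simp
  qed
  have "a + b = (s + t) * (c * (a / s) + (1 - c) * (b / t))"
  proof -
    have "c * (a / s) = a / (s + t)" "(1 - c) * (b / t) = b / (s + t)"
      unfolding c(3) using s t by (simp_all add: c_def)
    then show ?thesis using s t by (simp add: add_divide_distrib[symmetric])
  qed
  then have "(a + b) powr r = (s + t) powr r * (c * (a / s) + (1 - c) * (b / t)) powr r"
    using assms c by (simp add: powr_mult)
  also have "\<dots> \<le> (s + t) powr r * (c * (a / s) powr r + (1 - c) * (b / t) powr r)"
    using assms by (intro mult_left_mono conv) auto
  finally show ?thesis unfolding c(3) by (simp add: c_def)
qed

lemma summable_powr_add: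
  fixes a b :: "nat \<Rightarrow> real"
  assumes r: "1 \<le> r" and ab: "\<And>n. 0 \<le> a n" "\<And>n. 0 \<le> b n"
    and sum: "summable (\<lambda>n. a n powr r)" "summable (\<lambda>n. b n powr r)"
  shows "summable (\<lambda>n. (a n + b n) powr r)"
proof (rule summable_comparison_test'[of "\<lambda>n. 2 powr r * (1 / 2 * a n powr r + 1 / 2 * b n powr r)" 0])
  show "summable (\<lambda>n. 2 powr r * (1 / 2 * a n powr r + 1 / 2 * b n powr r))"
    using sum by (intro summable_mult summable_add)
  show "norm ((a n + b n) powr r) \<le> 2 powr r * (1 / 2 * a n powr r + 1 / 2 * b n powr r)" for n
    using powr_add_le[OF r ab, of 1 1 n n] by simp
qed

text \<open>
  Taking \<open>s\<close> and \<open>t\<close> to be the two norms, \<open>powr_add_le\<close> sums to the bound \<open>(s + t)\<^sup>r\<close>.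
\<close>
lemma minkowski_inequality:
  fixes a b :: "nat \<Rightarrow> real"
  assumes r: "1 \<le> r" and ab: "\<And>n. 0 \<le> a n" "\<And>n. 0 \<le> b n"
    and sum: "summable (\<lambda>n. a n powr r)" "summable (\<lambda>n. b n powr r)"
  shows "(\<Sum>n. (a n + b n) powr r) powr (1 / r) \<le> (\<Sum>n. a n powr r) powr (1 / r) + (\<Sum>n. b n powr r) powr (1 / r)"
proof -
  define s t where "s = (\<Sum>n. a n powr r) powr (1 / r)" and "t = (\<Sum>n. b n powr r) powr (1 / r)"
  have nn: "0 \<le> (\<Sum>n. a n powr r)" "0 \<le> (\<Sum>n. b n powr r)" using sum by (auto intro!: suminf_nonneg)
  have sr: "s powr r = (\<Sum>n. a n powr r)" and tr: "t powr r = (\<Sum>n. b n powr r)"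
    using r nn by (auto simp: s_def t_def powr_powr)
  have zero: "c n = 0" if "summable (\<lambda>n. c n powr r)" "(\<Sum>n. c n powr r) = 0" for c :: "nat \<Rightarrow> real" and n
    using suminf_eq_zero_iff[OF that(1)] that(2) by auto
  consider "s = 0" | "t = 0" | "0 < s" "0 < t" using s_def t_def by (metis powr_ge_zero order_le_less)
  then show ?thesis
  proof cases
    case 1
    then have "a n = 0" for n using zero[OF sum(1)] sr r by simp
    then show ?thesis by simp
  next
    case 2
    then have "b n = 0" for n using zero[OF sum(2)] tr r by simp
    then show ?thesis by simp
  next
    case 3
    define R where "R n = (s + t) powr r * (s / (s + t) * (a n / s) powr r + t / (s + t) * (b n / t) powr r)" for n
    have "(\<lambda>n. (a n / s) powr r) sums 1"
      using sums_divide[OF summable_sums[OF sum(1)], of "s powr r"] ab 3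
      unfolding sr[symmetric] by (simp add: powr_divide)
    moreover have "(\<lambda>n. (b n / t) powr r) sums 1"
      using sums_divide[OF summable_sums[OF sum(2)], of "t powr r"] ab 3
      unfolding tr[symmetric] by (simp add: powr_divide)
    ultimately have "R sums ((s + t) powr r * (s / (s + t) * 1 + t / (s + t) * 1))"
      unfolding R_def by (intro sums_mult sums_add)
    moreover have "(s + t) powr r * (s / (s + t) * 1 + t / (s + t) * 1) = (s + t) powr r"
      using 3 by (simp add: add_divide_distrib[symmetric])
    ultimately have R: "R sums ((s + t) powr r)" by (simp only:)
    have "(\<Sum>n. (a n + b n) powr r) \<le> (\<Sum>n. R n)"
    proof (rule suminf_le)
      show "(a n + b n) powr r \<le> R n" for n
        unfolding R_def by (rule powr_add_le[OF r ab 3])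
    qed (use summable_powr_add[OF r ab sum] sums_summable[OF R] in auto)
    then have "(\<Sum>n. (a n + b n) powr r) powr (1 / r) \<le> ((s + t) powr r) powr (1 / r)"
      using r sums_unique[OF R] summable_powr_add[OF r ab sum]
      by (intro powr_mono2) (auto intro!: suminf_nonneg)
    also have "\<dots> = s + t" using 3 r by (simp add: powr_powr)
    finally show ?thesis by (simp add: s_def t_def)
  qed
qed

locale lr_sum_of_normed_spaces =
  fixes X :: "nat \<Rightarrow> 'a normed_module" and r :: real
  assumes normed: "\<And>n. normed_space (X n)" and r: "1 \<le> r"
begin

abbreviation "Y \<equiv> lr_sum r X"

lemma carrier_iff:
  "x \<in> carrier Y \<longleftrightarrow> (\<forall>n. x n \<in> carrier (X n)) \<and> summable (\<lambda>n. vnorm (X n) (x n) powr r)"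
  by (simp add: lr_sum_def)

lemma closed: "x \<in> carrier Y \<Longrightarrow> x n \<in> carrier (X n)"
  and summable: "x \<in> carrier Y \<Longrightarrow> summable (\<lambda>n. vnorm (X n) (x n) powr r)"
  by (simp_all add: carrier_iff)

lemma lr_zero: "\<zero>\<^bsub>Y\<^esub> = (\<lambda>n. \<zero>\<^bsub>X n\<^esub>)"
  and lr_add: "x \<oplus>\<^bsub>Y\<^esub> y = (\<lambda>n. x n \<oplus>\<^bsub>X n\<^esub> y n)"
  and lr_smult: "a \<odot>\<^bsub>Y\<^esub> x = (\<lambda>n. a \<odot>\<^bsub>X n\<^esub> x n)"
  and lr_vnorm: "vnorm Y x = (\<Sum>n. vnorm (X n) (x n) powr r) powr (1 / r)"
  by (simp_all add: lr_sum_def)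

lemma abelian: "abelian_group (X n)"
  using normed[of n] by (simp add: normed_space_def module_def)

lemmas coord_simps =
  abelian_groupE(1)[OF abelian] abelian_groupE(2)[OF abelian]
  normed_space.smult_closed_real[OF normed] normed_space.vnorm_zero[OF normed]

lemma vnorm_coord_nonneg: "x \<in> carrier (X n) \<Longrightarrow> 0 \<le> vnorm (X n) x"
  by (rule normed_space.vnorm_nonneg[OF normed])

lemma carrier_dominated:
  assumes x: "x \<in> carrier Y" and y: "\<And>n. y n \<in> carrier (X n)"
    and le: "\<And>n. vnorm (X n) (y n) \<le> vnorm (X n) (x n)"
  shows "y \<in> carrier Y" "vnorm Y y \<le> vnorm Y x"
proof -
  have pw: "vnorm (X n) (y n) powr r \<le> vnorm (X n) (x n) powr r" for n
    using le vnorm_coord_nonneg[OF y] r by (intro powr_mono2) auto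
  have s: "summable (\<lambda>n. vnorm (X n) (y n) powr r)"
    by (rule summable_comparison_test'[OF summable[OF x], of 0]) (use pw in auto)
  then show "y \<in> carrier Y" using y by (simp add: carrier_iff)
  show "vnorm Y y \<le> vnorm Y x"
    unfolding lr_vnorm using s r
    by (intro powr_mono2 suminf_le pw summable[OF x] suminf_nonneg) auto
qed

lemma add_closed: "x \<in> carrier Y \<Longrightarrow> y \<in> carrier Y \<Longrightarrow> (\<lambda>n. x n \<oplus>\<^bsub>X n\<^esub> y n) \<in> carrier Y"
  and triangle: "x \<in> carrier Y \<Longrightarrow> y \<in> carrier Y \<Longrightarrow> vnorm Y (\<lambda>n. x n \<oplus>\<^bsub>X n\<^esub> y n) \<le> vnorm Y x + vnorm Y y"
proof -
  assume x: "x \<in> carrier Y" and y: "y \<in> carrier Y"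
  have nn: "0 \<le> vnorm (X n) (x n)" "0 \<le> vnorm (X n) (y n)" "0 \<le> vnorm (X n) (x n \<oplus>\<^bsub>X n\<^esub> y n)" for n
    using closed[OF x] closed[OF y] by (auto intro!: vnorm_coord_nonneg coord_simps)
  have pw: "vnorm (X n) (x n \<oplus>\<^bsub>X n\<^esub> y n) powr r \<le> (vnorm (X n) (x n) + vnorm (X n) (y n)) powr r" for n
    using normed_space.vnorm_triangle[OF normed closed[OF x] closed[OF y], of n] nn[of n] r
    by (intro powr_mono2) auto
  note s = summable_powr_add[OF r nn(1,2) summable[OF x] summable[OF y]]
  have s': "summable (\<lambda>n. vnorm (X n) (x n \<oplus>\<^bsub>X n\<^esub> y n) powr r)"
    by (rule summable_comparison_test'[OF s, of 0]) (use pw in auto)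
  then show "(\<lambda>n. x n \<oplus>\<^bsub>X n\<^esub> y n) \<in> carrier Y"
    using closed[OF x] closed[OF y] by (simp add: carrier_iff coord_simps)
  have "vnorm Y (\<lambda>n. x n \<oplus>\<^bsub>X n\<^esub> y n) \<le> (\<Sum>n. (vnorm (X n) (x n) + vnorm (X n) (y n)) powr r) powr (1 / r)"
    unfolding lr_vnorm using s s' r by (intro powr_mono2 suminf_le pw suminf_nonneg) auto
  also have "\<dots> \<le> vnorm Y x + vnorm Y y"
    unfolding lr_vnorm by (rule minkowski_inequality[OF r nn(1,2) summable[OF x] summable[OF y]])
  finally show "vnorm Y (\<lambda>n. x n \<oplus>\<^bsub>X n\<^esub> y n) \<le> vnorm Y x + vnorm Y y" .
qed

lemma smult_powr:
  assumes "x \<in> carrier Y"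
  shows "vnorm (X n) (a \<odot>\<^bsub>X n\<^esub> x n) powr r = \<bar>a\<bar> powr r * vnorm (X n) (x n) powr r"
  using normed_space.vnorm_smult[OF normed closed[OF assms]] vnorm_coord_nonneg[OF closed[OF assms]]
  by (simp add: powr_mult)

lemma smult_closed: "x \<in> carrier Y \<Longrightarrow> (\<lambda>n. a \<odot>\<^bsub>X n\<^esub> x n) \<in> carrier Y"
  using closed by (simp add: carrier_iff[of "\<lambda>n. a \<odot>\<^bsub>X n\<^esub> x n"] coord_simps smult_powr summable summable_mult)

lemma zero_closed: "(\<lambda>n. \<zero>\<^bsub>X n\<^esub>) \<in> carrier Y"
  by (simp add: carrier_iff coord_simps)

lemma vnorm_powr:
  assumes "x \<in> carrier Y"
  shows "vnorm Y x powr r = (\<Sum>n. vnorm (X n) (x n) powr r)"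
  using suminf_nonneg[OF summable[OF assms]] r by (simp add: lr_vnorm powr_powr)

lemma normed_space_lr_sum: "normed_space Y"
proof (rule normed_space.intro)
  have "abelian_group Y"
  proof (rule abelian_groupI)
    fix x assume x: "x \<in> carrier Y"
    note cx = closed[OF x]
    show "\<zero>\<^bsub>Y\<^esub> \<oplus>\<^bsub>Y\<^esub> x = x" unfolding lr_zero lr_add by (rule ext) (rule abelian_groupE(5)[OF abelian cx])
    show "\<exists>y\<in>carrier Y. y \<oplus>\<^bsub>Y\<^esub> x = \<zero>\<^bsub>Y\<^esub>"
    proof (rule bexI[OF _ smult_closed[OF x, of "-1"]])
      show "(\<lambda>n. - 1 \<odot>\<^bsub>X n\<^esub> x n) \<oplus>\<^bsub>Y\<^esub> x = \<zero>\<^bsub>Y\<^esub>"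
        unfolding lr_zero lr_add
        using normed_space.minus_eq_smult[OF normed cx] abelian_group.l_neg[OF abelian cx] by auto
    qed
  next
    fix x y assume "x \<in> carrier Y" "y \<in> carrier Y"
    note c = closed[OF this(1)] closed[OF this(2)]
    show "x \<oplus>\<^bsub>Y\<^esub> y = y \<oplus>\<^bsub>Y\<^esub> x" unfolding lr_add by (rule ext) (rule abelian_groupE(4)[OF abelian c])
    fix z assume "z \<in> carrier Y"
    note c' = closed[OF this(1)]
    show "x \<oplus>\<^bsub>Y\<^esub> y \<oplus>\<^bsub>Y\<^esub> z = x \<oplus>\<^bsub>Y\<^esub> (y \<oplus>\<^bsub>Y\<^esub> z)"
      unfolding lr_add by (rule ext) (rule abelian_groupE(3)[OF abelian c c'])
  qed (auto simp: lr_add lr_zero add_closed zero_closed)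
  then show "module real_ring Y"
  proof (rule moduleI[OF cring_real_ring])
    fix a b :: real and x assume x: "x \<in> carrier Y"
    note c = closed[OF this]
    show "a \<odot>\<^bsub>Y\<^esub> x \<in> carrier Y" unfolding lr_smult by (rule smult_closed[OF x])
    show "(a \<oplus>\<^bsub>real_ring\<^esub> b) \<odot>\<^bsub>Y\<^esub> x = a \<odot>\<^bsub>Y\<^esub> x \<oplus>\<^bsub>Y\<^esub> b \<odot>\<^bsub>Y\<^esub> x"
      by (simp add: lr_smult lr_add normed_space.smult_add_left[OF normed c])
    show "(a \<otimes>\<^bsub>real_ring\<^esub> b) \<odot>\<^bsub>Y\<^esub> x = a \<odot>\<^bsub>Y\<^esub> (b \<odot>\<^bsub>Y\<^esub> x)"
      by (simp add: lr_smult normed_space.smult_smult[OF normed c])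
    show "\<one>\<^bsub>real_ring\<^esub> \<odot>\<^bsub>Y\<^esub> x = x"
      by (simp add: lr_smult normed_space.smult_one_real[OF normed c])
    fix y assume "y \<in> carrier Y"
    note c' = closed[OF this]
    show "a \<odot>\<^bsub>Y\<^esub> (x \<oplus>\<^bsub>Y\<^esub> y) = a \<odot>\<^bsub>Y\<^esub> x \<oplus>\<^bsub>Y\<^esub> a \<odot>\<^bsub>Y\<^esub> y"
      by (simp add: lr_smult lr_add normed_space.smult_add_right[OF normed c c'])
  qed
  show "normed_space_axioms Y"
  proof
    fix x assume x: "x \<in> carrier Y"
    note c = closed[OF this]
    have "vnorm Y x = 0 \<longleftrightarrow> (\<Sum>n. vnorm (X n) (x n) powr r) = 0"
      using r by (simp add: lr_vnorm)
    also have "\<dots> \<longleftrightarrow> (\<forall>n. vnorm (X n) (x n) powr r = 0)"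
      by (intro suminf_eq_zero_iff summable[OF x]) simp
    also have "\<dots> \<longleftrightarrow> (\<forall>n. x n = \<zero>\<^bsub>X n\<^esub>)"
      using normed_space.vnorm_eq_zero[OF normed c] r by simp
    finally show "vnorm Y x = 0 \<longleftrightarrow> x = \<zero>\<^bsub>Y\<^esub>" by (auto simp: lr_zero)
    have "(\<Sum>n. vnorm (X n) (a \<odot>\<^bsub>X n\<^esub> x n) powr r) = \<bar>a\<bar> powr r * (\<Sum>n. vnorm (X n) (x n) powr r)" for a
      unfolding smult_powr[OF x] by (rule suminf_mult[OF summable[OF x]])
    then show "vnorm Y (a \<odot>\<^bsub>Y\<^esub> x) = \<bar>a\<bar> * vnorm Y x" for a
      using r suminf_nonneg[OF summable[OF x]] by (simp add: lr_vnorm lr_smult powr_mult powr_powr)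
    fix y assume "y \<in> carrier Y"
    then show "vnorm Y (x \<oplus>\<^bsub>Y\<^esub> y) \<le> vnorm Y x + vnorm Y y" using triangle[OF x] by (simp add: lr_add)
  qed
qed

sublocale Y: normed_space Y by (rule normed_space_lr_sum)

lemma lr_minus:
  assumes "x \<in> carrier Y" "y \<in> carrier Y"
  shows "x \<ominus>\<^bsub>Y\<^esub> y = (\<lambda>n. x n \<ominus>\<^bsub>X n\<^esub> y n)"
  using assms closed[OF assms(2)]
  by (simp add: a_minus_def Y.minus_eq_smult normed_space.minus_eq_smult[OF normed] lr_add lr_smult)

lemma vnorm_coord_le:
  assumes "x \<in> carrier Y"
  shows "vnorm (X n) (x n) \<le> vnorm Y x"
proof -
  have "vnorm (X n) (x n) powr r \<le> vnorm Y x powr r"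
    unfolding vnorm_powr[OF assms] using sum_le_suminf[OF summable[OF assms], of "{n}"] by simp
  then show ?thesis
    using powr_mono2[of "1 / r" "vnorm (X n) (x n) powr r" "vnorm Y x powr r"] r
      vnorm_coord_nonneg[OF closed[OF assms]] Y.vnorm_nonneg[OF assms] by (simp add: powr_powr)
qed

definition tail :: "nat \<Rightarrow> (nat \<Rightarrow> 'a) \<Rightarrow> nat \<Rightarrow> 'a" where
  "tail N x n = (if n < N then \<zero>\<^bsub>X n\<^esub> else x n)"

definition single :: "nat \<Rightarrow> 'a \<Rightarrow> nat \<Rightarrow> 'a" where
  "single n a k = (if k = n then a else \<zero>\<^bsub>X k\<^esub>)"

lemma tail_closed: "x \<in> carrier Y \<Longrightarrow> tail N x \<in> carrier Y"
  and vnorm_tail_le: "x \<in> carrier Y \<Longrightarrow> vnorm Y (tail N x) \<le> vnorm Y x"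
  by (rule carrier_dominated[of x]; simp add: tail_def closed coord_simps vnorm_coord_nonneg)+

lemma tail_add: "tail N (x \<oplus>\<^bsub>Y\<^esub> y) = tail N x \<oplus>\<^bsub>Y\<^esub> tail N y"
  using abelian_groupE(5)[OF abelian abelian_groupE(2)[OF abelian]] by (auto simp: tail_def lr_add)

lemma tail_smult: "tail N (a \<odot>\<^bsub>Y\<^esub> x) = a \<odot>\<^bsub>Y\<^esub> tail N x"
  by (auto simp: tail_def lr_smult normed_space.smult_zero_right[OF normed])

lemma tail_0 [simp]: "tail 0 x = x"
  by (auto simp: tail_def)

lemma vnorm_tail_powr:
  assumes x: "x \<in> carrier Y"
  shows "vnorm Y (tail N x) powr r = (\<Sum>n. vnorm (X (n + N)) (x (n + N)) powr r)"
proof -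
  have "vnorm Y (tail N x) powr r = (\<Sum>n. vnorm (X n) (tail N x n) powr r)"
    by (rule vnorm_powr[OF tail_closed[OF x]])
  also have "\<dots> = (\<Sum>n. vnorm (X (n + N)) (tail N x (n + N)) powr r) + (\<Sum>n<N. vnorm (X n) (tail N x n) powr r)"
    by (rule suminf_split_initial_segment[OF summable[OF tail_closed[OF x]]])
  also have "\<dots> = (\<Sum>n. vnorm (X (n + N)) (x (n + N)) powr r)"
    by (simp add: tail_def coord_simps)
  finally show ?thesis .
qed

lemma tail_tendsto_zero:
  assumes x: "x \<in> carrier Y"
  shows "(\<lambda>N. vnorm Y (tail N x)) \<longlonglongrightarrow> 0"
proof -
  have "(\<lambda>N. \<Sum>n. vnorm (X (n + N)) (x (n + N)) powr r) \<longlonglongrightarrow> 0"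
    by (rule suminf_exist_split2[OF summable[OF x]])
  then have "(\<lambda>N. vnorm Y (tail N x) powr r) \<longlonglongrightarrow> 0" by (simp add: vnorm_tail_powr[OF x])
  then have "(\<lambda>N. (vnorm Y (tail N x) powr r) powr (1 / r)) \<longlonglongrightarrow> 0"
    using r by (intro tendsto_zero_powrI[where f = "\<lambda>N. vnorm Y (tail N x) powr r" and b = "1 / r"]) auto
  then show ?thesis using r Y.vnorm_nonneg[OF tail_closed[OF x]] by (simp add: powr_powr)
qed

lemma single_closed:
  assumes "a \<in> carrier (X n)"
  shows "single n a \<in> carrier Y" "vnorm Y (single n a) = vnorm (X n) a"
proof -
  have s: "(\<lambda>k. vnorm (X k) (single n a k) powr r) sums (\<Sum>k\<in>{n}. vnorm (X k) (single n a k) powr r)"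
    by (rule sums_finite) (auto simp: single_def coord_simps)
  then show "single n a \<in> carrier Y"
    using assms by (auto simp: carrier_iff single_def coord_simps sums_iff)
  show "vnorm Y (single n a) = vnorm (X n) a"
  proof -
    have "(\<Sum>k. vnorm (X k) (single n a k) powr r) = vnorm (X n) (single n a n) powr r"
      using sums_unique[OF s] by simp
    moreover have "single n a n = a" by (simp add: single_def)
    ultimately show ?thesis using r vnorm_coord_nonneg[OF assms] by (simp add: lr_vnorm powr_powr)
  qed
qed

lemma single_functional:
  assumes \<phi>: "\<phi> \<in> bounded_functionals Y"
  shows "(\<lambda>a. \<phi> (single n a)) \<in> bounded_functionals (X n)"
proof -
  obtain B where B: "B > 0" "\<And>y. y \<in> carrier Y \<Longrightarrow> \<bar>\<phi> y\<bar> \<le> B * vnorm Y y"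
    using Y.functional_bound[OF \<phi>] by metis
  show ?thesis
  proof (rule normed_space.bounded_functionalI[OF normed, where B = B])
    fix a b assume ab: "a \<in> carrier (X n)" "b \<in> carrier (X n)"
    have "single n (a \<oplus>\<^bsub>X n\<^esub> b) = single n a \<oplus>\<^bsub>Y\<^esub> single n b"
      using abelian_groupE(5)[OF abelian abelian_groupE(2)[OF abelian]] by (auto simp: single_def lr_add)
    then show "\<phi> (single n (a \<oplus>\<^bsub>X n\<^esub> b)) = \<phi> (single n a) + \<phi> (single n b)"
      using Y.functional_add[OF \<phi>] single_closed(1)[OF ab(1)] single_closed(1)[OF ab(2)] by simp
  next
    fix c a assume a: "a \<in> carrier (X n)"
    have "single n (c \<odot>\<^bsub>X n\<^esub> a) = c \<odot>\<^bsub>Y\<^esub> single n a"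
      by (auto simp: single_def lr_smult normed_space.smult_zero_right[OF normed])
    then show "\<phi> (single n (c \<odot>\<^bsub>X n\<^esub> a)) = c * \<phi> (single n a)"
      using Y.functional_smult[OF \<phi> single_closed(1)[OF a]] by simp
  next
    fix a assume a: "a \<in> carrier (X n)"
    show "\<bar>\<phi> (single n a)\<bar> \<le> B * vnorm (X n) a"
      using B(2)[OF single_closed(1)[OF a]] single_closed(2)[OF a] by simp
  qed
qed

lemma functional_split:
  assumes \<phi>: "\<phi> \<in> bounded_functionals Y" and x: "x \<in> carrier Y"
  shows "\<phi> x = (\<Sum>n<N. \<phi> (single n (x n))) + \<phi> (tail N x)"
proof (induction N)
  case (Suc N)
  have "tail N x = single N (x N) \<oplus>\<^bsub>Y\<^esub> tail (Suc N) x"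
  proof
    have "x k \<oplus>\<^bsub>X k\<^esub> \<zero>\<^bsub>X k\<^esub> = x k" "\<zero>\<^bsub>X k\<^esub> \<oplus>\<^bsub>X k\<^esub> x k = x k"
      "\<zero>\<^bsub>X k\<^esub> \<oplus>\<^bsub>X k\<^esub> \<zero>\<^bsub>X k\<^esub> = \<zero>\<^bsub>X k\<^esub>" for k
    proof -
      interpret Xk: normed_space "X k" by (rule normed)
      show "x k \<oplus>\<^bsub>X k\<^esub> \<zero>\<^bsub>X k\<^esub> = x k" "\<zero>\<^bsub>X k\<^esub> \<oplus>\<^bsub>X k\<^esub> x k = x k"
        "\<zero>\<^bsub>X k\<^esub> \<oplus>\<^bsub>X k\<^esub> \<zero>\<^bsub>X k\<^esub> = \<zero>\<^bsub>X k\<^esub>"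
        using closed[OF x] by simp_all
    qed
    then show "tail N x n = (single N (x N) \<oplus>\<^bsub>Y\<^esub> tail (Suc N) x) n" for n
      by (auto simp: tail_def single_def lr_add less_Suc_eq)
  qed
  then have "\<phi> (tail N x) = \<phi> (single N (x N)) + \<phi> (tail (Suc N) x)"
    using Y.functional_add[OF \<phi> single_closed(1)[OF closed[OF x]] tail_closed[OF x]] by simp
  with Suc show ?case by simp
qed simp

end

section \<open>Weakly compact subsets of the \<open>\<ell>\<^sup>r\<close>-sum\<close>

context lr_sum_of_normed_spaces
begin

text \<open>
  Otherwise there are disjointly supported blocks of norm at most \<open>R\<close> on which \<open>\<phi>\<close> is at least \<open>\<eta>\<close>.  The
  sum of \<open>k\<close> of them has norm at most \<open>k\<^bsup>1/r\<^esup> R\<close>, while \<open>\<phi>\<close> is at least \<open>k \<eta>\<close> there; for \<open>r > 1\<close> and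
  large \<open>k\<close> this is impossible.
\<close>
lemma functional_tail_uniform:
  assumes r1: "1 < r" and \<phi>: "\<phi> \<in> bounded_functionals Y" and \<eta>: "0 < \<eta>" and R: "0 \<le> R"
  shows "\<forall>\<^sub>F M in sequentially. \<forall>x\<in>carrier Y. vnorm Y x \<le> R \<longrightarrow> \<bar>\<phi> (tail M x)\<bar> \<le> \<eta>"
proof (rule ccontr)
  assume "\<not> ?thesis"
  then have large: "\<exists>M\<ge>M0. \<exists>x\<in>carrier Y. vnorm Y x \<le> R \<and> \<eta> < \<bar>\<phi> (tail M x)\<bar>" for M0
    by (auto simp: eventually_sequentially not_le)
  obtain B where B: "B > 0" "\<And>y. y \<in> carrier Y \<Longrightarrow> \<bar>\<phi> y\<bar> \<le> B * vnorm Y y"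
    using Y.functional_bound[OF \<phi>] by metis
  have block: "\<exists>u\<in>carrier Y. \<exists>L. (\<forall>n. n < M0 \<or> L \<le> n \<longrightarrow> u n = \<zero>\<^bsub>X n\<^esub>) \<and> vnorm Y u \<le> R \<and> \<eta> \<le> \<phi> u" for M0
  proof -
    obtain N x where N: "N \<ge> M0" and x: "x \<in> carrier Y" and xR: "vnorm Y x \<le> R" and big: "\<eta> < \<bar>\<phi> (tail N x)\<bar>"
      using large by blast
    have "(\<lambda>L. B * vnorm Y (tail L x)) \<longlonglongrightarrow> B * 0"
      by (intro tendsto_mult tendsto_const tail_tendsto_zero x)
    then have "\<forall>\<^sub>F L in sequentially. B * vnorm Y (tail L x) < \<bar>\<phi> (tail N x)\<bar> - \<eta>"
      using big by (intro order_tendstoD) auto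
    then have "\<forall>\<^sub>F L in sequentially. B * vnorm Y (tail L x) < \<bar>\<phi> (tail N x)\<bar> - \<eta> \<and> N \<le> L"
      using eventually_ge_at_top by eventually_elim auto
    then obtain L where L: "B * vnorm Y (tail L x) < \<bar>\<phi> (tail N x)\<bar> - \<eta>" "N \<le> L"
      by (auto dest: eventually_happens)
    define u where "u n = (if N \<le> n \<and> n < L then x n else \<zero>\<^bsub>X n\<^esub>)" for n
    have uY: "u \<in> carrier Y" and uR: "vnorm Y u \<le> vnorm Y x"
      by (rule carrier_dominated[OF x]; simp add: u_def closed[OF x] coord_simps vnorm_coord_nonneg)+
    have "tail N x = u \<oplus>\<^bsub>Y\<^esub> tail L x"
    proof
      fix n
      interpret Xn: normed_space "X n" by (rule normed)
      show "tail N x n = (u \<oplus>\<^bsub>Y\<^esub> tail L x) n"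
        using L(2) closed[OF x, of n] by (auto simp: tail_def u_def lr_add)
    qed
    then have "\<phi> (tail N x) = \<phi> u + \<phi> (tail L x)"
      using Y.functional_add[OF \<phi> uY tail_closed[OF x]] by simp
    then have \<phi>u: "\<eta> < \<bar>\<phi> u\<bar>" using B(2)[OF tail_closed[OF x, of L]] L(1) by linarith
    define v where "v = (if 0 \<le> \<phi> u then 1 else -1) \<odot>\<^bsub>Y\<^esub> u"
    have "v \<in> carrier Y" using uY by (simp add: v_def)
    moreover have "\<forall>n. n < M0 \<or> L \<le> n \<longrightarrow> v n = \<zero>\<^bsub>X n\<^esub>"
      using N by (auto simp: v_def u_def lr_smult normed_space.smult_zero_right[OF normed])
    moreover have "vnorm Y v \<le> R" using uR xR uY by (simp add: v_def Y.vnorm_smult)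
    moreover have "\<eta> \<le> \<phi> v" using \<phi>u by (auto simp: v_def Y.functional_smult[OF \<phi> uY])
    ultimately show ?thesis by blast
  qed
  have blocks: "\<exists>v\<in>carrier Y. \<exists>M. (\<forall>n\<ge>M. v n = \<zero>\<^bsub>X n\<^esub>) \<and> vnorm Y v powr r \<le> real k * R powr r \<and> real k * \<eta> \<le> \<phi> v" for k
  proof (induction k)
    case 0
    have "\<zero>\<^bsub>Y\<^esub> \<in> carrier Y" by simp
    then show ?case
      using r by (intro bexI[of _ "\<zero>\<^bsub>Y\<^esub>"] exI[of _ 0]) (auto simp: lr_zero[symmetric] Y.functional_zero[OF \<phi>], simp add: lr_zero)
  next
    case (Suc k)
    then obtain v M where v: "v \<in> carrier Y" "\<forall>n\<ge>M. v n = \<zero>\<^bsub>X n\<^esub>" "vnorm Y v powr r \<le> real k * R powr r" "real k * \<eta> \<le> \<phi> v"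
      by blast
    obtain u L where u: "u \<in> carrier Y" "\<forall>n. n < M \<or> L \<le> n \<longrightarrow> u n = \<zero>\<^bsub>X n\<^esub>" "vnorm Y u \<le> R" "\<eta> \<le> \<phi> u"
      using block[of M] by blast
    have vu: "v \<oplus>\<^bsub>Y\<^esub> u \<in> carrier Y" using v(1) u(1) by simp
    have "vnorm (X n) ((v \<oplus>\<^bsub>Y\<^esub> u) n) powr r = vnorm (X n) (v n) powr r + vnorm (X n) (u n) powr r" for n
    proof -
      interpret Xn: normed_space "X n" by (rule normed)
      show ?thesis
        using v(2) u(2) closed[OF v(1), of n] closed[OF u(1), of n] by (cases "n < M") (auto simp: lr_add)
    qed
    then have "vnorm Y (v \<oplus>\<^bsub>Y\<^esub> u) powr r = vnorm Y v powr r + vnorm Y u powr r"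
      by (simp add: vnorm_powr vu v(1) u(1) suminf_add[OF summable[OF v(1)] summable[OF u(1)], symmetric])
    also have "\<dots> \<le> real k * R powr r + R powr r"
      using v(3) u(3) r Y.vnorm_nonneg[OF u(1)] by (intro add_mono powr_mono2) auto
    finally have "vnorm Y (v \<oplus>\<^bsub>Y\<^esub> u) powr r \<le> real (Suc k) * R powr r" by (simp add: algebra_simps)
    moreover have "real (Suc k) * \<eta> \<le> \<phi> (v \<oplus>\<^bsub>Y\<^esub> u)"
      using v(4) u(4) by (simp add: Y.functional_add[OF \<phi> v(1) u(1)] algebra_simps)
    moreover have "\<forall>n\<ge>max M L. (v \<oplus>\<^bsub>Y\<^esub> u) n = \<zero>\<^bsub>X n\<^esub>"
      using v(2) u(2) abelian_groupE(5)[OF abelian abelian_groupE(2)[OF abelian]] by (auto simp: lr_add)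
    ultimately show ?case using vu by blast
  qed
  \<comment> \<open>The two bounds on \<open>\<phi> v\<close> will give \<open>k\<^sup>s \<le> B R / \<eta>\<close>, which fails for large \<open>k\<close>.\<close>
  define s where "s = 1 - 1 / r"
  have s: "s > 0" using r1 by (simp add: s_def)
  define C where "C = B * R / \<eta> + 1"
  have C: "C > 0" using B(1) R \<eta> by (simp add: C_def add_nonneg_pos)
  obtain k :: nat where "C powr (1 / s) < real k" using reals_Archimedean2 by blast
  moreover then have k0: "real k > 0" using powr_ge_zero[of C "1/s"] by linarith
  ultimately have "(C powr (1 / s)) powr s < real k powr s"
    using s by (intro powr_less_mono2) auto
  then have kC: "C < real k powr s" using s C by (simp add: powr_powr)
  obtain v where v: "v \<in> carrier Y" "vnorm Y v powr r \<le> real k * R powr r" "real k * \<eta> \<le> \<phi> v"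
    using blocks[of k] by blast
  have "(vnorm Y v powr r) powr (1 / r) \<le> (real k * R powr r) powr (1 / r)"
    using v(2) r by (intro powr_mono2) auto
  then have "vnorm Y v \<le> real k powr (1 / r) * R"
    using r R Y.vnorm_nonneg[OF v(1)] by (simp add: powr_powr powr_mult)
  then have "real k * \<eta> \<le> B * (real k powr (1 / r) * R)"
    using v(3) B(2)[OF v(1)] B(1) mult_left_mono[of "vnorm Y v" "real k powr (1 / r) * R" B] by linarith
  moreover have "real k = real k powr (1 / r) * real k powr s"
    using k0 by (simp add: s_def powr_add[symmetric])
  ultimately have "(real k powr (1 / r) * real k powr s) * \<eta> \<le> B * (real k powr (1 / r) * R)"
    by metis
  then have "real k powr (1 / r) * (real k powr s * \<eta>) \<le> real k powr (1 / r) * (B * R)"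
    by (simp only: mult.assoc mult.left_commute)
  then have "real k powr s * \<eta> \<le> B * R"
    using k0 by (simp add: mult_le_cancel_left_pos)
  then have "real k powr s \<le> B * R / \<eta>" using \<eta> by (simp add: pos_le_divide_eq)
  then show False using kC by (simp add: C_def)
qed

text \<open>
  The two shapes of weakly compact sets in one definition: \<open>N = (\<lambda>_. 0)\<close> and a constant \<open>c\<close> give a
  bounded set, and \<open>c\<close> tending to zero gives a set with uniformly small tails.
\<close>
definition tail_box :: "(nat \<Rightarrow> 'a set) \<Rightarrow> (nat \<Rightarrow> nat) \<Rightarrow> (nat \<Rightarrow> real) \<Rightarrow> (nat \<Rightarrow> 'a) set" where
  "tail_box W N c = {x \<in> carrier Y. (\<forall>n. x n \<in> W n) \<and> (\<forall>j. vnorm Y (tail (N j) x) \<le> c j)}"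

abbreviation "coord_topology \<equiv> product_topology (\<lambda>n. weak_topology (X n)) UNIV"

lemma topspace_coord_topology: "topspace coord_topology = (\<Pi>\<^sub>E n\<in>UNIV. carrier (X n))"
  by (simp add: normed_space.topspace_weak_topology[OF normed])

text \<open>
  The norm of each coordinate is weakly lower semicontinuous: near \<open>x\<close> it is bounded below by a
  functional that norms the coordinate of \<open>x\<close>.
\<close>
lemma closedin_partial_norm:
  assumes "finite A"
  shows "closedin coord_topology {x \<in> topspace coord_topology. (\<Sum>n\<in>A. vnorm (X n) (x n) powr r) \<le> c}"
proof -
  let ?g = "\<lambda>x. \<Sum>n\<in>A. vnorm (X n) (x n) powr r"
  have "openin coord_topology {x \<in> topspace coord_topology. c < ?g x}"
  proof (subst openin_subopen, intro ballI)
    fix x assume "x \<in> {x \<in> topspace coord_topology. c < ?g x}"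
    then have x: "x \<in> topspace coord_topology" and gx: "c < ?g x" by auto
    have xX: "x n \<in> carrier (X n)" for n using x unfolding topspace_coord_topology by auto
    have "\<exists>\<phi>\<in>bounded_functionals (X n). \<phi> (x n) = vnorm (X n) (x n) \<and>
        (\<forall>y\<in>carrier (X n). \<bar>\<phi> y\<bar> \<le> vnorm (X n) y)" for n
      using normed_space.norming_functional[OF normed xX[of n]] by metis
    then obtain \<phi> where \<phi>: "\<And>n. \<phi> n \<in> bounded_functionals (X n)" "\<And>n. \<phi> n (x n) = vnorm (X n) (x n)"
      "\<And>n y. y \<in> carrier (X n) \<Longrightarrow> \<bar>\<phi> n y\<bar> \<le> vnorm (X n) y" by metis
    let ?h = "\<lambda>y. \<Sum>n\<in>A. \<bar>\<phi> n (y n)\<bar> powr r"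
    have "continuous_map coord_topology euclidean (\<lambda>y. \<phi> n (y n))" for n
      using continuous_map_compose[OF continuous_map_product_projection[of n UNIV "\<lambda>n. weak_topology (X n)"]
          normed_space.continuous_map_functional[OF normed \<phi>(1)]]
      by (simp add: o_def)
    moreover have "continuous_map euclidean euclidean (\<lambda>t::real. \<bar>t\<bar> powr r)"
    proof -
      have "continuous_on UNIV (\<lambda>t::real. \<bar>t\<bar> powr r)"
        by (rule continuous_on_powr') (use r in \<open>auto intro!: continuous_intros\<close>)
      then show ?thesis by simp
    qed
    ultimately have "continuous_map coord_topology euclidean (\<lambda>y. \<bar>\<phi> n (y n)\<bar> powr r)" for n
      using continuous_map_compose[of coord_topology euclidean "\<lambda>y. \<phi> n (y n)" euclidean "\<lambda>t. \<bar>t\<bar> powr r"]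
      by (simp add: o_def)
    then have "continuous_map coord_topology euclidean ?h"
      using assms by (intro continuous_map_sum) auto
    then have "openin coord_topology {y \<in> topspace coord_topology. ?h y \<in> {c<..}}"
      by (rule openin_continuous_map_preimage) simp
    moreover have "?h x = ?g x" using \<phi>(2) vnorm_coord_nonneg[OF xX] by simp
    moreover have "?h y \<le> ?g y" if "y \<in> topspace coord_topology" for y
      using that[unfolded topspace_coord_topology] \<phi>(3) r by (intro sum_mono powr_mono2) auto
    ultimately show "\<exists>T. openin coord_topology T \<and> x \<in> T \<and> T \<subseteq> {x \<in> topspace coord_topology. c < ?g x}"
      using x gx by (intro exI[of _ "{y \<in> topspace coord_topology. ?h y \<in> {c<..}}"]) force
  qed
  moreover have "topspace coord_topology - {x \<in> topspace coord_topology. ?g x \<le> c} = {x \<in> topspace coord_topology. c < ?g x}"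
    by auto
  ultimately show ?thesis by (simp add: closedin_def)
qed

text \<open>
  The constraints on tails are expressed by finitely many coordinates at a time, which makes the box
  closed in the product of the weak topologies.  Its elements lie in the sum because the constraint
  for \<open>j = 0\<close> bounds the partial sums of the series of norms.
\<close>
lemma tail_box_eq:
  assumes W: "\<And>n. W n \<subseteq> carrier (X n)" and c: "\<And>j. 0 \<le> c j"
  shows "tail_box W N c = (\<Pi>\<^sub>E n\<in>UNIV. W n) \<inter>
    (\<Inter>jm. case jm of (j, m) \<Rightarrow> {x \<in> topspace coord_topology. (\<Sum>n\<in>{N j..<N j + m}. vnorm (X n) (x n) powr r) \<le> c j powr r})"
    (is "_ = ?P \<inter> (\<Inter>jm. ?V jm)")
proof (intro Set.set_eqI iffI)
  have shift: "(\<Sum>n\<in>{N j..<N j + m}. f n) = (\<Sum>n<m. f (n + N j))" for j m and f :: "nat \<Rightarrow> real"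
    using sum.shift_bounds_nat_ivl[of f 0 "N j" m] by (simp add: lessThan_atLeast0 add.commute)
  fix x
  {
    assume "x \<in> tail_box W N c"
    then have x: "x \<in> carrier Y" and xW: "\<And>n. x n \<in> W n" and le: "\<And>j. vnorm Y (tail (N j) x) \<le> c j"
      by (auto simp: tail_box_def)
    have "(\<Sum>n<m. vnorm (X (n + N j)) (x (n + N j)) powr r) \<le> c j powr r" for j m
    proof -
      have "(\<Sum>n<m. vnorm (X (n + N j)) (x (n + N j)) powr r) \<le> (\<Sum>n. vnorm (X (n + N j)) (x (n + N j)) powr r)"
        by (intro sum_le_suminf summable_ignore_initial_segment[OF summable[OF x]]) auto
      also have "\<dots> = vnorm Y (tail (N j) x) powr r" by (simp add: vnorm_tail_powr[OF x])
      also have "\<dots> \<le> c j powr r"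
        using le[of j] r Y.vnorm_nonneg[OF tail_closed[OF x]] by (intro powr_mono2) auto
      finally show ?thesis .
    qed
    moreover have "x n \<in> carrier (X n)" for n using xW W by blast
    ultimately show "x \<in> ?P \<inter> (\<Inter>jm. ?V jm)"
      using xW unfolding topspace_coord_topology by (auto simp: shift)
  next
    assume "x \<in> ?P \<inter> (\<Inter>jm. ?V jm)"
    then have xW: "\<And>n. x n \<in> W n" and V: "\<And>j m. x \<in> ?V (j, m)" by blast+
    have le: "(\<Sum>n<m. vnorm (X (n + N j)) (x (n + N j)) powr r) \<le> c j powr r" for j m
      using V[of j m] by (simp add: shift)
    have s: "summable (\<lambda>n. vnorm (X (n + N j)) (x (n + N j)) powr r)" for j
      by (rule bounded_imp_summable[where B = "c j powr r"])
        (use le[of j] in \<open>auto simp: lessThan_Suc_atMost[symmetric] simp del: sum.lessThan_Suc\<close>)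
    have "summable (\<lambda>n. vnorm (X n) (x n) powr r)" using s[of 0] by (subst (asm) summable_iff_shift)
    then have x: "x \<in> carrier Y" using xW W by (auto simp: carrier_iff)
    have "vnorm Y (tail (N j) x) \<le> c j" for j
    proof -
      have "vnorm Y (tail (N j) x) powr r \<le> c j powr r"
        unfolding vnorm_tail_powr[OF x] by (rule suminf_le_const[OF s le])
      then have "(vnorm Y (tail (N j) x) powr r) powr (1 / r) \<le> (c j powr r) powr (1 / r)"
        using r by (intro powr_mono2[of "1 / r" "vnorm Y (tail (N j) x) powr r"]) auto
      then show ?thesis using r c Y.vnorm_nonneg[OF tail_closed[OF x]] by (simp add: powr_powr)
    qed
    then show "x \<in> tail_box W N c" using x xW by (simp add: tail_box_def)
  }
qed

text \<open>
  The box is compact in the product topology by Tychonoff's theorem.  The condition on tails makes each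
  bounded functional a uniform limit of functions of finitely many coordinates, so that the identity
  is continuous from the product topology of the box to the weak topology.
\<close>
theorem weakly_compact_tail_box:
  assumes W: "\<And>n. weakly_compact (X n) (W n)" and c: "\<And>j. 0 \<le> c j"
    and unif: "\<And>\<phi> \<eta>. \<phi> \<in> bounded_functionals Y \<Longrightarrow> 0 < \<eta> \<Longrightarrow>
        \<forall>\<^sub>F M in sequentially. \<forall>x\<in>tail_box W N c. \<bar>\<phi> (tail M x)\<bar> \<le> \<eta>"
  shows "weakly_compact Y (tail_box W N c)"
proof -
  let ?V = "tail_box W N c"
  have WX: "W n \<subseteq> carrier (X n)" for n
    using compactin_subset_topspace[OF W[of n, unfolded weakly_compact_def]]
    by (simp add: normed_space.topspace_weak_topology[OF normed])
  have "compactin coord_topology (\<Pi>\<^sub>E n\<in>UNIV. W n)"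
    using W by (simp add: compactin_PiE weakly_compact_def)
  moreover have "closedin coord_topology
      (\<Inter>jm. case jm of (j, m) \<Rightarrow> {x \<in> topspace coord_topology. (\<Sum>n\<in>{N j..<N j + m}. vnorm (X n) (x n) powr r) \<le> c j powr r})"
    by (intro closedin_Inter) (auto simp del: topspace_product_topology intro!: closedin_partial_norm)
  ultimately have comp: "compactin coord_topology ?V"
    unfolding tail_box_eq[of W c N, OF WX c] by (intro compact_Int_closedin)
  let ?T = "subtopology coord_topology ?V"
  have VX: "?V \<subseteq> carrier Y" by (auto simp: tail_box_def)
  have VT: "?V \<subseteq> topspace coord_topology" by (rule compactin_subset_topspace[OF comp])
  then have topT: "topspace ?T = ?V" by (rule topspace_subtopology_subset)
  have cont: "continuous_map ?T euclidean \<phi>" if \<phi>: "\<phi> \<in> bounded_functionals Y" for \<phi>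
  proof -
    have "continuous_map ?T Met_TC.mtopology \<phi>"
    proof (rule Met_TC.continuous_map_uniform_limit)
      have "continuous_map ?T euclidean (\<lambda>x. \<phi> (single n (x n)))" for n
        using continuous_map_compose[OF continuous_map_from_subtopology[OF
              continuous_map_product_projection[of n UNIV "\<lambda>n. weak_topology (X n)"]]
            normed_space.continuous_map_functional[OF normed single_functional[OF \<phi>]]]
        by (simp add: o_def)
      then show "\<forall>\<^sub>F M in sequentially. continuous_map ?T Met_TC.mtopology (\<lambda>x. \<Sum>n<M. \<phi> (single n (x n)))"
        by (intro always_eventually allI) (simp add: continuous_map_sum)
    next
      fix \<epsilon> :: real assume "0 < \<epsilon>"
      then have "\<forall>\<^sub>F M in sequentially. \<forall>x\<in>?V. \<bar>\<phi> (tail M x)\<bar> \<le> \<epsilon> / 2" by (intro unif \<phi>) simp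
      then show "\<forall>\<^sub>F M in sequentially. \<forall>x\<in>topspace ?T. \<phi> x \<in> UNIV \<and> dist (\<Sum>n<M. \<phi> (single n (x n))) (\<phi> x) < \<epsilon>"
      proof eventually_elim
        case (elim M)
        show ?case
        proof
          fix x assume "x \<in> topspace ?T"
          then have x: "x \<in> ?V" using topT by simp
          have "\<phi> x = (\<Sum>n<M. \<phi> (single n (x n))) + \<phi> (tail M x)"
            using functional_split[OF \<phi>] x VX by blast
          then show "\<phi> x \<in> UNIV \<and> dist (\<Sum>n<M. \<phi> (single n (x n))) (\<phi> x) < \<epsilon>"
            using elim[rule_format, OF x] \<open>0 < \<epsilon>\<close> by (simp add: dist_real_def)
        qed
      qed
    qed simp
    then show ?thesis by simp
  qed
  have "continuous_map ?T (weak_topology Y) (\<lambda>x. x)"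
    unfolding weak_topology_def[of Y]
  proof (rule continuous_on_generated_topo)
    show "(\<lambda>x. x) ` topspace ?T \<subseteq> \<Union>{{x \<in> carrier Y. \<phi> x \<in> U} |\<phi> U. \<phi> \<in> bounded_functionals Y \<and> open U}"
      using Y.topspace_weak_topology VX topT
      unfolding weak_topology_def[of Y] topology_generated_by_topspace by simp
    fix S assume "S \<in> {{x \<in> carrier Y. \<phi> x \<in> U} |\<phi> U. \<phi> \<in> bounded_functionals Y \<and> open U}"
    then obtain \<phi> U where S: "S = {x \<in> carrier Y. \<phi> x \<in> U}" and \<phi>: "\<phi> \<in> bounded_functionals Y" and U: "open U"
      by auto
    have "(\<lambda>x. x) -` S \<inter> topspace ?T = {x \<in> topspace ?T. \<phi> x \<in> U}" using VX topT by (auto simp: S)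
    then show "openin ?T ((\<lambda>x. x) -` S \<inter> topspace ?T)"
      using openin_continuous_map_preimage[OF cont[OF \<phi>]] U by simp
  qed
  moreover have "compactin ?T ?V" using comp by (simp add: compactin_subtopology)
  ultimately have "compactin (weak_topology Y) ((\<lambda>x. x) ` ?V)" by (rule image_compactin[rotated])
  then show ?thesis by (simp add: weakly_compact_def)
qed

text \<open>
  A bounded functional is small on small vectors, so uniformly small tails suffice for every \<open>r \<ge> 1\<close>.
\<close>
lemma weakly_compact_tail_box_of_decay:
  assumes W: "\<And>n. weakly_compact (X n) (W n)" and c: "\<And>j. 0 \<le> c j" "c \<longlonglongrightarrow> 0"
  shows "weakly_compact Y (tail_box W N c)"
proof (rule weakly_compact_tail_box[OF W c(1)])
  fix \<phi> and \<eta> :: real assume \<phi>: "\<phi> \<in> bounded_functionals Y" and \<eta>: "0 < \<eta>"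
  obtain B where B: "B > 0" "\<And>y. y \<in> carrier Y \<Longrightarrow> \<bar>\<phi> y\<bar> \<le> B * vnorm Y y"
    using Y.functional_bound[OF \<phi>] by metis
  have "\<forall>\<^sub>F j in sequentially. c j < \<eta> / B" using c(2) B(1) \<eta> by (intro order_tendstoD) auto
  then obtain j where j: "c j < \<eta> / B" by (auto dest: eventually_happens)
  show "\<forall>\<^sub>F M in sequentially. \<forall>x\<in>tail_box W N c. \<bar>\<phi> (tail M x)\<bar> \<le> \<eta>"
    using eventually_ge_at_top[of "N j"]
  proof eventually_elim
    case (elim M)
    show ?case
    proof
      fix x assume "x \<in> tail_box W N c"
      then have x: "x \<in> carrier Y" and le: "vnorm Y (tail (N j) x) \<le> c j" by (auto simp: tail_box_def)
      have "tail M x = tail M (tail (N j) x)" using elim by (auto simp: tail_def)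
      then have "vnorm Y (tail M x) \<le> c j"
        using vnorm_tail_le[OF tail_closed[OF x], of M "N j"] le by simp
      then have "B * vnorm Y (tail M x) \<le> B * (\<eta> / B)" using j B(1) by (intro mult_left_mono) auto
      then show "\<bar>\<phi> (tail M x)\<bar> \<le> \<eta>" using B(2)[OF tail_closed[OF x, of M]] B(1) by simp
    qed
  qed
qed

lemma weakly_compact_bounded_box:
  assumes r1: "1 < r" and W: "\<And>n. weakly_compact (X n) (W n)" and R: "0 \<le> R"
  shows "weakly_compact Y (tail_box W (\<lambda>_. 0) (\<lambda>_. R))"
proof (rule weakly_compact_tail_box[OF W R])
  fix \<phi> and \<eta> :: real assume \<phi>: "\<phi> \<in> bounded_functionals Y" and \<eta>: "0 < \<eta>"
  show "\<forall>\<^sub>F M in sequentially. \<forall>x\<in>tail_box W (\<lambda>_. 0) (\<lambda>_. R). \<bar>\<phi> (tail M x)\<bar> \<le> \<eta>"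
    using functional_tail_uniform[OF r1 \<phi> \<eta> R] by eventually_elim (auto simp: tail_box_def)
qed

end

section \<open>Measurability, Markov inequality and the property of the sum\<close>

lemma (in finite_measure) measure_UN_geometric_le:
  fixes A :: "nat \<Rightarrow> 'a set"
  assumes A: "\<And>n. A n \<in> sets M" "\<And>n. measure M (A n) \<le> d * (1/2) ^ Suc n"
  shows "measure M (\<Union>n. A n) \<le> d"
proof -
  have g: "(\<lambda>n. d * (1/2) ^ Suc n) sums (d * 1)"
    by (intro sums_mult power_half_series)
  have s: "summable (\<lambda>n. measure M (A n))"
    by (rule summable_comparison_test'[OF sums_summable[OF g], of 0]) (use A in auto)
  have "measure M (\<Union>n. A n) \<le> (\<Sum>n. measure M (A n))"
    using A(1) s by (intro finite_measure_subadditive_countably) auto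
  also have "\<dots> \<le> (\<Sum>n. d * (1/2) ^ Suc n)"
    by (intro suminf_le A s sums_summable[OF g])
  also have "\<dots> = d" using sums_unique[OF g] by simp
  finally show ?thesis .
qed

context normed_space
begin

lemma Metric_space_norm_dist: "Metric_space (carrier X) (norm_dist X)"
proof
  fix x y z
  show "0 \<le> norm_dist X x y" by (simp add: norm_dist_def vnorm_nonneg)
  show "norm_dist X x y = norm_dist X y x" by (simp add: norm_dist_def vnorm_minus_commute)
  assume x: "x \<in> carrier X" and y: "y \<in> carrier X"
  then show "norm_dist X x y = 0 \<longleftrightarrow> x = y"
    by (simp add: norm_dist_def vnorm_eq_zero minus_eq_zero_iff)
  assume "z \<in> carrier X"
  then show "norm_dist X x z \<le> norm_dist X x y + norm_dist X y z"
    using x y by (simp add: norm_dist_def vnorm_minus_triangle)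
qed

lemma openin_norm_topology:
  "openin (norm_topology X) U \<longleftrightarrow>
     U \<subseteq> carrier X \<and> (\<forall>x\<in>U. \<exists>e>0. \<forall>y\<in>carrier X. vnorm X (x \<ominus> y) < e \<longrightarrow> y \<in> U)"
proof -
  interpret D: Metric_space "carrier X" "norm_dist X" by (rule Metric_space_norm_dist)
  have "D.mball x e \<subseteq> U \<longleftrightarrow> (\<forall>y\<in>carrier X. vnorm X (x \<ominus> y) < e \<longrightarrow> y \<in> U)"
    if "x \<in> carrier X" for x e
    using that by (auto simp: D.mball_def norm_dist_def)
  then show ?thesis
    unfolding norm_topology_def D.openin_mtopology by blast
qed

lemma norm_open_Pow: "{U. openin (norm_topology X) U} \<subseteq> Pow (carrier X)"
  by (auto simp: openin_norm_topology)

lemma space_norm_borel: "space (norm_borel X) = carrier X"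
  unfolding norm_borel_def by (rule space_measure_of[OF norm_open_Pow])

lemma norm_open_in_borel: "openin (norm_topology X) U \<Longrightarrow> U \<in> sets (norm_borel X)"
  unfolding norm_borel_def using norm_open_Pow by (auto simp: sets_measure_of)

lemma measurable_vnorm: "vnorm X \<in> borel_measurable (norm_borel X)"
  unfolding borel_measurable_iff_greater space_norm_borel
proof
  fix a
  have "openin (norm_topology X) {x \<in> carrier X. a < vnorm X x}"
    unfolding openin_norm_topology
  proof (intro conjI ballI)
    fix x assume "x \<in> {x \<in> carrier X. a < vnorm X x}"
    then have x: "x \<in> carrier X" "a < vnorm X x" by auto
    have "a < vnorm X y" if "y \<in> carrier X" "vnorm X (x \<ominus> y) < vnorm X x - a" for y
      using vnorm_diff_le[OF x(1) that(1)] that(2) by linarith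
    then show "\<exists>e>0. \<forall>y\<in>carrier X. vnorm X (x \<ominus> y) < e \<longrightarrow> y \<in> {x \<in> carrier X. a < vnorm X x}"
      using x by (intro exI[of _ "vnorm X x - a"]) auto
  qed auto
  then show "{x \<in> carrier X. a < vnorm X x} \<in> sets (norm_borel X)" by (rule norm_open_in_borel)
qed

text \<open>
  A map that does not increase distances is continuous, hence Borel measurable.
\<close>
lemma measurable_norm_contraction:
  assumes Z: "normed_space Z" and T: "\<And>x. x \<in> carrier X \<Longrightarrow> T x \<in> carrier Z"
    and le: "\<And>x y. x \<in> carrier X \<Longrightarrow> y \<in> carrier X \<Longrightarrow> vnorm Z (T x \<ominus>\<^bsub>Z\<^esub> T y) \<le> vnorm X (x \<ominus> y)"
  shows "T \<in> measurable (norm_borel X) (norm_borel Z)"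
proof -
  interpret Z: normed_space Z by fact
  show ?thesis
    unfolding norm_borel_def[of Z]
  proof (rule measurable_measure_of[OF Z.norm_open_Pow])
    show "T \<in> space (norm_borel X) \<rightarrow> carrier Z" using T by (simp add: space_norm_borel)
    fix U assume "U \<in> {U. openin (norm_topology Z) U}"
    then have U: "\<And>x. x \<in> U \<Longrightarrow> \<exists>e>0. \<forall>y\<in>carrier Z. vnorm Z (x \<ominus>\<^bsub>Z\<^esub> y) < e \<longrightarrow> y \<in> U"
      by (simp add: Z.openin_norm_topology)
    have "openin (norm_topology X) (T -` U \<inter> carrier X)"
      unfolding openin_norm_topology
    proof (intro conjI ballI)
      fix x assume "x \<in> T -` U \<inter> carrier X"
      then have x: "T x \<in> U" "x \<in> carrier X" by auto
      obtain e where e: "e > 0" "\<And>z. z \<in> carrier Z \<Longrightarrow> vnorm Z (T x \<ominus>\<^bsub>Z\<^esub> z) < e \<Longrightarrow> z \<in> U"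
        using U[OF x(1)] by blast
      show "\<exists>e>0. \<forall>y\<in>carrier X. vnorm X (x \<ominus> y) < e \<longrightarrow> y \<in> T -` U \<inter> carrier X"
        using e(1) T by (intro exI[of _ e]) (auto intro!: e(2) le_less_trans[OF le[OF x(2)]])
    qed auto
    then show "T -` U \<inter> space (norm_borel X) \<in> sets (norm_borel X)"
      unfolding space_norm_borel by (rule norm_open_in_borel)
  qed
qed

lemma Markov_inequality_L1:
  assumes M: "prob_space M" and f: "f \<in> measurable M (norm_borel X)" "bochner_integrable M X f"
    and b: "vnorm (L1 M X) (ae_class M X f) \<le> b" and c: "c > 0"
  shows "{w \<in> space M. c < vnorm X (f w)} \<in> sets M" "measure M {w \<in> space M. c < vnorm X (f w)} \<le> b / c"
proof -
  interpret prob_space M by fact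
  have meas: "(\<lambda>w. vnorm X (f w)) \<in> borel_measurable M"
    using measurable_comp[OF f(1) measurable_vnorm] by (simp add: o_def)
  then show S: "{w \<in> space M. c < vnorm X (f w)} \<in> sets M" by measurable
  have "0 \<le> vnorm (L1 M X) (ae_class M X f)" by (simp add: vnorm_L1[OF f(2)])
  then have b0: "0 \<le> b" using b by simp
  have "emeasure M {w \<in> space M. c < vnorm X (f w)}
      \<le> emeasure M {w \<in> space M. 1 \<le> ennreal (1 / c) * ennreal (vnorm X (f w))}"
  proof (rule emeasure_mono)
    show "{w \<in> space M. 1 \<le> ennreal (1 / c) * ennreal (vnorm X (f w))} \<in> sets M" using meas by measurable
    show "{w \<in> space M. c < vnorm X (f w)} \<subseteq> {w \<in> space M. 1 \<le> ennreal (1 / c) * ennreal (vnorm X (f w))}"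
      using c by (auto simp: ennreal_mult'[symmetric] simp flip: ennreal_1 intro!: ennreal_leI)
  qed
  also have "\<dots> \<le> ennreal (1 / c) * (\<integral>\<^sup>+w. ennreal (vnorm X (f w)) * indicator (space M) w \<partial>M)"
    using meas by (intro nn_integral_Markov_inequality) auto
  also have "(\<integral>\<^sup>+w. ennreal (vnorm X (f w)) * indicator (space M) w \<partial>M) = (\<integral>\<^sup>+w. ennreal (vnorm X (f w)) \<partial>M)"
    by (intro nn_integral_cong) simp
  also have "\<dots> = ennreal (vnorm (L1 M X) (ae_class M X f))"
    by (rule ennreal_vnorm_L1[OF finite_measure_axioms f(2), symmetric])
  also have "ennreal (1 / c) * \<dots> \<le> ennreal (1 / c) * ennreal b"
    using b by (intro mult_left_mono ennreal_leI) auto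
  also have "\<dots> = ennreal (b / c)" using b0 c by (simp add: ennreal_mult'[symmetric])
  finally show "measure M {w \<in> space M. c < vnorm X (f w)} \<le> b / c"
    using b0 c by (simp add: emeasure_eq_measure)
qed

end

context lr_sum_of_normed_spaces
begin

lemma fibrewise_coordinate:
  assumes "prob_space M"
  shows "fibrewise M Y (X n) (\<lambda>w x. x n)"
proof -
  interpret prob_space M by fact
  show ?thesis
    by (intro fibrewise.intro fibrewise_axioms.intro Y.normed_space_axioms normed finite_measure_axioms)
       (auto simp: fibrewise_contraction_def closed vnorm_coord_le lr_add lr_smult)
qed

lemma fibrewise_tail:
  assumes "prob_space M"
  shows "fibrewise M Y Y (\<lambda>w. tail N)"
proof -
  interpret prob_space M by fact
  show ?thesis
    by (intro fibrewise.intro fibrewise_axioms.intro Y.normed_space_axioms finite_measure_axioms)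
       (auto simp: fibrewise_contraction_def tail_closed vnorm_tail_le tail_add tail_smult)
qed

lemma measurable_coordinate: "(\<lambda>x. x n) \<in> measurable (norm_borel Y) (norm_borel (X n))"
proof (rule Y.measurable_norm_contraction[OF normed])
  fix x y assume "x \<in> carrier Y" "y \<in> carrier Y"
  then show "vnorm (X n) (x n \<ominus>\<^bsub>X n\<^esub> y n) \<le> vnorm Y (x \<ominus>\<^bsub>Y\<^esub> y)"
    using vnorm_coord_le[OF Y.M.minus_closed, of x y n] by (simp add: lr_minus)
qed (rule closed)

lemma tail_minus:
  assumes "x \<in> carrier Y" "y \<in> carrier Y"
  shows "tail N (x \<ominus>\<^bsub>Y\<^esub> y) = tail N x \<ominus>\<^bsub>Y\<^esub> tail N y"
  using assms by (simp add: a_minus_def Y.minus_eq_smult tail_add tail_smult tail_closed)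

lemma measurable_tail: "tail N \<in> measurable (norm_borel Y) (norm_borel Y)"
  by (rule Y.measurable_norm_contraction[OF Y.normed_space_axioms tail_closed])
     (simp_all add: tail_minus[symmetric] vnorm_tail_le)

text \<open>
  For \<open>r = 1\<close> the norm is a sum over the coordinates, and vectors with disjoint supports have additive
  norm.
\<close>
lemma vnorm_tail_split:
  assumes r1: "r = 1" and nm: "n \<le> m" and x: "x \<in> carrier Y"
  shows "vnorm Y (tail n x) = vnorm Y (tail m x) + vnorm Y (tail n x \<ominus>\<^bsub>Y\<^esub> tail m x)"
proof -
  have norm: "vnorm Y y = (\<Sum>k. vnorm (X k) (y k))" "summable (\<lambda>k. vnorm (X k) (y k))" if y: "y \<in> carrier Y" for y
  proof -
    have eq: "vnorm (X k) (y k) powr r = vnorm (X k) (y k)" for k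
      using vnorm_coord_nonneg[OF closed[OF y]] r1 by simp
    show "summable (\<lambda>k. vnorm (X k) (y k))" using summable[OF y] by (simp add: eq)
    have "vnorm Y y = vnorm Y y powr r" using Y.vnorm_nonneg[OF y] r1 by simp
    then show "vnorm Y y = (\<Sum>k. vnorm (X k) (y k))" by (simp only: vnorm_powr[OF y] eq)
  qed
  have d: "tail n x \<ominus>\<^bsub>Y\<^esub> tail m x \<in> carrier Y" using tail_closed[OF x] by simp
  have "vnorm (X k) (tail n x k) = vnorm (X k) (tail m x k) + vnorm (X k) ((tail n x \<ominus>\<^bsub>Y\<^esub> tail m x) k)" for k
  proof -
    interpret Xk: normed_space "X k" by (rule normed)
    show ?thesis using nm closed[OF x, of k] tail_closed[OF x] by (auto simp: lr_minus tail_def)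
  qed
  then show ?thesis
    using norm[OF tail_closed[OF x]] norm[OF d] by (simp add: suminf_add)
qed

text \<open>
  The exceptional set consists of the points at which \<open>f\<close> violates one of the constraints on tails.  For
  \<open>r > 1\<close> the only constraint is a bound on the norm, and \<open>K\<close> is bounded.  For \<open>r = 1\<close> the norms of
  the tails decay uniformly on \<open>K\<close>, and \<open>N j\<close> is chosen so that the \<open>j\<close>-th constraint fails with
  probability at most \<open>d 2\<^bsup>-j-1\<^esup>\<close>.
\<close>
lemma exceptional_tails:
  assumes M: "prob_space M" and K: "relatively_weakly_compact (L1 M Y) K" and d: "0 < d"
  obtains N c where
    "\<And>W. (\<And>n. weakly_compact (X n) (W n)) \<Longrightarrow> weakly_compact Y (tail_box W N c)"
    "\<And>F f. F \<in> K \<Longrightarrow> f \<in> F \<Longrightarrow> f \<in> measurable M (norm_borel Y) \<Longrightarrow>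
      (\<Union>j. {w \<in> space M. c j < vnorm Y (tail (N j) (f w))}) \<in> sets M \<and>
      measure M (\<Union>j. {w \<in> space M. c j < vnorm Y (tail (N j) (f w))}) \<le> d"
proof -
  interpret prob_space M by fact
  interpret L: normed_space "L1 M Y" by (rule Y.normed_space_L1[OF finite_measure_axioms])
  have KX: "K \<subseteq> carrier (L1 M Y)" using K by (simp add: relatively_weakly_compact_def)
  have rep: "bochner_integrable M Y f" "F = ae_class M Y f" if F: "F \<in> K" "f \<in> F" for F f
  proof -
    obtain g where "F = ae_class M Y g" using Y.L1_carrierE[of F M] KX F(1) by blast
    then show "bochner_integrable M Y f" "F = ae_class M Y f"
      using F(2) Y.ae_classD(1,3)[of f M g] by auto
  qed
  show thesis
  proof (cases "r = 1")
    case False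
    with r have r1: "1 < r" by simp
    obtain B where B: "\<And>F. F \<in> K \<Longrightarrow> vnorm (L1 M Y) F \<le> B"
      using L.relatively_weakly_compact_bounded[OF K] by blast
    define B' where "B' = max B 0"
    define R where "R = (B' + 1) / d"
    have R: "R > 0" using d by (simp add: R_def B'_def add_nonneg_pos)
    have BR: "B' / R \<le> d" using d by (simp add: R_def B'_def field_simps)
    show thesis
    proof (rule that[of "\<lambda>_. 0" "\<lambda>_. R"])
      show "weakly_compact Y (tail_box W (\<lambda>_. 0) (\<lambda>_. R))" if "\<And>n. weakly_compact (X n) (W n)" for W
        by (rule weakly_compact_bounded_box[OF r1 that]) (use R in auto)
      fix F f assume F: "F \<in> K" "f \<in> F" and f: "f \<in> measurable M (norm_borel Y)"
      have "vnorm (L1 M Y) (ae_class M Y f) \<le> B'"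
        using B[OF F(1)] rep(2)[OF F] by (simp add: B'_def)
      note Markov = Y.Markov_inequality_L1[OF M f rep(1)[OF F] this R]
      then show "(\<Union>j::nat. {w \<in> space M. R < vnorm Y (tail 0 (f w))}) \<in> sets M \<and>
          measure M (\<Union>j::nat. {w \<in> space M. R < vnorm Y (tail 0 (f w))}) \<le> d"
        using BR by simp
    qed
  next
    case True
    define c :: "nat \<Rightarrow> real" where "c j = (1/2) ^ j" for j
    have c: "0 < c j" for j by (simp add: c_def)
    have "\<exists>n. \<forall>F\<in>K. vnorm (L1 M Y) (L1_map M Y (\<lambda>w. tail n) F) \<le> c j * (d * (1/2) ^ Suc j)" for j
    proof (rule Y.L1_uniform_decay[OF finite_measure_axioms])
      show "fibrewise_contraction M Y Y (\<lambda>w. tail n)" for n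
        by (rule fibrewise.p[OF fibrewise_tail[OF M]])
      show "AE w in M. \<forall>x\<in>carrier Y. (\<lambda>n. vnorm Y (tail n x)) \<longlonglongrightarrow> 0"
        by (simp add: tail_tendsto_zero)
      show "0 < c j * (d * (1/2) ^ Suc j)" using c d by simp
    qed (use vnorm_tail_split[OF True] K in auto)
    then obtain N where N: "\<And>j F. F \<in> K \<Longrightarrow>
        vnorm (L1 M Y) (L1_map M Y (\<lambda>w. tail (N j)) F) \<le> c j * (d * (1/2) ^ Suc j)"
      by metis
    show thesis
    proof (rule that[of N c])
      show "weakly_compact Y (tail_box W N c)" if "\<And>n. weakly_compact (X n) (W n)" for W
      proof (rule weakly_compact_tail_box_of_decay[OF that])
        show "c \<longlonglongrightarrow> 0" unfolding c_def by (rule LIMSEQ_power_zero) simp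
      qed (use c less_imp_le in auto)
      fix F f assume F: "F \<in> K" "f \<in> F" and f: "f \<in> measurable M (norm_borel Y)"
      note fb = rep(1)[OF F]
      have le: "vnorm (L1 M Y) (ae_class M Y (\<lambda>w. tail (N j) (f w))) \<le> c j * (d * (1/2) ^ Suc j)" for j
        using N[OF F(1), of j] fibrewise.L1_map_ae_class[OF fibrewise_tail[OF M] fb]
        by (simp add: rep(2)[OF F, symmetric])
      have meas: "(\<lambda>w. tail (N j) (f w)) \<in> measurable M (norm_borel Y)" for j
        using measurable_comp[OF f measurable_tail] by (simp add: o_def)
      have Markov: "{w \<in> space M. c j < vnorm Y (tail (N j) (f w))} \<in> sets M"
        "measure M {w \<in> space M. c j < vnorm Y (tail (N j) (f w))} \<le> c j * (d * (1/2) ^ Suc j) / c j" for j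
        by (rule Y.Markov_inequality_L1[OF M meas[of j]
              fibrewise.bochner_integrable_fibrewise[OF fibrewise_tail[OF M] fb] le[of j] c[of j]])+
      have "measure M {w \<in> space M. c j < vnorm Y (tail (N j) (f w))} \<le> d * (1/2) ^ Suc j" for j
        using Markov(2)[of j] c[of j] by simp
      then show "(\<Union>j. {w \<in> space M. c j < vnorm Y (tail (N j) (f w))}) \<in> sets M \<and>
          measure M (\<Union>j. {w \<in> space M. c j < vnorm Y (tail (N j) (f w))}) \<le> d"
        using Markov(1) by (intro conjI sets.countable_UN measure_UN_geometric_le) auto
    qed
  qed
qed

text \<open>
  Since \<open>measure\<close> vanishes on sets that are not measurable, a lower bound by a positive number also shows that the
  preimage of \<open>W n\<close> is measurable; \<open>d \<le> 1\<close> keeps the bound positive.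
\<close>
lemma coordinate_boxes:
  assumes M: "prob_space M" and K: "relatively_weakly_compact (L1 M Y) K"
    and delta_S: "\<And>n. property_delta_S M (X n)" and d: "0 < d" "d \<le> 1"
  obtains W where "\<And>n. weakly_compact (X n) (W n)"
    "\<And>F f n. F \<in> K \<Longrightarrow> f \<in> F \<Longrightarrow> f \<in> measurable M (norm_borel Y) \<Longrightarrow>
      {w \<in> space M. f w n \<in> W n} \<in> sets M \<and> 1 - d * (1/2) ^ Suc n \<le> measure M {w \<in> space M. f w n \<in> W n}"
proof -
  interpret prob_space M by fact
  have KX: "K \<subseteq> carrier (L1 M Y)" using K by (simp add: relatively_weakly_compact_def)
  have "\<exists>W. weakly_compact (X n) W \<and>
      (\<forall>F\<in>K. \<forall>g\<in>L1_map M (X n) (\<lambda>w x. x n) F. g \<in> measurable M (norm_borel (X n)) \<longrightarrow>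
        measure M (g -` W \<inter> space M) \<ge> 1 - d * (1/2) ^ Suc n)" for n
  proof -
    have "delta_S_set M (X n) (L1_map M (X n) (\<lambda>w x. x n) ` K)"
      using delta_S[of n] fibrewise.relatively_weakly_compact_L1_map[OF fibrewise_coordinate[OF M] K]
      by (simp add: property_delta_S_def)
    moreover have "0 < d * (1/2) ^ Suc n" using d by simp
    ultimately show ?thesis unfolding delta_S_set_def by (auto simp del: power_Suc)
  qed
  then obtain W where W: "\<And>n. weakly_compact (X n) (W n)"
    and large: "\<And>n F g. F \<in> K \<Longrightarrow> g \<in> L1_map M (X n) (\<lambda>w x. x n) F \<Longrightarrow>
      g \<in> measurable M (norm_borel (X n)) \<Longrightarrow> measure M (g -` W n \<inter> space M) \<ge> 1 - d * (1/2) ^ Suc n"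
    by metis
  show thesis
  proof (rule that[of W, OF W])
    fix F f n assume F: "F \<in> K" "f \<in> F" and f: "f \<in> measurable M (norm_borel Y)"
    obtain g where g: "F = ae_class M Y g" using Y.L1_carrierE[of F M] KX F(1) by blast
    have fb: "bochner_integrable M Y f" and Ff: "F = ae_class M Y f"
      using F(2) g Y.ae_classD(1,3)[of f M g] by auto
    have "(\<lambda>w. f w n) \<in> L1_map M (X n) (\<lambda>w x. x n) F"
      unfolding Ff fibrewise.L1_map_ae_class[OF fibrewise_coordinate[OF M] fb]
      by (rule normed_space.ae_class_self[OF normed
            fibrewise.bochner_integrable_fibrewise[OF fibrewise_coordinate[OF M] fb]])
    moreover have "(\<lambda>w. f w n) \<in> measurable M (norm_borel (X n))"
      using measurable_comp[OF f measurable_coordinate] by (simp add: o_def)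
    moreover have "(\<lambda>w. f w n) -` W n \<inter> space M = {w \<in> space M. f w n \<in> W n}" by auto
    ultimately have le: "1 - d * (1/2) ^ Suc n \<le> measure M {w \<in> space M. f w n \<in> W n}"
      using large[OF F(1), of "\<lambda>w. f w n" n] by simp
    have "(1/2::real) ^ Suc n \<le> 1/2" by (simp add: power_le_one)
    then have "d * (1/2) ^ Suc n \<le> 1 * (1/2)" using d by (intro mult_mono) auto
    then have "0 < measure M {w \<in> space M. f w n \<in> W n}" using le by linarith
    then have "{w \<in> space M. f w n \<in> W n} \<in> sets M" using measure_notin_sets by fastforce
    with le show "{w \<in> space M. f w n \<in> W n} \<in> sets M \<and>
        1 - d * (1/2) ^ Suc n \<le> measure M {w \<in> space M. f w n \<in> W n}" by simp
  qed
qed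

text \<open>
  The preimage of the box is exactly the complement of the countably many exceptional sets, those of the
  coordinates and those of the tails, each family having total measure at most \<open>d\<close>.
\<close>
theorem property_delta_S_lr_sum:
  assumes M: "prob_space M" and delta_S: "\<And>n. property_delta_S M (X n)"
  shows "property_delta_S M Y"
  unfolding property_delta_S_def delta_S_set_def
proof (intro allI impI conjI)
  fix K assume K: "relatively_weakly_compact (L1 M Y) K"
  interpret prob_space M by fact
  show "uniformly_integrable M Y K"
    by (rule Y.relatively_weakly_compact_imp_uniformly_integrable[OF M K])
  have KX: "K \<subseteq> carrier (L1 M Y)" using K by (simp add: relatively_weakly_compact_def)
  fix \<delta> :: real assume \<delta>: "0 < \<delta>"
  define d where "d = min \<delta> 1 / 2"
  have d: "0 < d" "d \<le> 1" "2 * d \<le> \<delta>" using \<delta> by (auto simp: d_def)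
  obtain W where W: "\<And>n. weakly_compact (X n) (W n)"
    and large: "\<And>F f n. F \<in> K \<Longrightarrow> f \<in> F \<Longrightarrow> f \<in> measurable M (norm_borel Y) \<Longrightarrow>
      {w \<in> space M. f w n \<in> W n} \<in> sets M \<and> 1 - d * (1/2) ^ Suc n \<le> measure M {w \<in> space M. f w n \<in> W n}"
    using coordinate_boxes[OF M K delta_S d(1,2)] by blast
  obtain N c where box: "\<And>W. (\<And>n. weakly_compact (X n) (W n)) \<Longrightarrow> weakly_compact Y (tail_box W N c)"
    and small: "\<And>F f. F \<in> K \<Longrightarrow> f \<in> F \<Longrightarrow> f \<in> measurable M (norm_borel Y) \<Longrightarrow>
      (\<Union>j. {w \<in> space M. c j < vnorm Y (tail (N j) (f w))}) \<in> sets M \<and>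
      measure M (\<Union>j. {w \<in> space M. c j < vnorm Y (tail (N j) (f w))}) \<le> d"
    using exceptional_tails[OF M K d(1)] by blast
  show "\<exists>V. weakly_compact Y V \<and> (\<forall>F\<in>K. \<forall>f\<in>F. f \<in> measurable M (norm_borel Y) \<longrightarrow>
      measure M (f -` V \<inter> space M) \<ge> 1 - \<delta>)"
  proof (intro exI[of _ "tail_box W N c"] conjI ballI impI)
    show "weakly_compact Y (tail_box W N c)" by (rule box[OF W])
    fix F f assume F: "F \<in> K" "f \<in> F" and f: "f \<in> measurable M (norm_borel Y)"
    define E where "E = (\<Union>j. {w \<in> space M. c j < vnorm Y (tail (N j) (f w))})"
    define A where "A n = space M - {w \<in> space M. f w n \<in> W n}" for n
    have E: "E \<in> sets M" "measure M E \<le> d" using small[OF F f] by (auto simp: E_def)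
    have A: "A n \<in> sets M" "measure M (A n) \<le> d * (1/2) ^ Suc n" for n
      using large[OF F f, of n] prob_compl[of "{w \<in> space M. f w n \<in> W n}"] by (auto simp: A_def)
    have UA: "(\<Union>n. A n) \<in> sets M" "measure M (\<Union>n. A n) \<le> d"
      using A by (auto intro!: measure_UN_geometric_le)
    have "f w \<in> carrier Y" if "w \<in> space M" for w
      using measurable_space[OF f that] by (simp add: Y.space_norm_borel)
    then have eq: "f -` tail_box W N c \<inter> space M = space M - ((\<Union>n. A n) \<union> E)"
      by (auto simp: tail_box_def A_def E_def simp flip: not_le)
    have "measure M ((\<Union>n. A n) \<union> E) \<le> measure M (\<Union>n. A n) + measure M E"
      using UA(1) E(1) by (rule measure_Un_le)
    also have "\<dots> \<le> \<delta>" using UA(2) E(2) d(3) by simp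
    finally show "1 - \<delta> \<le> measure M (f -` tail_box W N c \<inter> space M)"
      unfolding eq using UA(1) E(1) by (simp add: prob_compl)
  qed
qed

end

theorem theorem3p3:
  fixes M :: "'w measure"
    and X :: "nat \<Rightarrow> 'a normed_module"
    and r :: real
  assumes "prob_space M"
    and "\<And>n. banach_space (X n)"
    and "\<And>n. property_delta_S M (X n)"
    and "1 \<le> r"
  shows "property_delta_S M (lr_sum r X)"
proof -
  interpret lr_sum_of_normed_spaces X r
    by (intro lr_sum_of_normed_spaces.intro banach_space.axioms(1) assms)
  show ?thesis by (rule property_delta_S_lr_sum[OF assms(1,3)])
qed

end
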